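(* Let $\mathrm T\subseteq\Omega$ be a set of test truth values with associated sets $\Sigma$ of open and $\mathrm Z$ of closed truth values. Suppose that $\mathrm T=\Sigma\subseteq\Omega_{\lnot\lnot}$ and that finite sets are overt (equivalently, $\bot\in\Sigma$ and $\Sigma$ is closed under binary $\lor$). Write $\mathrm Z_{\lnot\lnot}=\mathrm Z\cap\Omega_{\lnot\lnot}$ and, for $A\subseteq\Omega$, $\lnot A=\{\lnot p\mid p\in A\}$. Then: (1) $\mathrm Z=\{f\in\Omega\mid \lnot f\in\Sigma\}$; (2) $\Sigma=\lnot\mathrm Z$; (3) $\lnot\lnot\mathrm Z=\lnot\Sigma=\mathrm Z_{\lnot\lnot}$; (4) strong condenseness, condenseness and compactness agree; moreover condenseness can be tested just on stable closed subsets: a map $f\colon X\to Y$ is condensed if and only if the truth value of $\exists x\in X.\ f(x)\in F$ is closed for every $F\subseteq Y$ that is closed and $\lnot\lnot$-stable; (5) $\mathrm Z$ is a bounded sublattice of $\Omega$ (finite sets are condensed); (6) $\Sigma\cap\mathrm Z=\{\top,\bot\}=\Sigma\cap\mathrm Z_{\lnot\lnot}$; (7) $\Sigma$ is a dominance for $\mathrm T$ if and only if openness is transitive (an open subset of an open subset of a set $X$ is open in $X$); (8) $\mathrm Z$ is a codominance for $\mathrm T$ if and only if closedness is transitive (a closed subset of a closed subset of $X$ is closed in $X$); and similarly, $\lnot\lnot$-stable closed subsets are subspaces when stable closedness is a transitive relation.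
   Context: Setting: intuitionistic higher-order logic (internal logic of an elementary topos), without excluded middle or choice. $\Omega$ is the set of truth values; $\Omega_{\lnot\lnot}=\{p\in\Omega\mid \lnot\lnot p\Rightarrow p\}$. $\{\top,\bot\}$ denotes the set of decidable truth values (those $p$ with $p\lor\lnot p$). Given an arbitrary $\mathrm T\subseteq\Omega$ (test truth values), define $\Sigma=\{u\in\Omega\mid \forall t\in\mathrm T.\ (u\land t)\in\mathrm T\}$ (open truth values), $\mathrm Z=\{f\in\Omega\mid\forall t\in\mathrm T.\ (f\Rightarrow t)\in\mathrm T\}$ (closed truth values). A subset $A\subseteq X$ is test/open/closed in $X$ if for every $x\in X$ the truth value of $x\in A$ is in $\mathrm T$/$\Sigma$/$\mathrm Z$; it is ($\lnot\lnot$-)stable if these truth values are in $\Omega_{\lnot\lnot}$. A map $f\colon X\to Y$ is: overt if $(\exists x\in X.\ f(x)\in U)\in\Sigma$ for every open $U\subseteq Y$; compact if $(\forall x\in X.\ f(x)\in U)\in\Sigma$ for every open $U\subseteq Y$; condensed if $(\exists x\in X.\ f(x)\in F)\in\mathrm Z$ for every closed $F\subseteq Y$; strongly condensed if $(\forall x\in X.\ f(x)\in A)\in\mathrm T$ for every test $A\subseteq Y$. A set $X$ has one of these properties if $\mathrm{id}_X$ has it. A set is finite if it is the image of $\{0,\dots,n-1\}$ for some natural number $n$. A subset $A\subseteq X$ is a subspace of $X$ if every test subset $B$ of $A$ is of the form $B=A\cap C$ with $C$ a test subset of $X$. $\Sigma$ is a dominance for $\mathrm T$ if $\forall u\in\Sigma\,\forall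 p\in\Omega.\ (u\Rightarrow(p\in\mathrm T))\Rightarrow (u\land p)\in\mathrm T$. $\mathrm Z$ is a codominance for $\mathrm T$ if $\forall f\in\mathrm Z\,\forall p\in\Omega.\ (f\Rightarrow(p\in\mathrm T))\Rightarrow (f\Rightarrow p)\in\mathrm T$. *)

theory Defs
  imports Main
begin

section \<open>Intuitionistic higher-order logic\<close>

text \<open>
  The ambient logic of the theorem is not that of HOL, so it is represented by a deep embedding of
  intuitionistic type theory in the style of Lambek and Scott, with natural numbers and with
  propositional and set extensionality, but without excluded middle and choice. The parameter
  \<open>'b\<close> supplies uninterpreted base types (arbitrary objects of the topos). These may be empty, which
  is why all judgements carry a typing context \<open>\<Delta>\<close>.

  Variables are de Bruijn indices: \<open>V 0\<close> belongs to the innermost binder, and \<open>\<Delta> ! n\<close> is the type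
  of \<open>V n\<close>. A formula is a term of type \<open>\<Omega>\<close>. In a term \<open>\<phi>\<close> placed under a binder, an outer
  term \<open>t\<close> has to be written \<open>\<up>t\<close>.
\<close>

datatype 'b ty =
    Base 'b
  | One
  | Omega ("\<Omega>")
  | NatT ("\<N>")
  | Times "'b ty" "'b ty" (infixr "\<^bold>\<times>" 70)
  | Power "'b ty" ("\<P> _" [90] 90)

datatype 'b tm =
    V nat
  | Star
  | Pr "'b tm" "'b tm" ("\<langle>_, _\<rangle>")
  | Zero
  | Succ "'b tm"
  | Compr "'b ty" "'b tm"
  | Mem "'b tm" "'b tm" (infix "\<^bold>\<in>" 60)
  | Eq "'b tm" "'b tm" (infix "\<^bold>=" 60)
  | Tru ("\<^bold>\<top>")
  | Fls ("\<^bold>\<bottom>")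
  | And "'b tm" "'b tm" (infixr "\<^bold>\<and>" 55)
  | Or "'b tm" "'b tm" (infixr "\<^bold>\<or>" 53)
  | Imp "'b tm" "'b tm" (infixr "\<^bold>\<rightarrow>" 51)
  | Forall "'b ty" "'b tm" ("(\<^bold>\<forall>[_]/ _)" [0, 51] 51)
  | Exists "'b ty" "'b tm" ("(\<^bold>\<exists>[_]/ _)" [0, 51] 51)

inductive typed :: "'b ty list \<Rightarrow> 'b tm \<Rightarrow> 'b ty \<Rightarrow> bool" ("_ \<turnstile> _ \<^bold>: _" [41, 51, 51] 40) where
  "n < length \<Delta> \<Longrightarrow> \<Delta> \<turnstile> V n \<^bold>: \<Delta> ! n"
| "\<Delta> \<turnstile> Star \<^bold>: One"
| "\<Delta> \<turnstile> s \<^bold>: A \<Longrightarrow> \<Delta> \<turnstile> t \<^bold>: B \<Longrightarrow> \<Delta> \<turnstile> \<langle>s, t\<rangle> \<^bold>: A \<^bold>\<times> B"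
| "\<Delta> \<turnstile> Zero \<^bold>: \<N>"
| "\<Delta> \<turnstile> t \<^bold>: \<N> \<Longrightarrow> \<Delta> \<turnstile> Succ t \<^bold>: \<N>"
| "A # \<Delta> \<turnstile> \<phi> \<^bold>: \<Omega> \<Longrightarrow> \<Delta> \<turnstile> Compr A \<phi> \<^bold>: \<P> A"
| "\<Delta> \<turnstile> s \<^bold>: A \<Longrightarrow> \<Delta> \<turnstile> t \<^bold>: \<P> A \<Longrightarrow> \<Delta> \<turnstile> s \<^bold>\<in> t \<^bold>: \<Omega>"
| "\<Delta> \<turnstile> s \<^bold>: A \<Longrightarrow> \<Delta> \<turnstile> t \<^bold>: A \<Longrightarrow> \<Delta> \<turnstile> s \<^bold>= t \<^bold>: \<Omega>"
| "\<Delta> \<turnstile> \<^bold>\<top> \<^bold>: \<Omega>"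
| "\<Delta> \<turnstile> \<^bold>\<bottom> \<^bold>: \<Omega>"
| "\<Delta> \<turnstile> \<phi> \<^bold>: \<Omega> \<Longrightarrow> \<Delta> \<turnstile> \<psi> \<^bold>: \<Omega> \<Longrightarrow> \<Delta> \<turnstile> \<phi> \<^bold>\<and> \<psi> \<^bold>: \<Omega>"
| "\<Delta> \<turnstile> \<phi> \<^bold>: \<Omega> \<Longrightarrow> \<Delta> \<turnstile> \<psi> \<^bold>: \<Omega> \<Longrightarrow> \<Delta> \<turnstile> \<phi> \<^bold>\<or> \<psi> \<^bold>: \<Omega>"
| "\<Delta> \<turnstile> \<phi> \<^bold>: \<Omega> \<Longrightarrow> \<Delta> \<turnstile> \<psi> \<^bold>: \<Omega> \<Longrightarrow> \<Delta> \<turnstile> \<phi> \<^bold>\<rightarrow> \<psi> \<^bold>: \<Omega>"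
| "A # \<Delta> \<turnstile> \<phi> \<^bold>: \<Omega> \<Longrightarrow> \<Delta> \<turnstile> \<^bold>\<forall>[A] \<phi> \<^bold>: \<Omega>"
| "A # \<Delta> \<turnstile> \<phi> \<^bold>: \<Omega> \<Longrightarrow> \<Delta> \<turnstile> \<^bold>\<exists>[A] \<phi> \<^bold>: \<Omega>"

primrec ren :: "(nat \<Rightarrow> nat) \<Rightarrow> 'b tm \<Rightarrow> 'b tm" where
  "ren r (V n) = V (r n)"
| "ren r Star = Star"
| "ren r \<langle>s, t\<rangle> = \<langle>ren r s, ren r t\<rangle>"
| "ren r Zero = Zero"
| "ren r (Succ t) = Succ (ren r t)"
| "ren r (Compr A \<phi>) = Compr A (ren (case_nat 0 (Suc \<circ> r)) \<phi>)"
| "ren r (s \<^bold>\<in> t) = (ren r s \<^bold>\<in> ren r t)"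
| "ren r (s \<^bold>= t) = (ren r s \<^bold>= ren r t)"
| "ren r \<^bold>\<top> = \<^bold>\<top>"
| "ren r \<^bold>\<bottom> = \<^bold>\<bottom>"
| "ren r (\<phi> \<^bold>\<and> \<psi>) = (ren r \<phi> \<^bold>\<and> ren r \<psi>)"
| "ren r (\<phi> \<^bold>\<or> \<psi>) = (ren r \<phi> \<^bold>\<or> ren r \<psi>)"
| "ren r (\<phi> \<^bold>\<rightarrow> \<psi>) = (ren r \<phi> \<^bold>\<rightarrow> ren r \<psi>)"
| "ren r (\<^bold>\<forall>[A] \<phi>) = (\<^bold>\<forall>[A] ren (case_nat 0 (Suc \<circ> r)) \<phi>)"
| "ren r (\<^bold>\<exists>[A] \<phi>) = (\<^bold>\<exists>[A] ren (case_nat 0 (Suc \<circ> r)) \<phi>)"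

definition shift :: "'b tm \<Rightarrow> 'b tm" ("\<up>_" [1000] 1000) where
  "\<up>t = ren Suc t"

primrec subst :: "(nat \<Rightarrow> 'b tm) \<Rightarrow> 'b tm \<Rightarrow> 'b tm" where
  "subst \<sigma> (V n) = \<sigma> n"
| "subst \<sigma> Star = Star"
| "subst \<sigma> \<langle>s, t\<rangle> = \<langle>subst \<sigma> s, subst \<sigma> t\<rangle>"
| "subst \<sigma> Zero = Zero"
| "subst \<sigma> (Succ t) = Succ (subst \<sigma> t)"
| "subst \<sigma> (Compr A \<phi>) = Compr A (subst (case_nat (V 0) (shift \<circ> \<sigma>)) \<phi>)"
| "subst \<sigma> (s \<^bold>\<in> t) = (subst \<sigma> s \<^bold>\<in> subst \<sigma> t)"
| "subst \<sigma> (s \<^bold>= t) = (subst \<sigma> s \<^bold>= subst \<sigma> t)"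
| "subst \<sigma> \<^bold>\<top> = \<^bold>\<top>"
| "subst \<sigma> \<^bold>\<bottom> = \<^bold>\<bottom>"
| "subst \<sigma> (\<phi> \<^bold>\<and> \<psi>) = (subst \<sigma> \<phi> \<^bold>\<and> subst \<sigma> \<psi>)"
| "subst \<sigma> (\<phi> \<^bold>\<or> \<psi>) = (subst \<sigma> \<phi> \<^bold>\<or> subst \<sigma> \<psi>)"
| "subst \<sigma> (\<phi> \<^bold>\<rightarrow> \<psi>) = (subst \<sigma> \<phi> \<^bold>\<rightarrow> subst \<sigma> \<psi>)"
| "subst \<sigma> (\<^bold>\<forall>[A] \<phi>) = (\<^bold>\<forall>[A] subst (case_nat (V 0) (shift \<circ> \<sigma>)) \<phi>)"
| "subst \<sigma> (\<^bold>\<exists>[A] \<phi>) = (\<^bold>\<exists>[A] subst (case_nat (V 0) (shift \<circ> \<sigma>)) \<phi>)"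

definition inst :: "'b tm \<Rightarrow> 'b tm \<Rightarrow> 'b tm" ("_\<^bold>[_\<^bold>]" [1000, 0] 1000) where
  "\<phi>\<^bold>[t\<^bold>] = subst (case_nat t V) \<phi>"

text \<open>
  Provability in context: \<open>\<Delta> \<parallel> \<Gamma> \<turnstile> \<phi>\<close> says that \<open>\<phi>\<close> is derivable from the (possibly infinite) set \<open>\<Gamma>\<close>
  of hypotheses, where the free variables have the types listed in \<open>\<Delta>\<close>.
\<close>

inductive prv :: "'b ty list \<Rightarrow> 'b tm set \<Rightarrow> 'b tm \<Rightarrow> bool" ("_ \<parallel> _ \<turnstile> _" [41, 41, 51] 40) where
  hyp: "\<phi> \<in> \<Gamma> \<Longrightarrow> \<Delta> \<turnstile> \<phi> \<^bold>: \<Omega> \<Longrightarrow> \<Delta> \<parallel> \<Gamma> \<turnstile> \<phi>"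
| truI: "\<Delta> \<parallel> \<Gamma> \<turnstile> \<^bold>\<top>"
| flsE: "\<Delta> \<parallel> \<Gamma> \<turnstile> \<^bold>\<bottom> \<Longrightarrow> \<Delta> \<turnstile> \<phi> \<^bold>: \<Omega> \<Longrightarrow> \<Delta> \<parallel> \<Gamma> \<turnstile> \<phi>"
| andI: "\<Delta> \<parallel> \<Gamma> \<turnstile> \<phi> \<Longrightarrow> \<Delta> \<parallel> \<Gamma> \<turnstile> \<psi> \<Longrightarrow> \<Delta> \<parallel> \<Gamma> \<turnstile> \<phi> \<^bold>\<and> \<psi>"
| andE1: "\<Delta> \<parallel> \<Gamma> \<turnstile> \<phi> \<^bold>\<and> \<psi> \<Longrightarrow> \<Delta> \<parallel> \<Gamma> \<turnstile> \<phi>"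
| andE2: "\<Delta> \<parallel> \<Gamma> \<turnstile> \<phi> \<^bold>\<and> \<psi> \<Longrightarrow> \<Delta> \<parallel> \<Gamma> \<turnstile> \<psi>"
| orI1: "\<Delta> \<parallel> \<Gamma> \<turnstile> \<phi> \<Longrightarrow> \<Delta> \<turnstile> \<psi> \<^bold>: \<Omega> \<Longrightarrow> \<Delta> \<parallel> \<Gamma> \<turnstile> \<phi> \<^bold>\<or> \<psi>"
| orI2: "\<Delta> \<parallel> \<Gamma> \<turnstile> \<psi> \<Longrightarrow> \<Delta> \<turnstile> \<phi> \<^bold>: \<Omega> \<Longrightarrow> \<Delta> \<parallel> \<Gamma> \<turnstile> \<phi> \<^bold>\<or> \<psi>"
| orE: "\<Delta> \<parallel> \<Gamma> \<turnstile> \<phi> \<^bold>\<or> \<psi> \<Longrightarrow> \<Delta> \<parallel> insert \<phi> \<Gamma> \<turnstile> \<chi> \<Longrightarrow> \<Delta> \<parallel> insert \<psi> \<Gamma> \<turnstile> \<chi> \<Longrightarrow> \<Delta> \<parallel> \<Gamma> \<turnstile> \<chi>"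
| impI: "\<Delta> \<parallel> insert \<phi> \<Gamma> \<turnstile> \<psi> \<Longrightarrow> \<Delta> \<turnstile> \<phi> \<^bold>: \<Omega> \<Longrightarrow> \<Delta> \<parallel> \<Gamma> \<turnstile> \<phi> \<^bold>\<rightarrow> \<psi>"
| impE: "\<Delta> \<parallel> \<Gamma> \<turnstile> \<phi> \<^bold>\<rightarrow> \<psi> \<Longrightarrow> \<Delta> \<parallel> \<Gamma> \<turnstile> \<phi> \<Longrightarrow> \<Delta> \<parallel> \<Gamma> \<turnstile> \<psi>"
| allI: "A # \<Delta> \<parallel> shift ` \<Gamma> \<turnstile> \<phi> \<Longrightarrow> \<Delta> \<parallel> \<Gamma> \<turnstile> \<^bold>\<forall>[A] \<phi>"
| allE: "\<Delta> \<parallel> \<Gamma> \<turnstile> \<^bold>\<forall>[A] \<phi> \<Longrightarrow> \<Delta> \<turnstile> t \<^bold>: A \<Longrightarrow> \<Delta> \<parallel> \<Gamma> \<turnstile> \<phi>\<^bold>[t\<^bold>]"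
| exI: "\<Delta> \<parallel> \<Gamma> \<turnstile> \<phi>\<^bold>[t\<^bold>] \<Longrightarrow> \<Delta> \<turnstile> t \<^bold>: A \<Longrightarrow> A # \<Delta> \<turnstile> \<phi> \<^bold>: \<Omega> \<Longrightarrow> \<Delta> \<parallel> \<Gamma> \<turnstile> \<^bold>\<exists>[A] \<phi>"
| exE: "\<Delta> \<parallel> \<Gamma> \<turnstile> \<^bold>\<exists>[A] \<phi> \<Longrightarrow> A # \<Delta> \<parallel> insert \<phi> (shift ` \<Gamma>) \<turnstile> \<up>\<psi> \<Longrightarrow> \<Delta> \<turnstile> \<psi> \<^bold>: \<Omega> \<Longrightarrow> \<Delta> \<parallel> \<Gamma> \<turnstile> \<psi>"
| eqI: "\<Delta> \<turnstile> t \<^bold>: A \<Longrightarrow> \<Delta> \<parallel> \<Gamma> \<turnstile> t \<^bold>= t"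
| eqE: "\<Delta> \<parallel> \<Gamma> \<turnstile> s \<^bold>= t \<Longrightarrow> \<Delta> \<parallel> \<Gamma> \<turnstile> \<phi>\<^bold>[s\<^bold>] \<Longrightarrow> \<Delta> \<turnstile> s \<^bold>: A \<Longrightarrow> \<Delta> \<turnstile> t \<^bold>: A \<Longrightarrow> A # \<Delta> \<turnstile> \<phi> \<^bold>: \<Omega> \<Longrightarrow>
    \<Delta> \<parallel> \<Gamma> \<turnstile> \<phi>\<^bold>[t\<^bold>]"
| prop_ext: "\<Delta> \<parallel> \<Gamma> \<turnstile> \<phi> \<^bold>\<rightarrow> \<psi> \<Longrightarrow> \<Delta> \<parallel> \<Gamma> \<turnstile> \<psi> \<^bold>\<rightarrow> \<phi> \<Longrightarrow> \<Delta> \<parallel> \<Gamma> \<turnstile> \<phi> \<^bold>= \<psi>"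
| set_ext: "\<Delta> \<parallel> \<Gamma> \<turnstile> \<^bold>\<forall>[A] ((V 0 \<^bold>\<in> \<up>s) \<^bold>= (V 0 \<^bold>\<in> \<up>t)) \<Longrightarrow> \<Delta> \<turnstile> s \<^bold>: \<P> A \<Longrightarrow> \<Delta> \<turnstile> t \<^bold>: \<P> A \<Longrightarrow> \<Delta> \<parallel> \<Gamma> \<turnstile> s \<^bold>= t"
| compr: "A # \<Delta> \<turnstile> \<phi> \<^bold>: \<Omega> \<Longrightarrow> \<Delta> \<turnstile> t \<^bold>: A \<Longrightarrow> \<Delta> \<parallel> \<Gamma> \<turnstile> (t \<^bold>\<in> Compr A \<phi>) \<^bold>= \<phi>\<^bold>[t\<^bold>]"
| star: "\<Delta> \<turnstile> t \<^bold>: One \<Longrightarrow> \<Delta> \<parallel> \<Gamma> \<turnstile> t \<^bold>= Star"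
| pair_inj1: "\<Delta> \<parallel> \<Gamma> \<turnstile> \<langle>s, t\<rangle> \<^bold>= \<langle>s', t'\<rangle> \<Longrightarrow> \<Delta> \<parallel> \<Gamma> \<turnstile> s \<^bold>= s'"
| pair_inj2: "\<Delta> \<parallel> \<Gamma> \<turnstile> \<langle>s, t\<rangle> \<^bold>= \<langle>s', t'\<rangle> \<Longrightarrow> \<Delta> \<parallel> \<Gamma> \<turnstile> t \<^bold>= t'"
| pair_surj: "\<Delta> \<turnstile> t \<^bold>: A \<^bold>\<times> B \<Longrightarrow> \<Delta> \<parallel> \<Gamma> \<turnstile> \<^bold>\<exists>[A] \<^bold>\<exists>[B] (\<up>\<up>t \<^bold>= \<langle>V 1, V 0\<rangle>)"
| succ_neq_zero: "\<Delta> \<parallel> \<Gamma> \<turnstile> Succ t \<^bold>= Zero \<Longrightarrow> \<Delta> \<parallel> \<Gamma> \<turnstile> \<^bold>\<bottom>"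
| succ_inj: "\<Delta> \<parallel> \<Gamma> \<turnstile> Succ s \<^bold>= Succ t \<Longrightarrow> \<Delta> \<parallel> \<Gamma> \<turnstile> s \<^bold>= t"
| nat_induct: "\<Delta> \<parallel> \<Gamma> \<turnstile> Zero \<^bold>\<in> s \<Longrightarrow> \<Delta> \<parallel> \<Gamma> \<turnstile> \<^bold>\<forall>[\<N>] (V 0 \<^bold>\<in> \<up>s \<^bold>\<rightarrow> Succ (V 0) \<^bold>\<in> \<up>s) \<Longrightarrow> \<Delta> \<turnstile> t \<^bold>: \<N> \<Longrightarrow>
    \<Delta> \<parallel> \<Gamma> \<turnstile> t \<^bold>\<in> s"


section \<open>Elementary notions inside the logic\<close>

text \<open>
  From here on everything is an abbreviation for a term of the object logic. A set is a term
  \<open>X\<close> of type \<open>\<P> A\<close> (a variable where sets are quantified over); quantification over all sets is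
  quantification over \<open>X\<close> inside the logic and over the type \<open>A\<close> outside. The term \<open>x \<^bold>\<in> S\<close>
  is itself the truth value of \<open>x \<in> S\<close>, so \<open>(x \<^bold>\<in> S) \<^bold>\<in> W\<close> is meaningful for \<open>W\<close> of type \<open>\<P> \<Omega>\<close>.
\<close>

abbreviation Neg :: "'b tm \<Rightarrow> 'b tm" ("\<^bold>\<not> _" [61] 61) where
  "\<^bold>\<not> \<phi> \<equiv> \<phi> \<^bold>\<rightarrow> \<^bold>\<bottom>"

abbreviation Iff :: "'b tm \<Rightarrow> 'b tm \<Rightarrow> 'b tm" (infix "\<^bold>\<leftrightarrow>" 52) where
  "\<phi> \<^bold>\<leftrightarrow> \<psi> \<equiv> (\<phi> \<^bold>\<rightarrow> \<psi>) \<^bold>\<and> (\<psi> \<^bold>\<rightarrow> \<phi>)"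

text \<open>Bounded quantifiers; \<open>V 0\<close> in \<open>\<phi>\<close> ranges over the elements of \<open>S\<close>, which is of type \<open>\<P> A\<close>.\<close>

abbreviation BForall :: "'b ty \<Rightarrow> 'b tm \<Rightarrow> 'b tm \<Rightarrow> 'b tm" ("(\<^bold>\<forall>[_, _]/ _)" [0, 0, 51] 51) where
  "\<^bold>\<forall>[A, S] \<phi> \<equiv> \<^bold>\<forall>[A] (V 0 \<^bold>\<in> \<up>S \<^bold>\<rightarrow> \<phi>)"

abbreviation BExists :: "'b ty \<Rightarrow> 'b tm \<Rightarrow> 'b tm \<Rightarrow> 'b tm" ("(\<^bold>\<exists>[_, _]/ _)" [0, 0, 51] 51) where
  "\<^bold>\<exists>[A, S] \<phi> \<equiv> \<^bold>\<exists>[A] (V 0 \<^bold>\<in> \<up>S \<^bold>\<and> \<phi>)"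

definition subset :: "'b ty \<Rightarrow> 'b tm \<Rightarrow> 'b tm \<Rightarrow> 'b tm" where
  "subset A S X = (\<^bold>\<forall>[A, S] (V 0 \<^bold>\<in> \<up>X))"

definition inter :: "'b ty \<Rightarrow> 'b tm \<Rightarrow> 'b tm \<Rightarrow> 'b tm" where
  "inter A S X = Compr A (V 0 \<^bold>\<in> \<up>S \<^bold>\<and> V 0 \<^bold>\<in> \<up>X)"

text \<open>A map \<open>f: X \<rightarrow> Y\<close> is a functional relation, given by its graph \<open>f\<close> of type \<open>\<P> (A \<^bold>\<times> B)\<close>.\<close>

definition is_map :: "'b ty \<Rightarrow> 'b ty \<Rightarrow> 'b tm \<Rightarrow> 'b tm \<Rightarrow> 'b tm \<Rightarrow> 'b tm" where
  "is_map A B f X Y =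
     ((\<^bold>\<forall>[A] \<^bold>\<forall>[B] (\<langle>V 1, V 0\<rangle> \<^bold>\<in> \<up>\<up>f \<^bold>\<rightarrow> V 1 \<^bold>\<in> \<up>\<up>X \<^bold>\<and> V 0 \<^bold>\<in> \<up>\<up>Y)) \<^bold>\<and>
      (\<^bold>\<forall>[A, X] \<^bold>\<exists>[B] (\<langle>V 1, V 0\<rangle> \<^bold>\<in> \<up>\<up>f \<^bold>\<and> (\<^bold>\<forall>[B] (\<langle>V 2, V 0\<rangle> \<^bold>\<in> \<up>\<up>\<up>f \<^bold>\<rightarrow> V 0 \<^bold>= V 1)))))"

text \<open>The truth value of \<open>f(x) \<in> S\<close>, where \<open>S\<close> is of type \<open>\<P> B\<close>.\<close>

definition app_in :: "'b ty \<Rightarrow> 'b tm \<Rightarrow> 'b tm \<Rightarrow> 'b tm \<Rightarrow> 'b tm" where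
  "app_in B f x S = (\<^bold>\<exists>[B] (\<langle>\<up>x, V 0\<rangle> \<^bold>\<in> \<up>f \<^bold>\<and> V 0 \<^bold>\<in> \<up>S))"

definition id_map :: "'b ty \<Rightarrow> 'b tm \<Rightarrow> 'b tm" where
  "id_map A X = Compr (A \<^bold>\<times> A) (\<^bold>\<exists>[A, \<up>X] (V 1 \<^bold>= \<langle>V 0, V 0\<rangle>))"

text \<open>\<open>k \<le> n\<close> holds iff \<open>n\<close> is in every set that contains \<open>k\<close> and is closed under successor.\<close>

definition nat_le :: "'b tm \<Rightarrow> 'b tm \<Rightarrow> 'b tm" where
  "nat_le k n = (\<^bold>\<forall>[\<P> \<N>] (\<up>k \<^bold>\<in> V 0 \<^bold>\<and> (\<^bold>\<forall>[\<N>] (V 0 \<^bold>\<in> V 1 \<^bold>\<rightarrow> Succ (V 0) \<^bold>\<in> V 1)) \<^bold>\<rightarrow> \<up>n \<^bold>\<in> V 0))"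

definition nats_below :: "'b tm \<Rightarrow> 'b tm" where
  "nats_below n = Compr \<N> (nat_le (Succ (V 0)) \<up>n)"

text \<open>There are \<open>n\<close> and a map \<open>g\<close> from \<open>{0, \<dots>, n - 1}\<close> to \<open>X\<close> that is onto.\<close>

definition finite_set :: "'b ty \<Rightarrow> 'b tm \<Rightarrow> 'b tm" where
  "finite_set A X =
     (\<^bold>\<exists>[\<N>] \<^bold>\<exists>[\<P> (\<N> \<^bold>\<times> A)]
        (is_map \<N> A (V 0) (nats_below (V 1)) \<up>\<up>X \<^bold>\<and>
         (\<^bold>\<forall>[A, \<up>\<up>X] \<^bold>\<exists>[\<N>] (\<langle>V 0, V 1\<rangle> \<^bold>\<in> V 2))))"


section \<open>Sets of truth values\<close>

definition stable_tv :: "'b tm" ("\<Omega>\<^sub>\<not>\<^sub>\<not>") where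
  "\<Omega>\<^sub>\<not>\<^sub>\<not> = Compr \<Omega> (\<^bold>\<not> \<^bold>\<not> V 0 \<^bold>\<rightarrow> V 0)"

definition decidable_tv :: "'b tm" where
  "decidable_tv = Compr \<Omega> (V 0 \<^bold>\<or> \<^bold>\<not> V 0)"

definition open_tv :: "'b tm \<Rightarrow> 'b tm" where
  "open_tv T = Compr \<Omega> (\<^bold>\<forall>[\<Omega>, \<up>T] ((V 1 \<^bold>\<and> V 0) \<^bold>\<in> \<up>\<up>T))"

definition closed_tv :: "'b tm \<Rightarrow> 'b tm" where
  "closed_tv T = Compr \<Omega> (\<^bold>\<forall>[\<Omega>, \<up>T] ((V 1 \<^bold>\<rightarrow> V 0) \<^bold>\<in> \<up>\<up>T))"

definition stable_closed_tv :: "'b tm \<Rightarrow> 'b tm" where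
  "stable_closed_tv T = inter \<Omega> (closed_tv T) \<Omega>\<^sub>\<not>\<^sub>\<not>"

text \<open>The set \<open>{\<not>q | q \<in> S}\<close>.\<close>

definition neg_set :: "'b tm \<Rightarrow> 'b tm" where
  "neg_set S = Compr \<Omega> (\<^bold>\<exists>[\<Omega>, \<up>S] (V 1 \<^bold>= \<^bold>\<not> V 0))"

definition bounded_sublattice :: "'b tm \<Rightarrow> 'b tm" where
  "bounded_sublattice S =
     (\<^bold>\<top> \<^bold>\<in> S \<^bold>\<and> \<^bold>\<bottom> \<^bold>\<in> S \<^bold>\<and>
      (\<^bold>\<forall>[\<Omega>, S] \<^bold>\<forall>[\<Omega>, \<up>S] ((V 1 \<^bold>\<and> V 0) \<^bold>\<in> \<up>\<up>S \<^bold>\<and> (V 1 \<^bold>\<or> V 0) \<^bold>\<in> \<up>\<up>S)))"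

definition finite_join_closed :: "'b tm \<Rightarrow> 'b tm" where
  "finite_join_closed S = (\<^bold>\<bottom> \<^bold>\<in> S \<^bold>\<and> (\<^bold>\<forall>[\<Omega>, S] \<^bold>\<forall>[\<Omega>, \<up>S] ((V 1 \<^bold>\<or> V 0) \<^bold>\<in> \<up>\<up>S)))"

definition dominance :: "'b tm \<Rightarrow> 'b tm" where
  "dominance T =
     (\<^bold>\<forall>[\<Omega>, open_tv T] \<^bold>\<forall>[\<Omega>] ((V 1 \<^bold>\<rightarrow> V 0 \<^bold>\<in> \<up>\<up>T) \<^bold>\<rightarrow> (V 1 \<^bold>\<and> V 0) \<^bold>\<in> \<up>\<up>T))"

definition codominance :: "'b tm \<Rightarrow> 'b tm" where
  "codominance T =
     (\<^bold>\<forall>[\<Omega>, closed_tv T] \<^bold>\<forall>[\<Omega>] ((V 1 \<^bold>\<rightarrow> V 0 \<^bold>\<in> \<up>\<up>T) \<^bold>\<rightarrow> (V 1 \<^bold>\<rightarrow> V 0) \<^bold>\<in> \<up>\<up>T))"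


section \<open>Subsets and maps\<close>

text \<open>
  \<open>tv_subset A W S X\<close>: \<open>S\<close> is a subset of \<open>X\<close> and the truth value of \<open>x \<in> S\<close> is in \<open>W\<close> for all \<open>x \<in> X\<close>.
  Thus \<open>S\<close> is test, open, closed, or closed and stable in \<open>X\<close> when \<open>W\<close> is \<open>T\<close>, \<open>open_tv T\<close>,
  \<open>closed_tv T\<close>, or \<open>stable_closed_tv T\<close>.
\<close>

definition tv_subset :: "'b ty \<Rightarrow> 'b tm \<Rightarrow> 'b tm \<Rightarrow> 'b tm \<Rightarrow> 'b tm" where
  "tv_subset A W S X = (subset A S X \<^bold>\<and> (\<^bold>\<forall>[A, X] ((V 0 \<^bold>\<in> \<up>S) \<^bold>\<in> \<up>W)))"

text \<open>
  For all \<open>S \<subseteq> Y\<close> with truth values in \<open>W\<close>, the truth value of \<open>\<exists>x \<in> X. f(x) \<in> S\<close> (respectively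
  \<open>\<forall>x \<in> X. f(x) \<in> S\<close>) is in \<open>W'\<close>.
\<close>

definition ex_preserves ::
    "'b ty \<Rightarrow> 'b ty \<Rightarrow> 'b tm \<Rightarrow> 'b tm \<Rightarrow> 'b tm \<Rightarrow> 'b tm \<Rightarrow> 'b tm \<Rightarrow> 'b tm" where
  "ex_preserves A B W W' f X Y =
     (\<^bold>\<forall>[\<P> B] (tv_subset B \<up>W (V 0) \<up>Y \<^bold>\<rightarrow> (\<^bold>\<exists>[A, \<up>X] app_in B \<up>\<up>f (V 0) (V 1)) \<^bold>\<in> \<up>W'))"

definition all_preserves ::
    "'b ty \<Rightarrow> 'b ty \<Rightarrow> 'b tm \<Rightarrow> 'b tm \<Rightarrow> 'b tm \<Rightarrow> 'b tm \<Rightarrow> 'b tm \<Rightarrow> 'b tm" where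
  "all_preserves A B W W' f X Y =
     (\<^bold>\<forall>[\<P> B] (tv_subset B \<up>W (V 0) \<up>Y \<^bold>\<rightarrow> (\<^bold>\<forall>[A, \<up>X] app_in B \<up>\<up>f (V 0) (V 1)) \<^bold>\<in> \<up>W'))"

definition overt :: "'b tm \<Rightarrow> 'b ty \<Rightarrow> 'b ty \<Rightarrow> 'b tm \<Rightarrow> 'b tm \<Rightarrow> 'b tm \<Rightarrow> 'b tm" where
  "overt T A B f X Y = ex_preserves A B (open_tv T) (open_tv T) f X Y"

definition compact_map :: "'b tm \<Rightarrow> 'b ty \<Rightarrow> 'b ty \<Rightarrow> 'b tm \<Rightarrow> 'b tm \<Rightarrow> 'b tm \<Rightarrow> 'b tm" where
  "compact_map T A B f X Y = all_preserves A B (open_tv T) (open_tv T) f X Y"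

definition condensed :: "'b tm \<Rightarrow> 'b ty \<Rightarrow> 'b ty \<Rightarrow> 'b tm \<Rightarrow> 'b tm \<Rightarrow> 'b tm \<Rightarrow> 'b tm" where
  "condensed T A B f X Y = ex_preserves A B (closed_tv T) (closed_tv T) f X Y"

definition strongly_condensed :: "'b tm \<Rightarrow> 'b ty \<Rightarrow> 'b ty \<Rightarrow> 'b tm \<Rightarrow> 'b tm \<Rightarrow> 'b tm \<Rightarrow> 'b tm" where
  "strongly_condensed T A B f X Y = all_preserves A B T T f X Y"

definition condensed_on_stable :: "'b tm \<Rightarrow> 'b ty \<Rightarrow> 'b ty \<Rightarrow> 'b tm \<Rightarrow> 'b tm \<Rightarrow> 'b tm \<Rightarrow> 'b tm" where
  "condensed_on_stable T A B f X Y = ex_preserves A B (stable_closed_tv T) (closed_tv T) f X Y"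

definition finite_sets_overt :: "'b tm \<Rightarrow> 'b ty \<Rightarrow> 'b tm" where
  "finite_sets_overt T A =
     (\<^bold>\<forall>[\<P> A] (finite_set A (V 0) \<^bold>\<rightarrow> overt \<up>T A A (id_map A (V 0)) (V 0) (V 0)))"

definition finite_sets_condensed :: "'b tm \<Rightarrow> 'b ty \<Rightarrow> 'b tm" where
  "finite_sets_condensed T A =
     (\<^bold>\<forall>[\<P> A] (finite_set A (V 0) \<^bold>\<rightarrow> condensed \<up>T A A (id_map A (V 0)) (V 0) (V 0)))"

definition subspace :: "'b tm \<Rightarrow> 'b ty \<Rightarrow> 'b tm \<Rightarrow> 'b tm \<Rightarrow> 'b tm" where
  "subspace T A S X =
     (subset A S X \<^bold>\<and>
      (\<^bold>\<forall>[\<P> A] (tv_subset A \<up>T (V 0) \<up>S \<^bold>\<rightarrow>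
         (\<^bold>\<exists>[\<P> A] (tv_subset A \<up>\<up>T (V 0) \<up>\<up>X \<^bold>\<and> V 1 \<^bold>= inter A \<up>\<up>S (V 0))))))"

text \<open>
  For all sets \<open>X = V 2\<close>, \<open>S = V 1\<close>, \<open>R = V 0\<close>: if \<open>S \<subseteq> X\<close> and \<open>R \<subseteq> S\<close> both have truth values in \<open>W\<close>,
  then so has \<open>R \<subseteq> X\<close>.
\<close>

definition transitive :: "'b tm \<Rightarrow> 'b ty \<Rightarrow> 'b tm" where
  "transitive W A =
     (\<^bold>\<forall>[\<P> A] \<^bold>\<forall>[\<P> A] \<^bold>\<forall>[\<P> A]
        (tv_subset A \<up>\<up>\<up>W (V 1) (V 2) \<^bold>\<and> tv_subset A \<up>\<up>\<up>W (V 0) (V 1) \<^bold>\<rightarrow>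
         tv_subset A \<up>\<up>\<up>W (V 0) (V 2)))"

text \<open>
  A property of all sets is a schema with one instance for every type. As a hypothesis it is
  the set of all its instances.
\<close>

definition tests_are_stable_opens :: "'b tm \<Rightarrow> 'b tm set" where
  "tests_are_stable_opens T = {T \<^bold>= open_tv T, subset \<Omega> (open_tv T) \<Omega>\<^sub>\<not>\<^sub>\<not>}"

definition standing :: "'b tm \<Rightarrow> 'b tm set" where
  "standing T = tests_are_stable_opens T \<union> range (finite_sets_overt T)"

end

theory Submission
  imports Defs
begin

text \<open>
  Derivations are organised by a forcing relation. A world is a typing context together with a
  set of hypotheses, a later world has more variables and more hypotheses, and \<open>w |= \<phi>\<close> means
  that \<open>\<phi>\<close> is derivable at \<open>w\<close>. The rules of natural deduction then read as clauses in the style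
  of Kripke: an implication or a universal quantification holds at \<open>w\<close> iff it holds elementwise
  at all later worlds, quantifiers range over all terms that are typed there, and \<open>\<or>\<close>, \<open>\<exists>\<close> and
  \<open>\<bottom>\<close> are used through their eliminations (as in Beth semantics). New variables are appended at
  the far end of the context, so that a formula is the same term at all later worlds and never
  has to be shifted. Every argument below is thus an intuitionistic proof about elements of
  sets, relative to a world.

  The mathematics rests on \<open>closed_iff\<close>: \<open>f\<close> is closed iff \<open>\<not>f\<close> is open. One direction holds
  because \<open>\<bottom>\<close> is a test truth value. For the other, let \<open>\<not>f\<close> and \<open>t\<close> be open. Then \<open>\<not>f \<or> t\<close> is
  open, hence stable; as \<open>f \<Rightarrow> t\<close> implies its double negation, \<open>f \<Rightarrow> t\<close> equals \<open>\<not>f \<or> t\<close> and is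
  open (\<open>open_imp\<close>). Since \<open>u = \<not>\<not>u\<close> for open \<open>u\<close>, negation is a bijection between open and
  stable closed truth values; the descriptions of these sets by negation, the lattice laws and
  the decidability of truth values that are open and closed follow. Compactness and condenseness
  agree because \<open>\<forall>x. f x \<in> U\<close> is the negation of \<open>\<exists>x. f x \<in> Y - U\<close>, and complementation
  exchanges open and closed subsets of \<open>Y\<close> (\<open>all_in_complement\<close>).

  The (co)dominance laws yield transitivity elementwise, and conversely they are its instances
  for subsets of a one-point set (\<open>transitive_One\<close>). On the closed side the link is that \<open>f \<Rightarrow> p\<close>
  equals \<open>\<not>(f \<and> \<not>p)\<close> if \<open>p\<close> is open as soon as \<open>f\<close> holds (\<open>imp_as_neg\<close>), where \<open>f \<and> \<not>p\<close> is a
  closed part of the closed \<open>f\<close>. Finally, a set of truth values that contains \<open>\<bottom>\<close> and binary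
  joins contains all joins over finite sets, by induction on the number of elements
  (\<open>finite_set_join\<close>); conversely \<open>\<bottom>\<close> and \<open>p \<or> q\<close> are joins over the finite sets \<open>{}\<close> and
  \<open>{0, 1}\<close> (\<open>finite_overt_imp_join\<close>).
\<close>

section \<open>Renaming and substitution\<close>

abbreviation lift :: "(nat \<Rightarrow> nat) \<Rightarrow> nat \<Rightarrow> nat" where
  "lift r \<equiv> case_nat 0 (Suc \<circ> r)"

abbreviation slift :: "(nat \<Rightarrow> 'b tm) \<Rightarrow> nat \<Rightarrow> 'b tm" where
  "slift \<sigma> \<equiv> case_nat (V 0) (shift \<circ> \<sigma>)"

lemma lift_id: "lift (\<lambda>n. n) = (\<lambda>n. n)"
  by (auto simp: fun_eq_iff split: nat.split)

lemma ren_id: "ren (\<lambda>n. n) t = t"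
  by (induction t) (simp_all add: lift_id)

lemma lift_comp: "lift r \<circ> lift s = lift (r \<circ> s)"
  by (auto simp: fun_eq_iff split: nat.split)

lemma ren_ren: "ren r (ren s t) = ren (r \<circ> s) t"
  by (induction t arbitrary: r s) (simp_all add: lift_comp)

lemma slift_lift: "slift \<sigma> \<circ> lift r = slift (\<sigma> \<circ> r)"
  by (auto simp: fun_eq_iff split: nat.split)

lemma subst_ren: "subst \<sigma> (ren r t) = subst (\<sigma> \<circ> r) t"
  by (induction t arbitrary: \<sigma> r) (simp_all add: slift_lift)

lemma ren_slift: "ren (lift r) \<circ> slift \<sigma> = slift (ren r \<circ> \<sigma>)"
  by (auto simp: fun_eq_iff shift_def ren_ren comp_def split: nat.split)

lemma ren_subst: "ren r (subst \<sigma> t) = subst (ren r \<circ> \<sigma>) t"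
  by (induction t arbitrary: \<sigma> r) (simp_all add: ren_slift)

lemma slift_V: "slift V = V"
  by (auto simp: fun_eq_iff shift_def split: nat.split)

lemma subst_V [simp]: "subst V t = t"
  by (induction t) (simp_all add: slift_V)

text \<open>
  With the next lemma, this cancels every shift against the substitution of an instantiated
  quantifier: instances of bounded quantifiers simplify to formulas without shifts.
\<close>

lemma subst_up [simp]: "subst (case_nat s \<sigma>) \<up>t = subst \<sigma> t"
  by (simp add: shift_def subst_ren comp_def)

lemma subst_shift [simp]: "subst (shift \<circ> \<sigma>) t = \<up>(subst \<sigma> t)"
proof -
  have "shift = (ren Suc :: 'a tm \<Rightarrow> 'a tm)" by (simp add: fun_eq_iff shift_def)
  then show ?thesis by (metis ren_subst)
qed

lemma shift_V [simp]: "\<up>(V n) = V (Suc n)"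
  by (simp add: shift_def)

lemma shift_Pr [simp]: "\<up>\<langle>s, t\<rangle> = \<langle>\<up>s, \<up>t\<rangle>"
  by (simp add: shift_def)

lemma ren_shift: "ren (lift r) \<up>t = \<up>(ren r t)"
  by (simp add: shift_def ren_ren comp_def)

lemma ren_inst: "ren r (\<phi>\<^bold>[t\<^bold>]) = (ren (lift r) \<phi>)\<^bold>[ren r t\<^bold>]"
proof -
  have "ren r \<circ> case_nat t V = case_nat (ren r t) V \<circ> lift r"
    by (auto simp: fun_eq_iff split: nat.split)
  then show ?thesis by (simp add: inst_def ren_subst subst_ren)
qed

section \<open>Typing\<close>

text \<open>
  Types are unique, so typing can be computed. In this form the simplifier discharges all typing
  conditions from the types of the parameters.
\<close>

fun tyof :: "'b ty list \<Rightarrow> 'b tm \<Rightarrow> 'b ty option" where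
  "tyof \<Delta> (V n) = (if n < length \<Delta> then Some (\<Delta> ! n) else None)"
| "tyof \<Delta> Star = Some One"
| "tyof \<Delta> \<langle>s, t\<rangle> = (case (tyof \<Delta> s, tyof \<Delta> t) of (Some A, Some B) \<Rightarrow> Some (A \<^bold>\<times> B) | _ \<Rightarrow> None)"
| "tyof \<Delta> Zero = Some \<N>"
| "tyof \<Delta> (Succ t) = (if tyof \<Delta> t = Some \<N> then Some \<N> else None)"
| "tyof \<Delta> (Compr A \<phi>) = (if tyof (A # \<Delta>) \<phi> = Some \<Omega> then Some (\<P> A) else None)"
| "tyof \<Delta> (s \<^bold>\<in> t) = (case tyof \<Delta> s of Some A \<Rightarrow> if tyof \<Delta> t = Some (\<P> A) then Some \<Omega> else None | None \<Rightarrow> None)"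
| "tyof \<Delta> (s \<^bold>= t) = (case tyof \<Delta> s of Some A \<Rightarrow> if tyof \<Delta> t = Some A then Some \<Omega> else None | None \<Rightarrow> None)"
| "tyof \<Delta> \<^bold>\<top> = Some \<Omega>"
| "tyof \<Delta> \<^bold>\<bottom> = Some \<Omega>"
| "tyof \<Delta> (\<phi> \<^bold>\<and> \<psi>) = (if tyof \<Delta> \<phi> = Some \<Omega> \<and> tyof \<Delta> \<psi> = Some \<Omega> then Some \<Omega> else None)"
| "tyof \<Delta> (\<phi> \<^bold>\<or> \<psi>) = (if tyof \<Delta> \<phi> = Some \<Omega> \<and> tyof \<Delta> \<psi> = Some \<Omega> then Some \<Omega> else None)"
| "tyof \<Delta> (\<phi> \<^bold>\<rightarrow> \<psi>) = (if tyof \<Delta> \<phi> = Some \<Omega> \<and> tyof \<Delta> \<psi> = Some \<Omega> then Some \<Omega> else None)"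
| "tyof \<Delta> (\<^bold>\<forall>[A] \<phi>) = (if tyof (A # \<Delta>) \<phi> = Some \<Omega> then Some \<Omega> else None)"
| "tyof \<Delta> (\<^bold>\<exists>[A] \<phi>) = (if tyof (A # \<Delta>) \<phi> = Some \<Omega> then Some \<Omega> else None)"

lemma typed_imp_tyof: "\<Delta> \<turnstile> t \<^bold>: A \<Longrightarrow> tyof \<Delta> t = Some A"
  by (induction rule: typed.induct) auto

lemma tyof_imp_typed: "tyof \<Delta> t = Some A \<Longrightarrow> \<Delta> \<turnstile> t \<^bold>: A"
  by (induction \<Delta> t arbitrary: A rule: tyof.induct)
     (auto intro: typed.intros split: if_splits option.splits)

lemma typed_iff: "\<Delta> \<turnstile> t \<^bold>: A \<longleftrightarrow> tyof \<Delta> t = Some A"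
  using typed_imp_tyof tyof_imp_typed by blast

text \<open>
  The renaming \<open>r\<close> carries the variables of \<open>\<Delta>\<close> to variables of \<open>\<Delta>'\<close> of the same types; indices
  outside \<open>\<Delta>\<close> are unconstrained.
\<close>

definition renames :: "'b ty list \<Rightarrow> 'b ty list \<Rightarrow> (nat \<Rightarrow> nat) \<Rightarrow> bool" where
  "renames \<Delta> \<Delta>' r \<longleftrightarrow> (\<forall>n < length \<Delta>. r n < length \<Delta>' \<and> \<Delta>' ! r n = \<Delta> ! n)"

lemma renames_lift: "renames \<Delta> \<Delta>' r \<Longrightarrow> renames (A # \<Delta>) (A # \<Delta>') (lift r)"
  by (auto simp: renames_def less_Suc_eq_0_disj)

lemma typed_ren: "\<Delta> \<turnstile> t \<^bold>: A \<Longrightarrow> renames \<Delta> \<Delta>' r \<Longrightarrow> \<Delta>' \<turnstile> ren r t \<^bold>: A"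
proof (induction arbitrary: \<Delta>' r rule: typed.induct)
  case (1 n \<Delta>)
  then show ?case using typed.intros(1)[of "r n" \<Delta>'] by (simp add: renames_def)
qed (simp_all, (blast intro: typed.intros renames_lift)+)

lemma typed_slift:
  assumes "\<And>n. n < length \<Delta> \<Longrightarrow> \<Delta>' \<turnstile> \<sigma> n \<^bold>: \<Delta> ! n" and "n < length (B # \<Delta>)"
  shows "B # \<Delta>' \<turnstile> slift \<sigma> n \<^bold>: (B # \<Delta>) ! n"
  using assms(2) assms(1)[of "n - 1"] typed_ren[of \<Delta>' "\<sigma> (n - 1)" _ "B # \<Delta>'" Suc]
  by (cases n) (auto simp: shift_def renames_def typed_iff[of _ "V _"])

lemma typed_subst:
  "\<Delta> \<turnstile> t \<^bold>: A \<Longrightarrow> (\<And>n. n < length \<Delta> \<Longrightarrow> \<Delta>' \<turnstile> \<sigma> n \<^bold>: \<Delta> ! n) \<Longrightarrow> \<Delta>' \<turnstile> subst \<sigma> t \<^bold>: A"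
proof (induction arbitrary: \<Delta>' \<sigma> rule: typed.induct)
  case (6 A \<Delta> \<phi>)
  show ?case using 6(2)[OF typed_slift, OF 6(3)] by (auto intro!: typed.intros)
next
  case (14 A \<Delta> \<phi>)
  show ?case using 14(2)[OF typed_slift, OF 14(3)] by (auto intro!: typed.intros)
next
  case (15 A \<Delta> \<phi>)
  show ?case using 15(2)[OF typed_slift, OF 15(3)] by (auto intro!: typed.intros)
qed (simp_all, (blast intro: typed.intros)+)

lemma typed_inst: "A # \<Delta> \<turnstile> \<phi> \<^bold>: B \<Longrightarrow> \<Delta> \<turnstile> t \<^bold>: A \<Longrightarrow> \<Delta> \<turnstile> \<phi>\<^bold>[t\<^bold>] \<^bold>: B"
  unfolding inst_def
  by (rule typed_subst) (auto simp: less_Suc_eq_0_disj typed_iff[of _ "V _"])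

lemma tyof_ren:
  assumes "\<And>n. tyof \<Delta>' (V (r n)) = tyof \<Delta> (V n)"
  shows "tyof \<Delta>' (ren r t) = tyof \<Delta> t"
  using assms
proof (induction t arbitrary: \<Delta> \<Delta>' r)
  have *: "tyof (B # \<Delta>') (V (lift r n)) = tyof (B # \<Delta>) (V n)"
    if "\<And>n. tyof \<Delta>' (V (r n)) = tyof \<Delta> (V n)" for B r n \<Delta> and \<Delta>' :: "'b ty list"
    using that[of "n - 1"] by (cases n) (auto split: if_splits)
  {
    case (Compr B \<phi>)
    show ?case using Compr.IH[OF *[OF Compr.prems]] by simp
  next
    case (Forall B \<phi>)
    show ?case using Forall.IH[OF *[OF Forall.prems]] by simp
  next
    case (Exists B \<phi>)
    show ?case using Exists.IH[OF *[OF Exists.prems]] by simp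
  }
qed (simp_all del: tyof.simps(1) cong: if_cong option.case_cong)

lemma tyof_shift [simp]: "tyof (B # \<Delta>) \<up>t = tyof \<Delta> t"
  unfolding shift_def by (rule tyof_ren) simp

section \<open>Renaming derivations\<close>

lemma prv_typed: "\<Delta> \<parallel> \<Gamma> \<turnstile> \<phi> \<Longrightarrow> \<Delta> \<turnstile> \<phi> \<^bold>: \<Omega>"
proof (induction rule: prv.induct)
  case (allE \<Delta> \<Gamma> A \<phi> t)
  then show ?case by (auto simp: typed_iff intro: typed_inst[unfolded typed_iff] split: if_splits)
next
  case (eqE \<Delta> \<Gamma> s t \<phi> A)
  then show ?case by (auto simp: typed_iff intro: typed_inst[unfolded typed_iff] split: if_splits)
next
  case (compr A \<Delta> \<phi> t \<Gamma>)
  then show ?case by (auto simp: typed_iff dest: typed_inst[unfolded typed_iff] split: if_splits)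
qed (auto simp: typed_iff split: if_splits option.splits)

text \<open>
  As \<open>\<Gamma>'\<close> may be larger than the image of \<open>\<Gamma>\<close>, this one induction covers both ways in which a
  world can be extended.
\<close>

lemma prv_ren:
  "\<Delta> \<parallel> \<Gamma> \<turnstile> \<phi> \<Longrightarrow> renames \<Delta> \<Delta>' r \<Longrightarrow> ren r ` \<Gamma> \<subseteq> \<Gamma>' \<Longrightarrow> \<Delta>' \<parallel> \<Gamma>' \<turnstile> ren r \<phi>"
proof (induction arbitrary: \<Delta>' r \<Gamma>' rule: prv.induct)
  case (hyp \<phi> \<Gamma> \<Delta>)
  then show ?case by (auto intro!: prv.hyp typed_ren)
next
  case (flsE \<Delta> \<Gamma> \<phi>)
  then show ?case by (auto intro: prv.flsE typed_ren)
next
  case (orI1 \<Delta> \<Gamma> \<phi> \<psi>)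
  then show ?case by (auto intro: prv.orI1 typed_ren)
next
  case (orI2 \<Delta> \<Gamma> \<phi> \<psi>)
  then show ?case by (auto intro: prv.orI2 typed_ren)
next
  case (orE \<Delta> \<Gamma> \<phi> \<psi> \<chi>)
  show ?case
    by (rule prv.orE[OF orE.IH(1)[simplified] orE.IH(2) orE.IH(3)]) (use orE.prems in auto)
next
  case (impI \<Delta> \<phi> \<Gamma> \<psi>)
  show ?case
    by (simp, rule prv.impI[OF impI.IH]) (use impI in \<open>auto intro: typed_ren\<close>)
next
  case (impE \<Delta> \<Gamma> \<phi> \<psi>)
  show ?case by (rule prv.impE[OF impE.IH(1)[simplified] impE.IH(2)]) (use impE.prems in auto)
next
  case (allI A \<Delta> \<Gamma> \<phi>)
  show ?case
    by (simp, rule prv.allI, rule allI.IH)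
       (use allI.prems in \<open>auto simp: ren_shift intro: renames_lift\<close>)
next
  case (allE \<Delta> \<Gamma> A \<phi> t)
  show ?case unfolding ren_inst
    by (rule prv.allE[OF allE.IH[simplified]]) (use allE in \<open>auto intro: typed_ren\<close>)
next
  case (exI \<Delta> \<Gamma> \<phi> t A)
  show ?case
    by (simp, rule prv.exI[OF exI.IH[unfolded ren_inst]])
       (use exI in \<open>auto intro: typed_ren renames_lift\<close>)
next
  case (exE \<Delta> \<Gamma> A \<phi> \<psi>)
  show ?case
  proof (rule prv.exE[OF exE.IH(1)[simplified]])
    show "A # \<Delta>' \<parallel> insert (ren (lift r) \<phi>) (shift ` \<Gamma>') \<turnstile> \<up>(ren r \<psi>)"
      unfolding ren_shift[symmetric]
      by (rule exE.IH(2)) (use exE.prems in \<open>auto simp: ren_shift intro: renames_lift\<close>)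
  qed (use exE in \<open>auto intro: typed_ren\<close>)
next
  case (eqI \<Delta> t A \<Gamma>)
  then show ?case by (auto intro: prv.eqI typed_ren)
next
  case (eqE \<Delta> \<Gamma> s t \<phi> A)
  show ?case unfolding ren_inst
    by (rule prv.eqE[OF eqE.IH(1)[simplified] eqE.IH(2)[unfolded ren_inst]])
       (use eqE in \<open>auto intro: typed_ren renames_lift\<close>)
next
  case (set_ext \<Delta> \<Gamma> A s t)
  show ?case
    by (simp, rule prv.set_ext[of _ _ A])
       (use set_ext.IH[OF set_ext.prems] set_ext in \<open>auto simp: ren_shift intro: typed_ren\<close>)
next
  case (compr A \<Delta> \<phi> t \<Gamma>)
  then show ?case
    by (auto simp: ren_inst intro!: prv.compr typed_ren renames_lift)
next
  case (star \<Delta> t \<Gamma>)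
  then show ?case by (auto intro: prv.star typed_ren)
next
  case (pair_inj1 \<Delta> \<Gamma> s t s' t')
  then show ?case by (auto intro: prv.pair_inj1)
next
  case (pair_inj2 \<Delta> \<Gamma> s t s' t')
  then show ?case by (auto intro: prv.pair_inj2)
next
  case (pair_surj \<Delta> t A B \<Gamma>)
  then show ?case
    using prv.pair_surj[of \<Delta>' "ren r t" A B \<Gamma>'] typed_ren[of \<Delta> t] by (simp add: ren_shift)
next
  case (succ_neq_zero \<Delta> \<Gamma> t)
  show ?case using succ_neq_zero.IH[OF succ_neq_zero.prems] by (auto intro: prv.succ_neq_zero)
next
  case (succ_inj \<Delta> \<Gamma> s t)
  then show ?case by (auto intro: prv.succ_inj)
next
  case (nat_induct \<Delta> \<Gamma> s t)
  show ?case
    by (simp, rule prv.nat_induct)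
       (use nat_induct.IH(1,2)[OF nat_induct.prems] nat_induct in \<open>auto simp: ren_shift intro: typed_ren\<close>)
next
  case (andE1 \<Delta> \<Gamma> \<phi> \<psi>)
  then show ?case by (auto intro: prv.andE1)
next
  case (andE2 \<Delta> \<Gamma> \<phi> \<psi>)
  then show ?case by (auto intro: prv.andE2)
qed (auto intro: prv.truI prv.andI prv.prop_ext)

section \<open>Worlds and forcing\<close>

text \<open>
  Hypotheses have to be well typed, since an ill-typed one is inert but might become well typed,
  and hence usable, when the context is enlarged.
\<close>

typedef 'b world = "{(\<Delta> :: 'b ty list, \<Gamma> :: 'b tm set). \<forall>\<gamma>\<in>\<Gamma>. \<Delta> \<turnstile> \<gamma> \<^bold>: \<Omega>}"
  by blast

definition ctx :: "'b world \<Rightarrow> 'b ty list" where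
  "ctx w = fst (Rep_world w)"

definition hyps :: "'b world \<Rightarrow> 'b tm set" where
  "hyps w = snd (Rep_world w)"

definition world :: "'b ty list \<Rightarrow> 'b tm set \<Rightarrow> 'b world" where
  "world \<Delta> \<Gamma> = Abs_world (\<Delta>, \<Gamma>)"

lemma hyps_typed: "\<gamma> \<in> hyps w \<Longrightarrow> ctx w \<turnstile> \<gamma> \<^bold>: \<Omega>"
  using Rep_world[of w] by (auto simp: ctx_def hyps_def)

lemma world:
  assumes "\<And>\<gamma>. \<gamma> \<in> \<Gamma> \<Longrightarrow> \<Delta> \<turnstile> \<gamma> \<^bold>: \<Omega>"
  shows ctx_world: "ctx (world \<Delta> \<Gamma>) = \<Delta>" and hyps_world: "hyps (world \<Delta> \<Gamma>) = \<Gamma>"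
  using assms by (simp_all add: ctx_def hyps_def world_def Abs_world_inverse)

instantiation world :: (type) preorder
begin

definition less_eq_world :: "'a world \<Rightarrow> 'a world \<Rightarrow> bool" where
  "w \<le> v \<longleftrightarrow> (\<exists>\<Delta>. ctx v = ctx w @ \<Delta>) \<and> hyps w \<subseteq> hyps v"

definition less_world :: "'a world \<Rightarrow> 'a world \<Rightarrow> bool" where
  "w < v \<longleftrightarrow> w \<le> v \<and> \<not> v \<le> (w :: 'a world)"

instance
  by standard (auto simp: less_eq_world_def less_world_def)

end

abbreviation ty :: "'b world \<Rightarrow> 'b tm \<Rightarrow> 'b ty option" where
  "ty w t \<equiv> tyof (ctx w) t"

text \<open>
  The context grows at its end, where the outermost variables live. Variables of \<open>w\<close> therefore
  keep their indices at later worlds, and formulas and terms persist unchanged.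
\<close>

definition forces :: "'b world \<Rightarrow> 'b tm \<Rightarrow> bool" ("_ |= _" [51, 51] 50) where
  "w |= \<phi> \<longleftrightarrow> ctx w \<parallel> hyps w \<turnstile> \<phi>"

lemma renames_append: "renames \<Delta> (\<Delta> @ \<Delta>') (\<lambda>n. n)"
  by (simp add: renames_def nth_append)

lemma force_mono: "w |= \<phi> \<Longrightarrow> w \<le> v \<Longrightarrow> v |= \<phi>"
  unfolding forces_def less_eq_world_def
  using prv_ren[OF _ renames_append, of "ctx w" "hyps w" \<phi> "hyps v"] by (auto simp: ren_id)

lemma ty_mono: "ty w t = Some A \<Longrightarrow> w \<le> v \<Longrightarrow> ty v t = Some A"
  unfolding less_eq_world_def typed_iff[symmetric]
  using typed_ren[OF _ renames_append, of "ctx w" t A] by (auto simp: ren_id)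

lemma ty_mono_under: "tyof (B # ctx w) t = Some A \<Longrightarrow> w \<le> v \<Longrightarrow> tyof (B # ctx v) t = Some A"
  unfolding less_eq_world_def typed_iff[symmetric]
  using typed_ren[OF _ renames_append, of "B # ctx w" t A] by (auto simp: ren_id)

lemma force_ty: "w |= \<phi> \<Longrightarrow> ty w \<phi> = Some \<Omega>"
  unfolding forces_def typed_iff[symmetric] by (rule prv_typed)

lemma ty_inst: "tyof (A # ctx w) \<phi> = Some B \<Longrightarrow> ty w t = Some A \<Longrightarrow> ty w (\<phi>\<^bold>[t\<^bold>]) = Some B"
  using typed_inst by (simp add: typed_iff)

lemma assume_world:
  assumes "ty w \<phi> = Some \<Omega>"
  obtains v where "w \<le> v" "v |= \<phi>" "ctx v = ctx w" "hyps v = insert \<phi> (hyps w)"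
proof
  let ?v = "world (ctx w) (insert \<phi> (hyps w))"
  have *: "\<And>\<gamma>. \<gamma> \<in> insert \<phi> (hyps w) \<Longrightarrow> ctx w \<turnstile> \<gamma> \<^bold>: \<Omega>"
    using assms hyps_typed by (auto simp: typed_iff)
  show 1: "ctx ?v = ctx w" "hyps ?v = insert \<phi> (hyps w)"
    using world[of "insert \<phi> (hyps w)", OF *] by blast+
  show "w \<le> ?v" "?v |= \<phi>"
    using * by (auto simp: less_eq_world_def forces_def 1 intro: prv.hyp)
qed

lemma ren_cong: "\<Delta> \<turnstile> t \<^bold>: A \<Longrightarrow> (\<And>n. n < length \<Delta> \<Longrightarrow> r n = s n) \<Longrightarrow> ren r t = ren s t"
proof (induction arbitrary: r s rule: typed.induct)
  have *: "lift r n = lift s n" if "n < length (A # \<Delta>)" "\<And>n. n < length \<Delta> \<Longrightarrow> r n = s n"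
    for n r s A and \<Delta> :: "'c ty list"
    using that(1) that(2)[of "n - 1"] by (cases n) simp_all
  {
    case (6 A \<Delta> \<phi>)
    show ?case using 6(2)[OF *[OF _ 6(3)]] by simp
  next
    case (14 A \<Delta> \<phi>)
    show ?case using 14(2)[OF *[OF _ 14(3)]] by simp
  next
    case (15 A \<Delta> \<phi>)
    show ?case using 15(2)[OF *[OF _ 15(3)]] by simp
  }
qed ((simp_all (no_asm))?, blast+)

lemma subst_cong: "\<Delta> \<turnstile> t \<^bold>: A \<Longrightarrow> (\<And>n. n < length \<Delta> \<Longrightarrow> \<sigma> n = \<tau> n) \<Longrightarrow> subst \<sigma> t = subst \<tau> t"
proof (induction arbitrary: \<sigma> \<tau> rule: typed.induct)
  have *: "slift \<sigma> n = slift \<tau> n" if "n < length (A # \<Delta>)" "\<And>n. n < length \<Delta> \<Longrightarrow> \<sigma> n = \<tau> n"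
    for n A and \<sigma> \<tau> :: "nat \<Rightarrow> 'd tm" and \<Delta> :: "'c ty list"
    using that(1) that(2)[of "n - 1"] by (cases n) simp_all
  {
    case (6 A \<Delta> \<phi>)
    show ?case using 6(2)[OF *[OF _ 6(3)]] by simp
  next
    case (14 A \<Delta> \<phi>)
    show ?case using 14(2)[OF *[OF _ 14(3)]] by simp
  next
    case (15 A \<Delta> \<phi>)
    show ?case using 15(2)[OF *[OF _ 15(3)]] by simp
  }
qed ((simp_all (no_asm))?, blast+)

text \<open>
  A fresh variable of a world has the highest index \<open>n\<close>, whereas the rules for quantifiers put
  it at index 0. This renaming moves it from the one place to the other.
\<close>

definition rotate_var :: "nat \<Rightarrow> nat \<Rightarrow> nat" where
  "rotate_var n i = (if i < n then Suc i else 0)"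

lemma ren_rotate_old: "\<Delta> \<turnstile> t \<^bold>: A \<Longrightarrow> ren (rotate_var (length \<Delta>)) t = \<up>t"
  unfolding shift_def by (rule ren_cong) (simp_all add: rotate_var_def)

lemma ren_rotate_fresh:
  assumes "A # \<Delta> \<turnstile> \<phi> \<^bold>: B"
  shows "ren (rotate_var (length \<Delta>)) (\<phi>\<^bold>[V (length \<Delta>)\<^bold>]) = \<phi>"
proof -
  let ?r = "rotate_var (length \<Delta>)"
  have "ren ?r (\<phi>\<^bold>[V (length \<Delta>)\<^bold>]) = subst (case_nat (V 0) V \<circ> lift ?r) \<phi>"
    by (simp add: ren_inst) (simp add: inst_def subst_ren rotate_var_def)
  also have "\<dots> = subst V \<phi>"
    by (rule subst_cong[OF assms]) (auto simp: rotate_var_def less_Suc_eq_0_disj)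
  finally show ?thesis by simp
qed

lemma renames_rotate: "renames (\<Delta> @ [A]) (A # \<Delta>) (rotate_var (length \<Delta>))"
  by (auto simp: renames_def rotate_var_def nth_append)

text \<open>
  Types may be empty, so the new variable is a genuine extension of the context.
\<close>

lemma fresh_world:
  obtains v where "w \<le> v" "ctx v = ctx w @ [A]" "hyps v = hyps w"
proof
  let ?v = "world (ctx w @ [A]) (hyps w)"
  have *: "\<And>\<gamma>. \<gamma> \<in> hyps w \<Longrightarrow> ctx w @ [A] \<turnstile> \<gamma> \<^bold>: \<Omega>"
    using typed_ren[OF hyps_typed renames_append] by (simp add: ren_id)
  show 1: "ctx ?v = ctx w @ [A]" "hyps ?v = hyps w"
    using world[of "hyps w", OF *] by blast+
  show "w \<le> ?v" by (simp add: less_eq_world_def 1)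
qed

lemma ren_rotate_hyps: "ren (rotate_var (length (ctx w))) ` hyps w = shift ` hyps w"
  by (rule image_cong) (simp_all add: ren_rotate_old[OF hyps_typed])

lemma forces_fresh:
  assumes "ctx v = ctx w @ [A]" "hyps v = hyps w" "v |= \<phi>"
  shows "A # ctx w \<parallel> shift ` hyps w \<turnstile> ren (rotate_var (length (ctx w))) \<phi>"
  using assms(3) unfolding forces_def assms(1,2)
  by (rule prv_ren[OF _ renames_rotate]) (simp add: ren_rotate_hyps)

lemma prv_imp_insert:
  assumes "\<Delta> \<parallel> \<Gamma> \<turnstile> \<phi> \<^bold>\<rightarrow> \<psi>"
  shows "\<Delta> \<parallel> insert \<phi> \<Gamma> \<turnstile> \<psi>"
proof (rule prv.impE)
  show "\<Delta> \<parallel> insert \<phi> \<Gamma> \<turnstile> \<phi> \<^bold>\<rightarrow> \<psi>"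
    using prv_ren[OF assms renames_append[of \<Delta> "[]"], of "insert \<phi> \<Gamma>"] by (auto simp: ren_id)
  show "\<Delta> \<parallel> insert \<phi> \<Gamma> \<turnstile> \<phi>"
    using prv_typed[OF assms] by (intro prv.hyp) (auto simp: typed_iff split: if_splits)
qed

section \<open>Forcing clauses of the logic\<close>

lemma force_allE: "w |= \<^bold>\<forall>[A] \<phi> \<Longrightarrow> w \<le> v \<Longrightarrow> ty v t = Some A \<Longrightarrow> v |= \<phi>\<^bold>[t\<^bold>]"
  unfolding forces_def by (rule prv.allE) (simp_all add: force_mono[unfolded forces_def] typed_iff)

text \<open>
  It suffices to consider the generic element, which is the variable of a fresh world; moving it
  to index 0 turns the instance of the body back into the body.
\<close>

lemma force_allI:
  assumes ty: "tyof (A # ctx w) \<phi> = Some \<Omega>"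
    and *: "\<And>v t. w \<le> v \<Longrightarrow> ty v t = Some A \<Longrightarrow> v |= \<phi>\<^bold>[t\<^bold>]"
  shows "w |= \<^bold>\<forall>[A] \<phi>"
proof -
  obtain v where v: "w \<le> v" "ctx v = ctx w @ [A]" "hyps v = hyps w" by (rule fresh_world)
  let ?n = "length (ctx w)"
  have "v |= \<phi>\<^bold>[V ?n\<^bold>]" by (rule *) (simp_all add: v)
  then have "A # ctx w \<parallel> shift ` hyps w \<turnstile> \<phi>"
    using forces_fresh[OF v(2,3)] ren_rotate_fresh[OF ty[folded typed_iff]] by metis
  then show ?thesis unfolding forces_def by (rule prv.allI)
qed

lemma force_all:
  "tyof (A # ctx w) \<phi> = Some \<Omega> \<Longrightarrow>
    w |= \<^bold>\<forall>[A] \<phi> \<longleftrightarrow> (\<forall>v\<ge>w. \<forall>t. ty v t = Some A \<longrightarrow> v |= \<phi>\<^bold>[t\<^bold>])"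
  using force_allI force_allE by metis

lemma force_top [simp]: "w |= \<^bold>\<top>"
  by (simp add: forces_def prv.truI)

lemma force_bot: "w |= \<^bold>\<bottom> \<Longrightarrow> ty w \<phi> = Some \<Omega> \<Longrightarrow> w |= \<phi>"
  by (simp add: forces_def prv.flsE typed_iff)

lemma force_and [simp]: "w |= \<phi> \<^bold>\<and> \<psi> \<longleftrightarrow> w |= \<phi> \<and> w |= \<psi>"
  unfolding forces_def by (blast intro: prv.andI prv.andE1 prv.andE2)

lemma force_impE: "w |= \<phi> \<^bold>\<rightarrow> \<psi> \<Longrightarrow> w \<le> v \<Longrightarrow> v |= \<phi> \<Longrightarrow> v |= \<psi>"
  using force_mono prv.impE unfolding forces_def by metis

lemma force_impI:
  assumes ty: "ty w \<phi> = Some \<Omega>" and *: "\<And>v. w \<le> v \<Longrightarrow> v |= \<phi> \<Longrightarrow> v |= \<psi>"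
  shows "w |= \<phi> \<^bold>\<rightarrow> \<psi>"
proof -
  obtain v where v: "w \<le> v" "v |= \<phi>" "ctx v = ctx w" "hyps v = insert \<phi> (hyps w)"
    using assume_world[OF ty] by blast
  have "v |= \<psi>" using * v by blast
  then show ?thesis using ty by (simp add: forces_def v prv.impI typed_iff)
qed

lemma force_imp: "ty w \<phi> = Some \<Omega> \<Longrightarrow> w |= \<phi> \<^bold>\<rightarrow> \<psi> \<longleftrightarrow> (\<forall>v\<ge>w. v |= \<phi> \<longrightarrow> v |= \<psi>)"
  using force_impI force_impE by metis

lemma force_orI1: "w |= \<phi> \<Longrightarrow> ty w \<psi> = Some \<Omega> \<Longrightarrow> w |= \<phi> \<^bold>\<or> \<psi>"
  by (simp add: forces_def prv.orI1 typed_iff)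

lemma force_orI2: "w |= \<psi> \<Longrightarrow> ty w \<phi> = Some \<Omega> \<Longrightarrow> w |= \<phi> \<^bold>\<or> \<psi>"
  by (simp add: forces_def prv.orI2 typed_iff)

text \<open>
  The conclusion is an arbitrary formula at the same world: disjunctions (and existential
  statements below) need not be decided at \<open>w\<close>, they only hold on a cover of it.
\<close>

lemma force_orE:
  assumes or: "w |= \<phi> \<^bold>\<or> \<psi>"
    and *: "\<And>v. w \<le> v \<Longrightarrow> v |= \<phi> \<Longrightarrow> v |= \<chi>" "\<And>v. w \<le> v \<Longrightarrow> v |= \<psi> \<Longrightarrow> v |= \<chi>"
  shows "w |= \<chi>"
proof -
  have ty: "ty w \<phi> = Some \<Omega>" "ty w \<psi> = Some \<Omega>"
    using force_ty[OF or] by (auto split: if_splits)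
  have "w |= \<phi> \<^bold>\<rightarrow> \<chi>" "w |= \<psi> \<^bold>\<rightarrow> \<chi>"
    using * ty by (auto intro: force_impI)
  then have "ctx w \<parallel> insert \<phi> (hyps w) \<turnstile> \<chi>" "ctx w \<parallel> insert \<psi> (hyps w) \<turnstile> \<chi>"
    by (simp_all add: forces_def prv_imp_insert)
  with or show ?thesis unfolding forces_def by (rule prv.orE)
qed

lemma force_exI:
  "w |= \<phi>\<^bold>[t\<^bold>] \<Longrightarrow> ty w t = Some A \<Longrightarrow> tyof (A # ctx w) \<phi> = Some \<Omega> \<Longrightarrow> w |= \<^bold>\<exists>[A] \<phi>"
  by (simp add: forces_def prv.exI typed_iff)

lemma force_exE:
  assumes ex: "w |= \<^bold>\<exists>[A] \<phi>" and \<psi>: "ty w \<psi> = Some \<Omega>"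
    and *: "\<And>v t. w \<le> v \<Longrightarrow> ty v t = Some A \<Longrightarrow> v |= \<phi>\<^bold>[t\<^bold>] \<Longrightarrow> v |= \<psi>"
  shows "w |= \<psi>"
proof -
  have ty: "tyof (A # ctx w) \<phi> = Some \<Omega>"
    using force_ty[OF ex] by (auto split: if_splits)
  obtain v where v: "w \<le> v" "ctx v = ctx w @ [A]" "hyps v = hyps w" by (rule fresh_world)
  let ?n = "length (ctx w)"
  have n: "ty v (V ?n) = Some A" by (simp add: v)
  have "v |= \<phi>\<^bold>[V ?n\<^bold>] \<^bold>\<rightarrow> \<psi>"
  proof (rule force_impI)
    show "ty v (\<phi>\<^bold>[V ?n\<^bold>]) = Some \<Omega>"
      by (rule ty_inst[OF ty_mono_under[OF ty v(1)] n])
    show "u |= \<psi>" if "v \<le> u" "u |= \<phi>\<^bold>[V ?n\<^bold>]" for u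
      using * order_trans[OF v(1) that(1)] ty_mono[OF n that(1)] that(2) by blast
  qed
  then have "A # ctx w \<parallel> shift ` hyps w \<turnstile> \<phi> \<^bold>\<rightarrow> \<up>\<psi>"
    using forces_fresh[OF v(2,3)]
    by (fastforce simp: ren_rotate_fresh[OF ty[folded typed_iff]] ren_rotate_old[OF \<psi>[folded typed_iff]])
  then have "A # ctx w \<parallel> insert \<phi> (shift ` hyps w) \<turnstile> \<up>\<psi>"
    by (rule prv_imp_insert)
  with ex \<psi> show ?thesis unfolding forces_def by (auto simp: typed_iff intro: prv.exE)
qed

lemma force_replace:
  assumes "w |= s \<^bold>= t" "w |= \<phi>\<^bold>[s\<^bold>]" "ty w s = Some A" "tyof (A # ctx w) \<phi> = Some \<Omega>"
  shows "w |= \<phi>\<^bold>[t\<^bold>]"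
  using prv.eqE[of "ctx w" "hyps w" s t \<phi> A] assms force_ty[OF assms(1)]
  by (auto simp: forces_def typed_iff split: if_splits)

lemma force_refl: "ty w t = Some A \<Longrightarrow> w |= t \<^bold>= t"
  by (simp add: forces_def prv.eqI[of _ _ A] typed_iff)

lemma eq_ty: "w |= s \<^bold>= t \<Longrightarrow> ty w s = Some A \<Longrightarrow> ty w t = Some A"
  using force_ty[of w "s \<^bold>= t"] by (auto split: if_splits)

lemma force_sym:
  assumes "w |= s \<^bold>= t" shows "w |= t \<^bold>= s"
proof -
  obtain A where "ty w s = Some A" "ty w t = Some A"
    using force_ty[OF assms] by (auto split: if_splits option.splits)
  then show ?thesis
    using force_replace[OF assms, of "V 0 \<^bold>= \<up>s" A] by (simp add: inst_def force_refl)
qed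

lemma force_mem_eq:
  assumes "w |= s \<^bold>= t" "w |= s \<^bold>\<in> S" shows "w |= t \<^bold>\<in> S"
proof -
  obtain A where "ty w s = Some A" "ty w S = Some (\<P> A)"
    using force_ty[OF assms(2)] by (auto split: if_splits option.splits)
  then show ?thesis
    using force_replace[OF assms(1), of "V 0 \<^bold>\<in> \<up>S" A] assms(2) by (simp add: inst_def)
qed

lemma force_set_eq:
  assumes "w |= S \<^bold>= R" "w |= t \<^bold>\<in> S" shows "w |= t \<^bold>\<in> R"
proof -
  obtain A where "ty w t = Some A" "ty w S = Some (\<P> A)"
    using force_ty[OF assms(2)] by (auto split: if_splits option.splits)
  then show ?thesis
    using force_replace[OF assms(1), of "\<up>t \<^bold>\<in> V 0" "\<P> A"] assms(2) by (simp add: inst_def)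
qed

text \<open>
  Propositional extensionality: a truth value is the set of later worlds that force it.
\<close>

lemma force_prop_eq:
  assumes "ty w \<phi> = Some \<Omega>" "ty w \<psi> = Some \<Omega>"
  shows "w |= \<phi> \<^bold>= \<psi> \<longleftrightarrow> (\<forall>v\<ge>w. v |= \<phi> \<longleftrightarrow> v |= \<psi>)"
proof
  assume eq: "w |= \<phi> \<^bold>= \<psi>"
  have *: "v |= \<beta>" if "v |= \<alpha> \<^bold>= \<beta>" "v |= \<alpha>" for v \<alpha> \<beta>
    using force_replace[OF that(1), of "V 0" \<Omega>] that(2) force_ty[OF that(2)] by (simp add: inst_def)
  show "\<forall>v\<ge>w. v |= \<phi> \<longleftrightarrow> v |= \<psi>"
    using * force_mono[OF eq] force_sym by blast
next
  assume "\<forall>v\<ge>w. v |= \<phi> \<longleftrightarrow> v |= \<psi>"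
  then have "w |= \<phi> \<^bold>\<rightarrow> \<psi>" "w |= \<psi> \<^bold>\<rightarrow> \<phi>"
    using assms by (auto intro: force_impI)
  then show "w |= \<phi> \<^bold>= \<psi>" unfolding forces_def by (rule prv.prop_ext)
qed

lemma force_mem_Compr:
  assumes "tyof (A # ctx w) \<phi> = Some \<Omega>" "ty w t = Some A"
  shows "w |= t \<^bold>\<in> Compr A \<phi> \<longleftrightarrow> w |= \<phi>\<^bold>[t\<^bold>]"
proof -
  have "w |= (t \<^bold>\<in> Compr A \<phi>) \<^bold>= \<phi>\<^bold>[t\<^bold>]"
    using assms by (simp add: forces_def typed_iff prv.compr)
  then show ?thesis
    using assms force_prop_eq[of w "t \<^bold>\<in> Compr A \<phi>"] by (auto simp: ty_inst)
qed

lemma force_set_ext: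
  assumes "ty w S = Some (\<P> A)" "ty w R = Some (\<P> A)"
  shows "w |= S \<^bold>= R \<longleftrightarrow> (\<forall>v\<ge>w. \<forall>t. ty v t = Some A \<longrightarrow> v |= t \<^bold>\<in> S \<longleftrightarrow> v |= t \<^bold>\<in> R)"
proof
  assume eq: "w |= S \<^bold>= R"
  then show "\<forall>v\<ge>w. \<forall>t. ty v t = Some A \<longrightarrow> v |= t \<^bold>\<in> S \<longleftrightarrow> v |= t \<^bold>\<in> R"
    using force_set_eq force_sym force_mono by blast
next
  assume *: "\<forall>v\<ge>w. \<forall>t. ty v t = Some A \<longrightarrow> v |= t \<^bold>\<in> S \<longleftrightarrow> v |= t \<^bold>\<in> R"
  have "w |= \<^bold>\<forall>[A] ((V 0 \<^bold>\<in> \<up>S) \<^bold>= (V 0 \<^bold>\<in> \<up>R))"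
  proof (rule force_allI)
    fix v t assume v: "w \<le> v" "ty v t = Some A"
    note [simp] = v(2) assms[THEN ty_mono, OF v(1)]
    show "v |= ((V 0 \<^bold>\<in> \<up>S) \<^bold>= (V 0 \<^bold>\<in> \<up>R))\<^bold>[t\<^bold>]"
      using * order_trans[OF v(1)] ty_mono[OF v(2)] by (simp add: inst_def force_prop_eq)
  qed (simp add: assms)
  then show "w |= S \<^bold>= R" 
    using assms unfolding forces_def by (auto simp: typed_iff intro: prv.set_ext)
qed

lemma force_set_extI:
  assumes "\<And>v t. w \<le> v \<Longrightarrow> v |= t \<^bold>\<in> S \<Longrightarrow> v |= t \<^bold>\<in> R" "\<And>v t. w \<le> v \<Longrightarrow> v |= t \<^bold>\<in> R \<Longrightarrow> v |= t \<^bold>\<in> S"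
    and "ty w S = Some (\<P> A)" "ty w R = Some (\<P> A)"
  shows "w |= S \<^bold>= R"
  using assms by (auto simp: force_set_ext)

lemma force_iff:
  assumes "ty w \<phi> = Some \<Omega>" "ty w \<psi> = Some \<Omega>" "\<And>v. w \<le> v \<Longrightarrow> v |= \<phi> \<longleftrightarrow> v |= \<psi>"
  shows "w |= \<phi> \<^bold>\<leftrightarrow> \<psi>"
  using assms by (simp add: force_imp)

text \<open>
  The two quantifications over later worlds merge into one. All bounded quantifiers have this
  shape, and the side conditions concern the world \<open>w\<close> only.
\<close>

lemma force_all_imp:
  assumes "tyof (A # ctx w) \<phi> = Some \<Omega>" "tyof (A # ctx w) \<psi> = Some \<Omega>"
  shows "w |= \<^bold>\<forall>[A] (\<phi> \<^bold>\<rightarrow> \<psi>) \<longleftrightarrow>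
    (\<forall>v\<ge>w. \<forall>t. ty v t = Some A \<longrightarrow> v |= \<phi>\<^bold>[t\<^bold>] \<longrightarrow> v |= \<psi>\<^bold>[t\<^bold>])" (is "_ = ?R")
proof -
  have *: "(\<phi> \<^bold>\<rightarrow> \<psi>)\<^bold>[t\<^bold>] = (\<phi>\<^bold>[t\<^bold>] \<^bold>\<rightarrow> \<psi>\<^bold>[t\<^bold>])" for t
    by (simp add: inst_def)
  have "w |= \<^bold>\<forall>[A] (\<phi> \<^bold>\<rightarrow> \<psi>) \<longleftrightarrow>
      (\<forall>v\<ge>w. \<forall>t. ty v t = Some A \<longrightarrow> (\<forall>u\<ge>v. u |= \<phi>\<^bold>[t\<^bold>] \<longrightarrow> u |= \<psi>\<^bold>[t\<^bold>]))"
    using assms ty_inst[OF ty_mono_under[OF assms(1)]] by (auto simp: force_all * force_imp)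
  also have "\<dots> \<longleftrightarrow> ?R"
    using ty_mono order_trans by blast
  finally show ?thesis .
qed

section \<open>Substitution and typing for the defined notions\<close>

lemma subst_basic [simp]:
  "subst \<sigma> (subset A S X) = subset A (subst \<sigma> S) (subst \<sigma> X)"
  "subst \<sigma> (inter A S X) = inter A (subst \<sigma> S) (subst \<sigma> X)"
  "subst \<sigma> (is_map A B f X Y) = is_map A B (subst \<sigma> f) (subst \<sigma> X) (subst \<sigma> Y)"
  "subst \<sigma> (app_in B f x S) = app_in B (subst \<sigma> f) (subst \<sigma> x) (subst \<sigma> S)"
  "subst \<sigma> (id_map A X) = id_map A (subst \<sigma> X)"
  "subst \<sigma> (nat_le k n) = nat_le (subst \<sigma> k) (subst \<sigma> n)"
  "subst \<sigma> \<Omega>\<^sub>\<not>\<^sub>\<not> = \<Omega>\<^sub>\<not>\<^sub>\<not>"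
  "subst \<sigma> (open_tv T) = open_tv (subst \<sigma> T)"
  "subst \<sigma> (closed_tv T) = closed_tv (subst \<sigma> T)"
  "subst \<sigma> (neg_set S) = neg_set (subst \<sigma> S)"
  by (simp_all add: subset_def inter_def is_map_def app_in_def id_map_def
    nat_le_def stable_tv_def open_tv_def closed_tv_def neg_set_def numeral_2_eq_2)

lemma subst_sets [simp]:
  "subst \<sigma> (nats_below n) = nats_below (subst \<sigma> n)"
  "subst \<sigma> (stable_closed_tv T) = stable_closed_tv (subst \<sigma> T)"
  "subst \<sigma> (tv_subset A W S X) = tv_subset A (subst \<sigma> W) (subst \<sigma> S) (subst \<sigma> X)"
  by (simp_all add: nats_below_def stable_closed_tv_def tv_subset_def numeral_2_eq_2)

lemma subst_quantified [simp]:
  "subst \<sigma> (finite_set A X) = finite_set A (subst \<sigma> X)"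
  "subst \<sigma> (ex_preserves A B W W' f X Y) =
    ex_preserves A B (subst \<sigma> W) (subst \<sigma> W') (subst \<sigma> f) (subst \<sigma> X) (subst \<sigma> Y)"
  "subst \<sigma> (all_preserves A B W W' f X Y) =
    all_preserves A B (subst \<sigma> W) (subst \<sigma> W') (subst \<sigma> f) (subst \<sigma> X) (subst \<sigma> Y)"
  "subst \<sigma> (subspace T A S X) = subspace (subst \<sigma> T) A (subst \<sigma> S) (subst \<sigma> X)"
  by (simp_all add: finite_set_def ex_preserves_def all_preserves_def subspace_def numeral_2_eq_2)

lemma subst_map_notions [simp]:
  "subst \<sigma> (strongly_condensed T A B f X Y) = strongly_condensed (subst \<sigma> T) A B (subst \<sigma> f) (subst \<sigma> X) (subst \<sigma> Y)"
  "subst \<sigma> (condensed T A B f X Y) = condensed (subst \<sigma> T) A B (subst \<sigma> f) (subst \<sigma> X) (subst \<sigma> Y)"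
  "subst \<sigma> (compact_map T A B f X Y) = compact_map (subst \<sigma> T) A B (subst \<sigma> f) (subst \<sigma> X) (subst \<sigma> Y)"
  "subst \<sigma> (condensed_on_stable T A B f X Y) =
    condensed_on_stable (subst \<sigma> T) A B (subst \<sigma> f) (subst \<sigma> X) (subst \<sigma> Y)"
  by (simp_all add: strongly_condensed_def condensed_def compact_map_def condensed_on_stable_def numeral_2_eq_2)

lemma ty_subset [simp]:
  "tyof \<Delta> S = Some (\<P> A) \<Longrightarrow> tyof \<Delta> X = Some (\<P> A) \<Longrightarrow> tyof \<Delta> (subset A S X) = Some \<Omega>"
  by (simp add: subset_def)

lemma ty_inter [simp]:
  "tyof \<Delta> S = Some (\<P> A) \<Longrightarrow> tyof \<Delta> X = Some (\<P> A) \<Longrightarrow> tyof \<Delta> (inter A S X) = Some (\<P> A)"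
  by (simp add: inter_def)

lemma ty_is_map [simp]:
  "tyof \<Delta> f = Some (\<P> (A \<^bold>\<times> B)) \<Longrightarrow> tyof \<Delta> X = Some (\<P> A) \<Longrightarrow> tyof \<Delta> Y = Some (\<P> B) \<Longrightarrow>
    tyof \<Delta> (is_map A B f X Y) = Some \<Omega>"
  by (simp add: is_map_def)

lemma ty_app_in [simp]:
  "tyof \<Delta> f = Some (\<P> (A \<^bold>\<times> B)) \<Longrightarrow> tyof \<Delta> x = Some A \<Longrightarrow> tyof \<Delta> S = Some (\<P> B) \<Longrightarrow>
    tyof \<Delta> (app_in B f x S) = Some \<Omega>"
  by (simp add: app_in_def)

lemma ty_id_map [simp]: "tyof \<Delta> X = Some (\<P> A) \<Longrightarrow> tyof \<Delta> (id_map A X) = Some (\<P> (A \<^bold>\<times> A))"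
  by (simp add: id_map_def)

lemma ty_nat_le [simp]: "tyof \<Delta> k = Some \<N> \<Longrightarrow> tyof \<Delta> n = Some \<N> \<Longrightarrow> tyof \<Delta> (nat_le k n) = Some \<Omega>"
  by (simp add: nat_le_def)

lemma ty_nats_below [simp]: "tyof \<Delta> n = Some \<N> \<Longrightarrow> tyof \<Delta> (nats_below n) = Some (\<P> \<N>)"
  by (simp add: nats_below_def)

lemma ty_finite_set [simp]: "tyof \<Delta> X = Some (\<P> A) \<Longrightarrow> tyof \<Delta> (finite_set A X) = Some \<Omega>"
  by (simp add: finite_set_def)

lemma ty_stable_tv [simp]: "tyof \<Delta> \<Omega>\<^sub>\<not>\<^sub>\<not> = Some (\<P> \<Omega>)"
  by (simp add: stable_tv_def)

lemma ty_decidable_tv [simp]: "tyof \<Delta> decidable_tv = Some (\<P> \<Omega>)"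
  by (simp add: decidable_tv_def)

lemma ty_open_tv [simp]: "tyof \<Delta> T = Some (\<P> \<Omega>) \<Longrightarrow> tyof \<Delta> (open_tv T) = Some (\<P> \<Omega>)"
  by (simp add: open_tv_def)

lemma ty_closed_tv [simp]: "tyof \<Delta> T = Some (\<P> \<Omega>) \<Longrightarrow> tyof \<Delta> (closed_tv T) = Some (\<P> \<Omega>)"
  by (simp add: closed_tv_def)

lemma ty_stable_closed_tv [simp]:
  "tyof \<Delta> T = Some (\<P> \<Omega>) \<Longrightarrow> tyof \<Delta> (stable_closed_tv T) = Some (\<P> \<Omega>)"
  by (simp add: stable_closed_tv_def)

lemma ty_neg_set [simp]: "tyof \<Delta> S = Some (\<P> \<Omega>) \<Longrightarrow> tyof \<Delta> (neg_set S) = Some (\<P> \<Omega>)"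
  by (simp add: neg_set_def)

lemma ty_finite_join_closed [simp]:
  "tyof \<Delta> S = Some (\<P> \<Omega>) \<Longrightarrow> tyof \<Delta> (finite_join_closed S) = Some \<Omega>"
  by (simp add: finite_join_closed_def)

lemma ty_tv_subset [simp]:
  "tyof \<Delta> W = Some (\<P> \<Omega>) \<Longrightarrow> tyof \<Delta> S = Some (\<P> A) \<Longrightarrow> tyof \<Delta> X = Some (\<P> A) \<Longrightarrow>
    tyof \<Delta> (tv_subset A W S X) = Some \<Omega>"
  by (simp add: tv_subset_def)

lemma ty_ex_preserves [simp]:
  "tyof \<Delta> W = Some (\<P> \<Omega>) \<Longrightarrow> tyof \<Delta> W' = Some (\<P> \<Omega>) \<Longrightarrow> tyof \<Delta> f = Some (\<P> (A \<^bold>\<times> B)) \<Longrightarrow>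
    tyof \<Delta> X = Some (\<P> A) \<Longrightarrow> tyof \<Delta> Y = Some (\<P> B) \<Longrightarrow>
    tyof \<Delta> (ex_preserves A B W W' f X Y) = Some \<Omega>"
  by (simp add: ex_preserves_def)

lemma ty_all_preserves [simp]:
  "tyof \<Delta> W = Some (\<P> \<Omega>) \<Longrightarrow> tyof \<Delta> W' = Some (\<P> \<Omega>) \<Longrightarrow> tyof \<Delta> f = Some (\<P> (A \<^bold>\<times> B)) \<Longrightarrow>
    tyof \<Delta> X = Some (\<P> A) \<Longrightarrow> tyof \<Delta> Y = Some (\<P> B) \<Longrightarrow>
    tyof \<Delta> (all_preserves A B W W' f X Y) = Some \<Omega>"
  by (simp add: all_preserves_def)

lemma ty_map_props [simp]:
  assumes "tyof \<Delta> T = Some (\<P> \<Omega>)" "tyof \<Delta> f = Some (\<P> (A \<^bold>\<times> B))"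
    "tyof \<Delta> X = Some (\<P> A)" "tyof \<Delta> Y = Some (\<P> B)"
  shows "tyof \<Delta> (strongly_condensed T A B f X Y) = Some \<Omega>" "tyof \<Delta> (condensed T A B f X Y) = Some \<Omega>"
    "tyof \<Delta> (compact_map T A B f X Y) = Some \<Omega>" "tyof \<Delta> (condensed_on_stable T A B f X Y) = Some \<Omega>"
  using assms
  by (simp_all add: strongly_condensed_def condensed_def compact_map_def condensed_on_stable_def)

lemma ty_finite_sets_overt [simp]: "tyof \<Delta> T = Some (\<P> \<Omega>) \<Longrightarrow> tyof \<Delta> (finite_sets_overt T A) = Some \<Omega>"
  by (simp add: finite_sets_overt_def overt_def)

lemma ty_dominance [simp]: "tyof \<Delta> T = Some (\<P> \<Omega>) \<Longrightarrow> tyof \<Delta> (dominance T) = Some \<Omega>"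
  by (simp add: dominance_def)

lemma ty_codominance [simp]: "tyof \<Delta> T = Some (\<P> \<Omega>) \<Longrightarrow> tyof \<Delta> (codominance T) = Some \<Omega>"
  by (simp add: codominance_def)

lemma ty_transitive [simp]: "tyof \<Delta> W = Some (\<P> \<Omega>) \<Longrightarrow> tyof \<Delta> (transitive W A) = Some \<Omega>"
  by (simp add: transitive_def)

lemma ty_subspace [simp]:
  "tyof \<Delta> T = Some (\<P> \<Omega>) \<Longrightarrow> tyof \<Delta> S = Some (\<P> A) \<Longrightarrow> tyof \<Delta> X = Some (\<P> A) \<Longrightarrow>
    tyof \<Delta> (subspace T A S X) = Some \<Omega>"
  by (simp add: subspace_def)

section \<open>Forcing clauses of the defined notions\<close>

lemma mem_ty:
  assumes "w |= t \<^bold>\<in> S"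
  obtains A where "ty w t = Some A" "ty w S = Some (\<P> A)"
  using force_ty[OF assms] by (auto split: if_splits option.splits)

lemma mem_ty_elem: "w |= t \<^bold>\<in> S \<Longrightarrow> ty w S = Some (\<P> A) \<Longrightarrow> ty w t = Some A"
  by (erule mem_ty) simp

text \<open>
  The tool by which truth values are compared: membership in \<open>W\<close> depends only on the later
  worlds that force the truth value.
\<close>

lemma force_cong:
  assumes "w |= p \<^bold>\<in> W" "ty w q = Some \<Omega>" "\<And>v. w \<le> v \<Longrightarrow> v |= p \<longleftrightarrow> v |= q" "ty w W = Some (\<P> \<Omega>)"
  shows "w |= q \<^bold>\<in> W"
  using assms force_mem_eq[of w p q W] mem_ty_elem[OF assms(1,4)] by (simp add: force_prop_eq)

lemma force_neg: "ty w p = Some \<Omega> \<Longrightarrow> w |= \<^bold>\<not> p \<longleftrightarrow> (\<forall>v\<ge>w. v |= p \<longrightarrow> v |= \<^bold>\<bottom>)"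
  by (rule force_imp)

text \<open>
  Elements need no typing condition here or below, because membership in a set determines their
  type.
\<close>

lemma force_subset:
  assumes [simp]: "ty w S = Some (\<P> A)" "ty w X = Some (\<P> A)"
  shows "w |= subset A S X \<longleftrightarrow> (\<forall>v\<ge>w. \<forall>t. v |= t \<^bold>\<in> S \<longrightarrow> v |= t \<^bold>\<in> X)"
  unfolding subset_def
  by (subst force_all_imp) (auto simp: inst_def dest: mem_ty_elem[OF _ ty_mono[OF assms(1)]])

lemma force_tv_subset:
  assumes [simp]: "ty w W = Some (\<P> \<Omega>)" "ty w S = Some (\<P> A)" "ty w X = Some (\<P> A)"
  shows "w |= tv_subset A W S X \<longleftrightarrow>
    (\<forall>v\<ge>w. \<forall>t. (v |= t \<^bold>\<in> S \<longrightarrow> v |= t \<^bold>\<in> X) \<and> (v |= t \<^bold>\<in> X \<longrightarrow> v |= (t \<^bold>\<in> S) \<^bold>\<in> W))"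
proof -
  have "w |= \<^bold>\<forall>[A, X] ((V 0 \<^bold>\<in> \<up>S) \<^bold>\<in> \<up>W) \<longleftrightarrow>
      (\<forall>v\<ge>w. \<forall>t. v |= t \<^bold>\<in> X \<longrightarrow> v |= (t \<^bold>\<in> S) \<^bold>\<in> W)"
    by (subst force_all_imp) (auto simp: inst_def dest: mem_ty_elem[OF _ ty_mono[OF assms(3)]])
  then show ?thesis
    unfolding tv_subset_def by (auto simp: force_subset)
qed

lemma tv_subsetI:
  assumes "\<And>v t. w \<le> v \<Longrightarrow> v |= t \<^bold>\<in> S \<Longrightarrow> v |= t \<^bold>\<in> X"
    "\<And>v t. w \<le> v \<Longrightarrow> v |= t \<^bold>\<in> X \<Longrightarrow> v |= (t \<^bold>\<in> S) \<^bold>\<in> W"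
    "ty w W = Some (\<P> \<Omega>)" "ty w S = Some (\<P> A)" "ty w X = Some (\<P> A)"
  shows "w |= tv_subset A W S X"
  using assms by (simp add: force_tv_subset)

lemma tv_subsetD1:
  assumes "w |= tv_subset A W S X" "w \<le> v" "v |= t \<^bold>\<in> S"
    "ty w W = Some (\<P> \<Omega>)" "ty w S = Some (\<P> A)" "ty w X = Some (\<P> A)"
  shows "v |= t \<^bold>\<in> X"
  using assms by (simp add: force_tv_subset)

lemma tv_subsetD2:
  assumes "w |= tv_subset A W S X" "w \<le> v" "v |= t \<^bold>\<in> X"
    "ty w W = Some (\<P> \<Omega>)" "ty w S = Some (\<P> A)" "ty w X = Some (\<P> A)"
  shows "v |= (t \<^bold>\<in> S) \<^bold>\<in> W"
  using assms by (simp add: force_tv_subset)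

lemma tv_subset_mono:
  assumes "w |= tv_subset A W S X"
    and "\<And>v p. w \<le> v \<Longrightarrow> v |= p \<^bold>\<in> W \<Longrightarrow> v |= p \<^bold>\<in> W'"
    and "ty w W = Some (\<P> \<Omega>)" "ty w W' = Some (\<P> \<Omega>)" "ty w S = Some (\<P> A)" "ty w X = Some (\<P> A)"
  shows "w |= tv_subset A W' S X"
  using assms by (simp add: force_tv_subset)

lemma force_inter:
  assumes "ty w S = Some (\<P> A)" "ty w X = Some (\<P> A)"
  shows "w |= t \<^bold>\<in> inter A S X \<longleftrightarrow> w |= t \<^bold>\<in> S \<and> w |= t \<^bold>\<in> X"
proof (cases "ty w t = Some A")
  case True
  then show ?thesis unfolding inter_def
    by (subst force_mem_Compr) (simp_all add: assms inst_def)
next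
  case False
  then show ?thesis
    using assms by (auto dest: mem_ty_elem[of _ _ _ A])
qed

lemma force_Compr:
  assumes "tyof (A # ctx w) \<phi> = Some \<Omega>"
  shows "w |= t \<^bold>\<in> Compr A \<phi> \<longleftrightarrow> ty w t = Some A \<and> w |= \<phi>\<^bold>[t\<^bold>]"
  using force_mem_Compr[OF assms] mem_ty_elem[of w t "Compr A \<phi>" A] assms by auto

lemma force_stable:
  "w |= p \<^bold>\<in> \<Omega>\<^sub>\<not>\<^sub>\<not> \<longleftrightarrow> ty w p = Some \<Omega> \<and> (\<forall>v\<ge>w. v |= \<^bold>\<not> \<^bold>\<not> p \<longrightarrow> v |= p)"
  unfolding stable_tv_def by (subst force_Compr) (auto simp: inst_def force_imp)

lemma force_decidable: "w |= p \<^bold>\<in> decidable_tv \<longleftrightarrow> w |= p \<^bold>\<or> \<^bold>\<not> p"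
  unfolding decidable_tv_def
  by (subst force_Compr) (auto simp: inst_def dest: force_ty split: if_splits)

lemma force_open:
  assumes [simp]: "ty w T = Some (\<P> \<Omega>)"
  shows "w |= u \<^bold>\<in> open_tv T \<longleftrightarrow> ty w u = Some \<Omega> \<and> (\<forall>v\<ge>w. \<forall>t. v |= t \<^bold>\<in> T \<longrightarrow> v |= (u \<^bold>\<and> t) \<^bold>\<in> T)"
proof (cases "ty w u = Some \<Omega>")
  case [simp]: True
  show ?thesis unfolding open_tv_def
    by (subst force_Compr)
       (auto simp: inst_def force_all_imp dest: mem_ty_elem[OF _ ty_mono[OF assms]])
next
  case False
  then show ?thesis using mem_ty_elem[of w u "open_tv T" \<Omega>] by auto
qed

lemma force_closed:
  assumes [simp]: "ty w T = Some (\<P> \<Omega>)"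
  shows "w |= f \<^bold>\<in> closed_tv T \<longleftrightarrow> ty w f = Some \<Omega> \<and> (\<forall>v\<ge>w. \<forall>t. v |= t \<^bold>\<in> T \<longrightarrow> v |= (f \<^bold>\<rightarrow> t) \<^bold>\<in> T)"
proof (cases "ty w f = Some \<Omega>")
  case [simp]: True
  show ?thesis unfolding closed_tv_def
    by (subst force_Compr)
       (auto simp: inst_def force_all_imp dest: mem_ty_elem[OF _ ty_mono[OF assms]])
next
  case False
  then show ?thesis using mem_ty_elem[of w f "closed_tv T" \<Omega>] by auto
qed

lemma force_stable_closed:
  assumes "ty w T = Some (\<P> \<Omega>)"
  shows "w |= f \<^bold>\<in> stable_closed_tv T \<longleftrightarrow> w |= f \<^bold>\<in> closed_tv T \<and> w |= f \<^bold>\<in> \<Omega>\<^sub>\<not>\<^sub>\<not>"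
  using assms by (simp add: stable_closed_tv_def force_inter)

lemma force_finite_join_closed:
  assumes [simp]: "ty w S = Some (\<P> \<Omega>)"
  shows "w |= finite_join_closed S \<longleftrightarrow>
    w |= \<^bold>\<bottom> \<^bold>\<in> S \<and> (\<forall>v\<ge>w. \<forall>p q. v |= p \<^bold>\<in> S \<longrightarrow> v |= q \<^bold>\<in> S \<longrightarrow> v |= (p \<^bold>\<or> q) \<^bold>\<in> S)"
proof -
  have "w |= \<^bold>\<forall>[\<Omega>, S] \<^bold>\<forall>[\<Omega>, \<up>S] ((V 1 \<^bold>\<or> V 0) \<^bold>\<in> \<up>\<up>S) \<longleftrightarrow>
    (\<forall>v\<ge>w. \<forall>p q. v |= p \<^bold>\<in> S \<longrightarrow> v |= q \<^bold>\<in> S \<longrightarrow> v |= (p \<^bold>\<or> q) \<^bold>\<in> S)" (is "_ = ?R")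
  proof -
    have "w |= \<^bold>\<forall>[\<Omega>, S] \<^bold>\<forall>[\<Omega>, \<up>S] ((V 1 \<^bold>\<or> V 0) \<^bold>\<in> \<up>\<up>S) \<longleftrightarrow>
      (\<forall>v\<ge>w. \<forall>p. ty v p = Some \<Omega> \<longrightarrow> v |= p \<^bold>\<in> S \<longrightarrow> v |= \<^bold>\<forall>[\<Omega>, S] ((\<up>p \<^bold>\<or> V 0) \<^bold>\<in> \<up>S))"
      by (subst force_all_imp) (simp_all add: inst_def)
    also have "\<dots> \<longleftrightarrow> (\<forall>v\<ge>w. \<forall>p. ty v p = Some \<Omega> \<longrightarrow> v |= p \<^bold>\<in> S \<longrightarrow>
       (\<forall>u\<ge>v. \<forall>q. ty u q = Some \<Omega> \<longrightarrow> u |= q \<^bold>\<in> S \<longrightarrow> u |= (p \<^bold>\<or> q) \<^bold>\<in> S))"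
      using ty_mono[OF assms] by (simp add: force_all_imp inst_def)
    also have "\<dots> \<longleftrightarrow> ?R"
    proof safe
      fix v p q assume H: "\<forall>v\<ge>w. \<forall>p. ty v p = Some \<Omega> \<longrightarrow> v |= p \<^bold>\<in> S \<longrightarrow>
         (\<forall>u\<ge>v. \<forall>q. ty u q = Some \<Omega> \<longrightarrow> u |= q \<^bold>\<in> S \<longrightarrow> u |= (p \<^bold>\<or> q) \<^bold>\<in> S)"
        and v: "w \<le> v" "v |= p \<^bold>\<in> S" "v |= q \<^bold>\<in> S"
      then show "v |= (p \<^bold>\<or> q) \<^bold>\<in> S"
        using mem_ty_elem[OF _ ty_mono[OF assms v(1)]] by blast
    next
      fix v p u q assume H: "\<forall>v\<ge>w. \<forall>p q. v |= p \<^bold>\<in> S \<longrightarrow> v |= q \<^bold>\<in> S \<longrightarrow> v |= (p \<^bold>\<or> q) \<^bold>\<in> S"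
        and "w \<le> v" "v |= p \<^bold>\<in> S" "v \<le> u" "u |= q \<^bold>\<in> S"
      then have "w \<le> u" "u |= p \<^bold>\<in> S" "u |= q \<^bold>\<in> S"
        using order_trans[of w v u] force_mono[of v _ u] by blast+
      then show "u |= (p \<^bold>\<or> q) \<^bold>\<in> S"
        using H by blast
    qed
    finally show ?thesis .
  qed
  then show ?thesis by (simp add: finite_join_closed_def)
qed

lemma dominanceI:
  assumes T: "ty w T = Some (\<P> \<Omega>)"
    and *: "\<And>v u p. w \<le> v \<Longrightarrow> v |= u \<^bold>\<in> open_tv T \<Longrightarrow> ty v p = Some \<Omega> \<Longrightarrow>
      v |= u \<^bold>\<rightarrow> (p \<^bold>\<in> T) \<Longrightarrow> v |= (u \<^bold>\<and> p) \<^bold>\<in> T"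
  shows "w |= dominance T"
  unfolding dominance_def
proof (subst force_all_imp, goal_cases)
  case 3
  have "v |= \<^bold>\<forall>[\<Omega>] ((\<up>u \<^bold>\<rightarrow> V 0 \<^bold>\<in> \<up>T) \<^bold>\<rightarrow> (\<up>u \<^bold>\<and> V 0) \<^bold>\<in> \<up>T)"
    if "w \<le> v" "v |= u \<^bold>\<in> open_tv T" "ty v u = Some \<Omega>" for v u
    using that ty_mono[OF T] * force_mono[OF that(2)] order_trans[OF that(1)]
    by (simp add: force_all_imp inst_def)
  then show ?case by (simp add: inst_def)
qed (simp_all add: T)

lemma dominanceD:
  assumes "w |= dominance T" "w |= u \<^bold>\<in> open_tv T" "w |= u \<^bold>\<rightarrow> (p \<^bold>\<in> T)"
    and ty: "ty w u = Some \<Omega>" "ty w p = Some \<Omega>"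
  shows "w |= (u \<^bold>\<and> p) \<^bold>\<in> T"
proof -
  note 1 = force_allE[OF assms(1)[unfolded dominance_def] order_refl ty(1), unfolded inst_def, simplified]
  note 2 = force_allE[OF force_impE[OF 1 order_refl assms(2)] order_refl ty(2), unfolded inst_def, simplified]
  show ?thesis by (rule force_impE[OF 2 order_refl assms(3)])
qed

lemma codominanceI:
  assumes T: "ty w T = Some (\<P> \<Omega>)"
    and *: "\<And>v f p. w \<le> v \<Longrightarrow> v |= f \<^bold>\<in> closed_tv T \<Longrightarrow> ty v p = Some \<Omega> \<Longrightarrow>
      v |= f \<^bold>\<rightarrow> (p \<^bold>\<in> T) \<Longrightarrow> v |= (f \<^bold>\<rightarrow> p) \<^bold>\<in> T"
  shows "w |= codominance T"
  unfolding codominance_def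
proof (subst force_all_imp, goal_cases)
  case 3
  have "v |= \<^bold>\<forall>[\<Omega>] ((\<up>f \<^bold>\<rightarrow> V 0 \<^bold>\<in> \<up>T) \<^bold>\<rightarrow> (\<up>f \<^bold>\<rightarrow> V 0) \<^bold>\<in> \<up>T)"
    if "w \<le> v" "v |= f \<^bold>\<in> closed_tv T" "ty v f = Some \<Omega>" for v f
    using that ty_mono[OF T] * force_mono[OF that(2)] order_trans[OF that(1)]
    by (simp add: force_all_imp inst_def)
  then show ?case by (simp add: inst_def)
qed (simp_all add: T)

lemma codominanceD:
  assumes "w |= codominance T" "w |= f \<^bold>\<in> closed_tv T" "w |= f \<^bold>\<rightarrow> (p \<^bold>\<in> T)"
    and ty: "ty w f = Some \<Omega>" "ty w p = Some \<Omega>"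
  shows "w |= (f \<^bold>\<rightarrow> p) \<^bold>\<in> T"
proof -
  note 1 = force_allE[OF assms(1)[unfolded codominance_def] order_refl ty(1), unfolded inst_def, simplified]
  note 2 = force_allE[OF force_impE[OF 1 order_refl assms(2)] order_refl ty(2), unfolded inst_def, simplified]
  show ?thesis by (rule force_impE[OF 2 order_refl assms(3)])
qed

lemma transitiveI:
  assumes W: "ty w W = Some (\<P> \<Omega>)"
    and *: "\<And>v X S R. w \<le> v \<Longrightarrow> ty v X = Some (\<P> A) \<Longrightarrow> ty v S = Some (\<P> A) \<Longrightarrow> ty v R = Some (\<P> A) \<Longrightarrow>
      v |= tv_subset A W S X \<Longrightarrow> v |= tv_subset A W R S \<Longrightarrow> v |= tv_subset A W R X"
  shows "w |= transitive W A"
  unfolding transitive_def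
proof (rule force_allI, goal_cases)
  case (2 x X)
  note X = 2(2)
  note [simp] = X ty_mono[OF W 2(1)]
  have "x |= \<^bold>\<forall>[\<P> A] \<^bold>\<forall>[\<P> A] (tv_subset A \<up>\<up>W (V 1) \<up>\<up>X \<^bold>\<and> tv_subset A \<up>\<up>W (V 0) (V 1) \<^bold>\<rightarrow>
         tv_subset A \<up>\<up>W (V 0) \<up>\<up>X)"
  proof (rule force_allI, goal_cases)
    case (2 y S)
    note y = 2
    note le = order_trans[OF \<open>w \<le> x\<close> y(1)]
    note [simp] = y(2) ty_mono[OF W le] ty_mono[OF X y(1)]
    have "y |= \<^bold>\<forall>[\<P> A] (tv_subset A \<up>W \<up>S \<up>X \<^bold>\<and> tv_subset A \<up>W (V 0) \<up>S \<^bold>\<rightarrow> tv_subset A \<up>W (V 0) \<up>X)"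
    proof (subst force_all_imp, goal_cases)
      case 3
      have "z |= tv_subset A W R X"
        if z: "y \<le> z" and "ty z R = Some (\<P> A)" "z |= tv_subset A W S X" "z |= tv_subset A W R S" for z R
        by (rule *[OF order_trans[OF le z] ty_mono[OF X order_trans[OF y(1) z]] ty_mono[OF y(2) z] that(2-4)])
      then show ?case by (simp add: inst_def numeral_2_eq_2)
    qed simp_all
    then show ?case by (simp add: inst_def numeral_2_eq_2)
  qed simp
  then show ?case by (simp add: inst_def numeral_2_eq_2)
qed (simp add: W)

lemma transitiveD:
  assumes "w |= transitive W A" "w |= tv_subset A W S X" "w |= tv_subset A W R S"
    and ty: "ty w X = Some (\<P> A)" "ty w S = Some (\<P> A)" "ty w R = Some (\<P> A)"
  shows "w |= tv_subset A W R X"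
proof -
  note 1 = force_allE[OF assms(1)[unfolded transitive_def] order_refl ty(1), unfolded inst_def, simplified numeral_2_eq_2, simplified]
  note 2 = force_allE[OF 1 order_refl ty(2), unfolded inst_def, simplified numeral_2_eq_2, simplified]
  note 3 = force_allE[OF 2 order_refl ty(3), unfolded inst_def, simplified numeral_2_eq_2, simplified]
  show ?thesis using force_impE[OF 3 order_refl] assms(2,3) by simp
qed

lemma bounded_sublatticeI:
  assumes S: "ty w S = Some (\<P> \<Omega>)"
    and "w |= \<^bold>\<top> \<^bold>\<in> S" "w |= \<^bold>\<bottom> \<^bold>\<in> S"
    and *: "\<And>v p q. w \<le> v \<Longrightarrow> v |= p \<^bold>\<in> S \<Longrightarrow> v |= q \<^bold>\<in> S \<Longrightarrow> v |= (p \<^bold>\<and> q) \<^bold>\<in> S \<and> v |= (p \<^bold>\<or> q) \<^bold>\<in> S"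
  shows "w |= bounded_sublattice S"
proof -
  have "w |= \<^bold>\<forall>[\<Omega>, S] \<^bold>\<forall>[\<Omega>, \<up>S] ((V 1 \<^bold>\<and> V 0) \<^bold>\<in> \<up>\<up>S \<^bold>\<and> (V 1 \<^bold>\<or> V 0) \<^bold>\<in> \<up>\<up>S)"
  proof (subst force_all_imp, goal_cases)
    case 3
    have "v |= \<^bold>\<forall>[\<Omega>] (V 0 \<^bold>\<in> \<up>S \<^bold>\<rightarrow> (\<up>p \<^bold>\<and> V 0) \<^bold>\<in> \<up>S \<^bold>\<and> (\<up>p \<^bold>\<or> V 0) \<^bold>\<in> \<up>S)"
      if "w \<le> v" "v |= p \<^bold>\<in> S" "ty v p = Some \<Omega>" for v p
      using that ty_mono[OF S] * force_mono[OF that(2)] order_trans[OF that(1)]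
      by (simp add: force_all_imp inst_def)
    then show ?case by (simp add: inst_def)
  qed (simp_all add: S)
  then show ?thesis using assms by (simp add: bounded_sublattice_def)
qed

lemma neg_setI:
  assumes "w |= p \<^bold>\<in> S" "ty w S = Some (\<P> \<Omega>)" "w |= q \<^bold>= \<^bold>\<not> p"
  shows "w |= q \<^bold>\<in> neg_set S"
proof -
  have [simp]: "ty w p = Some \<Omega>" using assms(1,2) by (rule mem_ty_elem)
  then have [simp]: "ty w q = Some \<Omega>" using force_ty[OF assms(3)] by (auto split: if_splits option.splits)
  show ?thesis
    unfolding neg_set_def
    by (subst force_Compr) (use assms in \<open>auto simp: inst_def intro!: force_exI[of _ _ p]\<close>)
qed

lemma neg_setE:
  assumes "w |= q \<^bold>\<in> neg_set S" "ty w S = Some (\<P> \<Omega>)" "ty w \<chi> = Some \<Omega>"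
    and *: "\<And>v p. w \<le> v \<Longrightarrow> v |= p \<^bold>\<in> S \<Longrightarrow> v |= q \<^bold>= \<^bold>\<not> p \<Longrightarrow> v |= \<chi>"
  shows "w |= \<chi>"
proof -
  have "w |= \<^bold>\<exists>[\<Omega>] (V 0 \<^bold>\<in> \<up>S \<^bold>\<and> \<up>q \<^bold>= \<^bold>\<not> V 0)"
    using assms(1) unfolding neg_set_def
    by (subst (asm) force_Compr) (simp_all add: assms inst_def)
  then show ?thesis
    by (rule force_exE[OF _ assms(3)]) (auto simp: inst_def *)
qed

lemma not_not_intro:
  assumes "w |= p" shows "w |= \<^bold>\<not> \<^bold>\<not> p"
  using force_ty[OF assms] force_mono[OF assms] by (auto intro!: force_impI elim: force_impE)

lemma neg_stable:
  assumes "ty w p = Some \<Omega>" shows "w |= (\<^bold>\<not> p) \<^bold>\<in> \<Omega>\<^sub>\<not>\<^sub>\<not>"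
  unfolding force_stable
proof (intro conjI HOL.allI HOL.impI)
  fix v assume v: "w \<le> v" "v |= \<^bold>\<not> \<^bold>\<not> \<^bold>\<not> p"
  show "v |= \<^bold>\<not> p"
  proof (rule force_impI[OF ty_mono[OF assms v(1)]])
    fix u assume "v \<le> u" "u |= p"
    then show "u |= \<^bold>\<bottom>" using force_impE[OF v(2)] not_not_intro by blast
  qed
qed (simp add: assms)

section \<open>Open and closed truth values\<close>

text \<open>
  The standing assumptions at a world. Closure under finite joins stands for the overtness of
  finite sets, since it is a single formula instead of one for every type.
\<close>

definition setting :: "'b tm \<Rightarrow> 'b world \<Rightarrow> bool" where
  "setting T w \<longleftrightarrow> ty w T = Some (\<P> \<Omega>) \<and> w |= T \<^bold>= open_tv T \<and>
     w |= subset \<Omega> (open_tv T) \<Omega>\<^sub>\<not>\<^sub>\<not> \<and> w |= finite_join_closed (open_tv T)"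

lemma setting_mono: "setting T w \<Longrightarrow> w \<le> v \<Longrightarrow> setting T v"
  unfolding setting_def using ty_mono force_mono by blast

lemma setting_stable:
  assumes "setting T w" "w |= p \<^bold>\<in> open_tv T"
  shows "w |= p \<^bold>\<in> \<Omega>\<^sub>\<not>\<^sub>\<not>"
  using assms by (auto simp: setting_def force_subset)

lemma open_join:
  assumes "setting T w"
  shows "w |= \<^bold>\<bottom> \<^bold>\<in> open_tv T"
    and "w |= p \<^bold>\<in> open_tv T \<Longrightarrow> w |= q \<^bold>\<in> open_tv T \<Longrightarrow> w |= (p \<^bold>\<or> q) \<^bold>\<in> open_tv T"
  using assms by (auto simp: setting_def force_finite_join_closed)

lemma setting_ty [simp]: "setting T w \<Longrightarrow> ty w T = Some (\<P> \<Omega>)"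
  by (simp add: setting_def)

lemma test_iff: "setting T w \<Longrightarrow> w |= p \<^bold>\<in> T \<longleftrightarrow> w |= p \<^bold>\<in> open_tv T"
  unfolding setting_def
  using force_set_eq[of w T "open_tv T" p] force_set_eq[OF force_sym[of w T "open_tv T"], of p] by blast

lemma open_ty: "setting T w \<Longrightarrow> w |= p \<^bold>\<in> open_tv T \<Longrightarrow> ty w p = Some \<Omega>"
  by (rule mem_ty_elem[of _ _ "open_tv T"]) simp_all

lemma closed_ty: "setting T w \<Longrightarrow> w |= p \<^bold>\<in> closed_tv T \<Longrightarrow> ty w p = Some \<Omega>"
  by (rule mem_ty_elem[of _ _ "closed_tv T"]) simp_all

text \<open>
  To derive an open truth value, one may assume its negation and derive a contradiction.
\<close>

lemma open_stable:
  assumes "setting T w" "w |= p \<^bold>\<in> open_tv T"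
    and *: "\<And>v. w \<le> v \<Longrightarrow> v |= \<^bold>\<not> p \<Longrightarrow> v |= \<^bold>\<bottom>"
  shows "w |= p"
proof -
  have "w |= \<^bold>\<not> \<^bold>\<not> p"
    using * open_ty[OF assms(1,2)] by (intro force_impI) auto
  then show ?thesis
    using setting_stable[OF assms(1,2)] by (auto simp: force_stable)
qed

lemma open_top:
  assumes "setting T w" shows "w |= \<^bold>\<top> \<^bold>\<in> open_tv T"
proof (subst force_open, goal_cases)
  case 2
  have "v |= (\<^bold>\<top> \<^bold>\<and> t) \<^bold>\<in> T" if "w \<le> v" and t: "v |= t \<^bold>\<in> T" for v t
    using setting_mono[OF assms \<open>w \<le> v\<close>] mem_ty_elem[OF t, of \<Omega>] by (intro force_cong[OF t]) simp_all
  then show ?case by simp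
qed (simp add: assms)

lemma open_and:
  "setting T w \<Longrightarrow> w |= p \<^bold>\<in> open_tv T \<Longrightarrow> w |= q \<^bold>\<in> open_tv T \<Longrightarrow> w |= (p \<^bold>\<and> q) \<^bold>\<in> open_tv T"
  using force_open[of w T p] by (auto simp: test_iff)

lemma open_cong:
  "setting T w \<Longrightarrow> w |= p \<^bold>\<in> open_tv T \<Longrightarrow> ty w q = Some \<Omega> \<Longrightarrow> (\<And>v. w \<le> v \<Longrightarrow> v |= p \<longleftrightarrow> v |= q) \<Longrightarrow>
    w |= q \<^bold>\<in> open_tv T"
  by (rule force_cong[of w p]) simp_all

text \<open>
  The implication equals \<open>\<not>f \<or> t\<close>. The nontrivial direction uses stability of this disjunction:
  if it were false, then \<open>f\<close> would be false, since \<open>f\<close> gives \<open>t\<close>; but then the disjunction is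
  true.
\<close>

lemma open_imp:
  assumes w: "setting T w" and f: "w |= (\<^bold>\<not> f) \<^bold>\<in> open_tv T" and t: "w |= t \<^bold>\<in> open_tv T"
  shows "w |= (f \<^bold>\<rightarrow> t) \<^bold>\<in> open_tv T"
proof (rule open_cong[OF w open_join(2)[OF w f t]])
  have ty: "ty w f = Some \<Omega>" "ty w t = Some \<Omega>"
    using open_ty[OF w f] open_ty[OF w t] by (auto split: if_splits)
  then show "ty w (f \<^bold>\<rightarrow> t) = Some \<Omega>" by simp
  fix v assume v: "w \<le> v"
  note ty = ty[THEN ty_mono, OF v] and sv = setting_mono[OF w v]
    and fv = force_mono[OF f v] and tv = force_mono[OF t v]
  show "v |= \<^bold>\<not> f \<^bold>\<or> t \<longleftrightarrow> v |= f \<^bold>\<rightarrow> t"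
  proof
    assume "v |= \<^bold>\<not> f \<^bold>\<or> t"
    then show "v |= f \<^bold>\<rightarrow> t"
    proof (rule force_orE)
      fix u assume u: "v \<le> u" "u |= \<^bold>\<not> f"
      then show "u |= f \<^bold>\<rightarrow> t"
        using ty[THEN ty_mono, OF u(1)] ty(2)[THEN ty_mono, OF order_trans[OF u(1)]]
        by (auto intro!: force_impI force_bot[OF force_impE[OF u(2)]])
    next
      fix u assume u: "v \<le> u" "u |= t"
      then show "u |= f \<^bold>\<rightarrow> t"
        using ty[THEN ty_mono, OF u(1)] by (auto intro!: force_impI force_mono[OF u(2)])
    qed
  next
    assume imp: "v |= f \<^bold>\<rightarrow> t"
    show "v |= \<^bold>\<not> f \<^bold>\<or> t"
    proof (rule open_stable[OF sv open_join(2)[OF sv fv tv]])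
      fix u assume u: "v \<le> u" and no: "u |= \<^bold>\<not> (\<^bold>\<not> f \<^bold>\<or> t)"
      note ty = ty[THEN ty_mono, OF u]
      have "u |= \<^bold>\<not> f"
      proof (rule force_impI[OF ty(1)])
        fix x assume x: "u \<le> x" "x |= f"
        have "x |= t" using force_impE[OF imp order_trans[OF u x(1)] x(2)] .
        then have "x |= \<^bold>\<not> f \<^bold>\<or> t"
          using ty[THEN ty_mono, OF x(1)] by (auto intro: force_orI2)
        then show "x |= \<^bold>\<bottom>" by (rule force_impE[OF no x(1)])
      qed
      then have "u |= \<^bold>\<not> f \<^bold>\<or> t" using ty by (auto intro: force_orI1)
      then show "u |= \<^bold>\<bottom>" by (rule force_impE[OF no order_refl])
    qed
  qed
qed

text \<open>
  A closed \<open>f\<close> has \<open>\<not>f\<close> open because \<open>\<bottom>\<close> is a test truth value; the converse is \<open>open_imp\<close>.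
\<close>

lemma closed_iff:
  assumes w: "setting T w" and ty: "ty w f = Some \<Omega>"
  shows "w |= f \<^bold>\<in> closed_tv T \<longleftrightarrow> w |= (\<^bold>\<not> f) \<^bold>\<in> open_tv T"
proof
  assume "w |= f \<^bold>\<in> closed_tv T"
  then show "w |= (\<^bold>\<not> f) \<^bold>\<in> open_tv T"
    using w open_join(1)[OF w] by (auto simp: force_closed test_iff)
next
  assume *: "w |= (\<^bold>\<not> f) \<^bold>\<in> open_tv T"
  then show "w |= f \<^bold>\<in> closed_tv T"
    using w ty by (auto simp: force_closed test_iff setting_mono intro: open_imp force_mono[OF *])
qed

lemma closed_cong:
  "setting T w \<Longrightarrow> w |= p \<^bold>\<in> closed_tv T \<Longrightarrow> ty w q = Some \<Omega> \<Longrightarrow> (\<And>v. w \<le> v \<Longrightarrow> v |= p \<longleftrightarrow> v |= q) \<Longrightarrow>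
    w |= q \<^bold>\<in> closed_tv T"
  by (rule force_cong[of w p]) simp_all

lemma open_double_neg:
  assumes "setting T w" "w |= p \<^bold>\<in> open_tv T"
  shows "w |= \<^bold>\<not> \<^bold>\<not> p \<longleftrightarrow> w |= p"
  using open_stable[OF assms] not_not_intro force_impE[of w "\<^bold>\<not> p"] by blast

text \<open>
  The double negation of \<open>u\<close> is \<open>u\<close> itself, which is open.
\<close>

lemma neg_open_closed:
  assumes w: "setting T w" and u: "w |= u \<^bold>\<in> open_tv T"
  shows "w |= (\<^bold>\<not> u) \<^bold>\<in> closed_tv T"
proof -
  note ty = open_ty[OF w u]
  have "w |= (\<^bold>\<not> \<^bold>\<not> u) \<^bold>\<in> open_tv T"
    using w u
  proof (rule open_cong)
    show "v |= u \<longleftrightarrow> v |= \<^bold>\<not> \<^bold>\<not> u" if "w \<le> v" for v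
      using open_double_neg[OF setting_mono[OF w that] force_mono[OF u that]] by simp
  qed (simp add: ty)
  then show ?thesis using closed_iff[OF w, of "\<^bold>\<not> u"] ty by simp
qed

lemma neg_closed_open: "setting T w \<Longrightarrow> w |= f \<^bold>\<in> closed_tv T \<Longrightarrow> w |= (\<^bold>\<not> f) \<^bold>\<in> open_tv T"
  using closed_iff[of T w f] closed_ty[of T w f] by blast

lemma closed_tv_eq_neg_open:
  assumes w: "setting T w"
  shows "w |= closed_tv T \<^bold>= Compr \<Omega> ((\<^bold>\<not> V 0) \<^bold>\<in> \<up>(open_tv T))"
proof (subst force_set_ext[where A = \<Omega>])
  show "\<forall>v\<ge>w. \<forall>t. ty v t = Some \<Omega> \<longrightarrow>
      v |= t \<^bold>\<in> closed_tv T \<longleftrightarrow> v |= t \<^bold>\<in> Compr \<Omega> ((\<^bold>\<not> V 0) \<^bold>\<in> \<up>(open_tv T))"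
    using setting_mono[OF w] by (simp add: force_Compr closed_iff inst_def)
qed (use w in simp_all)

text \<open>
  An open \<open>u\<close> is the negation of the closed \<open>\<not>u\<close>.
\<close>

lemma open_tv_eq_neg_closed:
  assumes w: "setting T w"
  shows "w |= open_tv T \<^bold>= neg_set (closed_tv T)"
proof (rule force_set_extI[where A = \<Omega>])
  fix v u assume v: "w \<le> v"
  note w = setting_mono[OF w v]
  show "v |= u \<^bold>\<in> neg_set (closed_tv T)" if u: "v |= u \<^bold>\<in> open_tv T"
  proof (rule neg_setI[OF neg_open_closed[OF w u]])
    show "v |= u \<^bold>= \<^bold>\<not> \<^bold>\<not> u"
      using open_ty[OF w u] open_double_neg[OF setting_mono[OF w] force_mono[OF u]]
      by (simp add: force_prop_eq)
  qed (simp add: w)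
  show "v |= u \<^bold>\<in> open_tv T" if "v |= u \<^bold>\<in> neg_set (closed_tv T)"
    using that
    by (rule neg_setE)
       (use w mem_ty_elem[OF that, of \<Omega>] setting_mono[OF w] in
         \<open>auto intro: force_mem_eq[OF force_sym] neg_closed_open\<close>)
qed (use w in simp_all)

text \<open>
  A stable closed \<open>f\<close> is the negation of the open \<open>\<not>f\<close>.
\<close>

lemma neg_open_eq_stable_closed:
  assumes w: "setting T w"
  shows "w |= neg_set (neg_set (closed_tv T)) \<^bold>= neg_set (open_tv T) \<^bold>\<and>
    neg_set (open_tv T) \<^bold>= stable_closed_tv T"
  unfolding force_and
proof
  show "w |= neg_set (neg_set (closed_tv T)) \<^bold>= neg_set (open_tv T)"
    using force_replace[OF open_tv_eq_neg_closed[OF w], of "neg_set (V 0) \<^bold>= neg_set \<up>(open_tv T)" "\<P> \<Omega>"] w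
      force_refl[of w "neg_set (open_tv T)"]
    by (simp add: inst_def)
  show "w |= neg_set (open_tv T) \<^bold>= stable_closed_tv T"
  proof (rule force_set_extI[where A = \<Omega>])
    fix v f assume v: "w \<le> v"
    note w = setting_mono[OF w v]
    show "v |= f \<^bold>\<in> stable_closed_tv T" if "v |= f \<^bold>\<in> neg_set (open_tv T)"
      using that
    proof (rule neg_setE)
      fix x u assume x: "v \<le> x" "x |= u \<^bold>\<in> open_tv T" "x |= f \<^bold>= \<^bold>\<not> u"
      note w = setting_mono[OF w x(1)]
      have "x |= (\<^bold>\<not> u) \<^bold>\<in> stable_closed_tv T"
        using neg_open_closed[OF w x(2)] neg_stable[OF open_ty[OF w x(2)]] w
        by (simp add: force_stable_closed)
      then show "x |= f \<^bold>\<in> stable_closed_tv T" by (rule force_mem_eq[OF force_sym[OF x(3)]])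
    qed (use w mem_ty_elem[OF that, of \<Omega>] in simp_all)
    show "v |= f \<^bold>\<in> neg_set (open_tv T)" if f: "v |= f \<^bold>\<in> stable_closed_tv T"
    proof (rule neg_setI)
      have f: "v |= f \<^bold>\<in> closed_tv T" "v |= f \<^bold>\<in> \<Omega>\<^sub>\<not>\<^sub>\<not>"
        using f w by (simp_all add: force_stable_closed)
      show "v |= (\<^bold>\<not> f) \<^bold>\<in> open_tv T" using neg_closed_open[OF w f(1)] .
      show "v |= f \<^bold>= \<^bold>\<not> \<^bold>\<not> f"
        using f(2) not_not_intro by (auto simp: force_stable force_prop_eq)
    qed (use w in simp)
  qed (use w in simp_all)
qed

text \<open>
  By currying, \<open>\<not>(f \<and> g)\<close> is the implication \<open>f \<Rightarrow> \<not>g\<close> to which \<open>open_imp\<close> applies.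
\<close>

lemma closed_and:
  assumes w: "setting T w" and f: "w |= f \<^bold>\<in> closed_tv T" and g: "w |= g \<^bold>\<in> closed_tv T"
  shows "w |= (f \<^bold>\<and> g) \<^bold>\<in> closed_tv T"
proof -
  note ty = closed_ty[OF w f] closed_ty[OF w g]
  have "w |= (f \<^bold>\<rightarrow> \<^bold>\<not> g) \<^bold>\<in> open_tv T"
    using neg_closed_open[OF w g] neg_closed_open[OF w f] by (rule open_imp[OF w, rotated])
  then have "w |= (\<^bold>\<not> (f \<^bold>\<and> g)) \<^bold>\<in> open_tv T"
  proof (rule open_cong[OF w])
    fix v assume v: "w \<le> v"
    note ty = ty[THEN ty_mono, OF v]
    show "v |= f \<^bold>\<rightarrow> \<^bold>\<not> g \<longleftrightarrow> v |= \<^bold>\<not> (f \<^bold>\<and> g)"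
    proof
      assume *: "v |= f \<^bold>\<rightarrow> \<^bold>\<not> g"
      show "v |= \<^bold>\<not> (f \<^bold>\<and> g)"
        by (rule force_impI) (use ty * force_impE[OF force_impE[OF *]] in auto)
    next
      assume *: "v |= \<^bold>\<not> (f \<^bold>\<and> g)"
      show "v |= f \<^bold>\<rightarrow> \<^bold>\<not> g"
      proof (rule force_impI[OF ty(1)], rule force_impI)
        fix u x assume u: "v \<le> u" "u |= f" "u \<le> x" "x |= g"
        then show "x |= \<^bold>\<bottom>"
          using force_impE[OF * order_trans[OF u(1,3)]] force_mono[OF u(2,3)] by simp
      qed (rule ty_mono[OF ty(2)])
    qed
  qed (simp add: ty)
  then show ?thesis using closed_iff[OF w, of "f \<^bold>\<and> g"] ty by simp
qed

lemma closed_or: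
  assumes w: "setting T w" and f: "w |= f \<^bold>\<in> closed_tv T" and g: "w |= g \<^bold>\<in> closed_tv T"
  shows "w |= (f \<^bold>\<or> g) \<^bold>\<in> closed_tv T"
proof -
  note ty = closed_ty[OF w f] closed_ty[OF w g]
  have "w |= (\<^bold>\<not> f \<^bold>\<and> \<^bold>\<not> g) \<^bold>\<in> open_tv T"
    using neg_closed_open[OF w f] neg_closed_open[OF w g] by (rule open_and[OF w])
  then have "w |= (\<^bold>\<not> (f \<^bold>\<or> g)) \<^bold>\<in> open_tv T"
  proof (rule open_cong[OF w])
    fix v assume v: "w \<le> v"
    note ty = ty[THEN ty_mono, OF v]
    show "v |= \<^bold>\<not> f \<^bold>\<and> \<^bold>\<not> g \<longleftrightarrow> v |= \<^bold>\<not> (f \<^bold>\<or> g)"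
    proof
      assume "v |= \<^bold>\<not> f \<^bold>\<and> \<^bold>\<not> g"
      then have *: "v |= \<^bold>\<not> f" "v |= \<^bold>\<not> g" by simp_all
      show "v |= \<^bold>\<not> (f \<^bold>\<or> g)"
      proof (rule force_impI)
        show "u |= \<^bold>\<bottom>" if "v \<le> u" "u |= f \<^bold>\<or> g" for u
          using that(2) by (rule force_orE)
            (use that(1) in \<open>auto intro: force_impE[OF *(1) order_trans] force_impE[OF *(2) order_trans]\<close>)
      qed (simp add: ty)
    next
      assume *: "v |= \<^bold>\<not> (f \<^bold>\<or> g)"
      have "v |= \<^bold>\<not> f" "v |= \<^bold>\<not> g"
        using ty[THEN ty_mono] by (auto intro!: force_impI intro: force_impE[OF *] force_orI1 force_orI2 simp: ty)
      then show "v |= \<^bold>\<not> f \<^bold>\<and> \<^bold>\<not> g" by simp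
    qed
  qed (simp add: ty)
  then show ?thesis using closed_iff[OF w, of "f \<^bold>\<or> g"] ty by simp
qed

lemma closed_bot: assumes w: "setting T w" shows "w |= \<^bold>\<bottom> \<^bold>\<in> closed_tv T"
  unfolding closed_iff[OF w, of "\<^bold>\<bottom>", simplified]
  by (rule open_cong[OF w open_top[OF w]]) (auto intro: force_impI)

lemma closed_top: assumes w: "setting T w" shows "w |= \<^bold>\<top> \<^bold>\<in> closed_tv T"
  unfolding closed_iff[OF w, of "\<^bold>\<top>", simplified]
  by (rule open_cong[OF w open_join(1)[OF w]]) (auto intro!: force_impI elim: force_mono force_impE[OF _ order_refl])

lemma closed_bounded_sublattice: assumes w: "setting T w" shows "w |= bounded_sublattice (closed_tv T)"
  using setting_mono[OF w] w
  by (intro bounded_sublatticeI) (auto intro: closed_top closed_bot closed_and closed_or)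

lemma closed_finite_join_closed:
  assumes w: "setting T w" shows "w |= finite_join_closed (closed_tv T)"
  using setting_mono[OF w] w by (auto simp: force_finite_join_closed intro: closed_bot closed_or)

text \<open>
  If \<open>p\<close> is open and closed, then \<open>p \<or> \<not>p\<close> is open, hence stable, and its double negation is an
  intuitionistic tautology. Conversely a decidable truth value equals \<open>\<top>\<close> or \<open>\<bottom>\<close>.
\<close>

lemma open_inter_closed_decidable:
  assumes w: "setting T w"
  shows "w |= inter \<Omega> (open_tv T) (closed_tv T) \<^bold>= decidable_tv \<^bold>\<and>
        decidable_tv \<^bold>= inter \<Omega> (open_tv T) (stable_closed_tv T)"
proof -
  have open_closed: "v |= p \<^bold>\<in> decidable_tv"
    if v: "w \<le> v" and p: "v |= p \<^bold>\<in> open_tv T" "v |= p \<^bold>\<in> closed_tv T" for v p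
    unfolding force_decidable
  proof (rule open_stable)
    note w = setting_mono[OF w v]
    show "setting T v" by fact
    note ty = open_ty[OF w p(1)]
    show "v |= (p \<^bold>\<or> \<^bold>\<not> p) \<^bold>\<in> open_tv T"
      by (intro open_join(2) neg_closed_open w p)
    fix u assume u: "v \<le> u" "u |= \<^bold>\<not> (p \<^bold>\<or> \<^bold>\<not> p)"
    have "u |= \<^bold>\<not> p"
    proof (rule force_impI[OF ty_mono[OF ty u(1)]])
      fix x assume x: "u \<le> x" "x |= p"
      then have "x |= p \<^bold>\<or> \<^bold>\<not> p"
        using ty_mono[OF ty order_trans[OF u(1)]] by (auto intro: force_orI1)
      then show "x |= \<^bold>\<bottom>" by (rule force_impE[OF u(2) x(1)])
    qed
    then show "u |= \<^bold>\<bottom>"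
      using force_impE[OF u(2) order_refl] ty_mono[OF ty u(1)] by (auto intro: force_orI2)
  qed
  have decidable: "v |= p \<^bold>\<in> open_tv T \<and> v |= p \<^bold>\<in> stable_closed_tv T"
    if v: "w \<le> v" and p: "v |= p \<^bold>\<in> decidable_tv" for v p
  proof -
    note w = setting_mono[OF w v]
    have ty: "ty v p = Some \<Omega>" using p by (rule mem_ty_elem) simp
    have "v |= p \<^bold>\<in> open_tv T \<^bold>\<and> p \<^bold>\<in> closed_tv T \<^bold>\<and> p \<^bold>\<in> \<Omega>\<^sub>\<not>\<^sub>\<not>"
      using p[unfolded force_decidable]
    proof (rule force_orE)
      fix u assume u: "v \<le> u" "u |= p"
      note w = setting_mono[OF w u(1)] and ty = ty_mono[OF ty u(1)]
      have "u |= p \<^bold>\<in> open_tv T"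
        by (rule open_cong[OF w open_top[OF w] ty]) (use u(2) force_mono in auto)
      moreover have "u |= p \<^bold>\<in> closed_tv T"
        by (rule closed_cong[OF w closed_top[OF w] ty]) (use u(2) force_mono in auto)
      ultimately show "u |= p \<^bold>\<in> open_tv T \<^bold>\<and> p \<^bold>\<in> closed_tv T \<^bold>\<and> p \<^bold>\<in> \<Omega>\<^sub>\<not>\<^sub>\<not>"
        using setting_stable[OF w] by simp
    next
      fix u assume u: "v \<le> u" "u |= \<^bold>\<not> p"
      note w = setting_mono[OF w u(1)] and ty = ty_mono[OF ty u(1)]
      have *: "x |= \<^bold>\<bottom> \<longleftrightarrow> x |= p" if "u \<le> x" for x
        using that force_impE[OF u(2) that] force_bot[of x p] ty_mono[OF ty that] by blast
      have "u |= p \<^bold>\<in> open_tv T"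
        by (rule open_cong[OF w open_join(1)[OF w] ty]) (use * in auto)
      moreover have "u |= p \<^bold>\<in> closed_tv T"
        by (rule closed_cong[OF w closed_bot[OF w] ty]) (use * in auto)
      ultimately show "u |= p \<^bold>\<in> open_tv T \<^bold>\<and> p \<^bold>\<in> closed_tv T \<^bold>\<and> p \<^bold>\<in> \<Omega>\<^sub>\<not>\<^sub>\<not>"
        using setting_stable[OF w] by simp
    qed
    then show ?thesis using w by (simp add: force_stable_closed)
  qed
  show ?thesis
    unfolding force_and
  proof
    show "w |= inter \<Omega> (open_tv T) (closed_tv T) \<^bold>= decidable_tv"
    proof (rule force_set_extI[where A = \<Omega>])
      fix v p assume v: "w \<le> v"
      note w = setting_mono[OF w v]
      show "v |= p \<^bold>\<in> decidable_tv" if "v |= p \<^bold>\<in> inter \<Omega> (open_tv T) (closed_tv T)"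
        using that open_closed[OF v] w by (simp add: force_inter)
      show "v |= p \<^bold>\<in> inter \<Omega> (open_tv T) (closed_tv T)" if "v |= p \<^bold>\<in> decidable_tv"
        using decidable[OF v that] w by (simp add: force_inter force_stable_closed)
    qed (simp_all add: w)
    show "w |= decidable_tv \<^bold>= inter \<Omega> (open_tv T) (stable_closed_tv T)"
    proof (rule force_set_extI[where A = \<Omega>])
      fix v p assume v: "w \<le> v"
      note w = setting_mono[OF w v]
      show "v |= p \<^bold>\<in> decidable_tv" if "v |= p \<^bold>\<in> inter \<Omega> (open_tv T) (stable_closed_tv T)"
        using that open_closed[OF v] w by (simp add: force_inter force_stable_closed)
      show "v |= p \<^bold>\<in> inter \<Omega> (open_tv T) (stable_closed_tv T)" if "v |= p \<^bold>\<in> decidable_tv"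
        using decidable[OF v that] w by (simp add: force_inter force_stable_closed)
    qed (simp_all add: w)
  qed
qed

section \<open>Transitivity, dominance and codominance\<close>

text \<open>
  For \<open>t \<in> X\<close>, the truth value of \<open>t \<in> R\<close> is that of \<open>t \<in> S \<and> t \<in> R\<close>, where \<open>t \<in> R\<close> is open once
  \<open>t \<in> S\<close> holds.
\<close>

lemma dominance_imp_transitive:
  assumes w: "setting T w" and dom: "w |= dominance T"
  shows "w |= transitive (open_tv T) A"
proof (rule transitiveI)
  fix v X S R
  assume v: "w \<le> v"
    and ty: "ty v X = Some (\<P> A)" "ty v S = Some (\<P> A)" "ty v R = Some (\<P> A)"
    and S: "v |= tv_subset A (open_tv T) S X" and R: "v |= tv_subset A (open_tv T) R S"
  note w = setting_mono[OF w v] and dom = force_mono[OF dom v]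
  note [simp] = setting_ty[OF w] ty
  show "v |= tv_subset A (open_tv T) R X"
  proof (rule tv_subsetI)
    fix x t assume x: "v \<le> x"
    note w = setting_mono[OF w x]
    show "x |= t \<^bold>\<in> X" if "x |= t \<^bold>\<in> R"
      using tv_subsetD1[OF S x] tv_subsetD1[OF R x] that by simp
    show "x |= (t \<^bold>\<in> R) \<^bold>\<in> open_tv T" if t: "x |= t \<^bold>\<in> X"
    proof -
      have [simp]: "ty x t = Some A" using mem_ty_elem[OF t] ty_mono[OF ty(1) x] by simp
      note [simp] = ty[THEN ty_mono, OF x]
      have u: "x |= (t \<^bold>\<in> S) \<^bold>\<in> open_tv T" using tv_subsetD2[OF S x t] by simp
      have "x |= (t \<^bold>\<in> S) \<^bold>\<rightarrow> ((t \<^bold>\<in> R) \<^bold>\<in> T)"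
      proof (rule force_impI)
        fix y assume y: "x \<le> y" "y |= t \<^bold>\<in> S"
        show "y |= (t \<^bold>\<in> R) \<^bold>\<in> T"
          using tv_subsetD2[OF R order_trans[OF x y(1)] y(2)] test_iff[OF setting_mono[OF w y(1)]] by simp
      qed simp
      from dominanceD[OF force_mono[OF dom x] u this]
      have "x |= (t \<^bold>\<in> S \<^bold>\<and> t \<^bold>\<in> R) \<^bold>\<in> open_tv T" using test_iff[OF w] by simp
      then show ?thesis
        by (rule open_cong[OF w]) (use tv_subsetD1[OF R order_trans[OF x]] in auto)
    qed
  qed simp_all
qed (simp add: w)

text \<open>
  A truth value \<open>p\<close> is encoded by the subset \<open>{* | p}\<close> of the one-point set.
\<close>

lemma tv_subset_One:
  assumes ty: "ty w p = Some \<Omega>" "ty w q = Some \<Omega>" "ty w W = Some (\<P> \<Omega>)"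
    and sub: "\<And>v. w \<le> v \<Longrightarrow> v |= p \<Longrightarrow> v |= q"
    and mem: "\<And>v. w \<le> v \<Longrightarrow> v |= q \<Longrightarrow> v |= p \<^bold>\<in> W"
  shows "w |= tv_subset One W (Compr One \<up>p) (Compr One \<up>q)"
proof (rule tv_subsetI)
  fix v t assume v: "w \<le> v"
  note tyv = ty[THEN ty_mono, OF v]
  show "v |= t \<^bold>\<in> Compr One \<up>q" if "v |= t \<^bold>\<in> Compr One \<up>p"
    using that tyv sub[OF v] by (simp add: force_Compr inst_def)
  show "v |= (t \<^bold>\<in> Compr One \<up>p) \<^bold>\<in> W" if t: "v |= t \<^bold>\<in> Compr One \<up>q"
  proof -
    have tyt: "ty v t = Some One" and q: "v |= q" using t tyv by (simp_all add: force_Compr inst_def)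
    from mem[OF v q] show ?thesis
    proof (rule force_cong)
      show "u |= p \<longleftrightarrow> u |= t \<^bold>\<in> Compr One \<up>p" if "v \<le> u" for u
        using tyt[THEN ty_mono, OF that] tyv[THEN ty_mono, OF that] by (simp add: force_Compr inst_def)
    qed (simp_all add: tyt tyv)
  qed
qed (simp_all add: ty)

text \<open>
  Transitivity for the chain of subsets of the one-point set that is given by \<open>p \<Rightarrow> q \<Rightarrow> \<top>\<close>.
\<close>

lemma transitive_One:
  assumes trans: "w |= transitive W One"
    and ty: "ty w p = Some \<Omega>" "ty w q = Some \<Omega>" "ty w W = Some (\<P> \<Omega>)"
    and q: "w |= q \<^bold>\<in> W" and sub: "\<And>v. w \<le> v \<Longrightarrow> v |= p \<Longrightarrow> v |= q"
    and p: "\<And>v. w \<le> v \<Longrightarrow> v |= q \<Longrightarrow> v |= p \<^bold>\<in> W"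
  shows "w |= p \<^bold>\<in> W"
proof -
  have "w |= tv_subset One W (Compr One \<up>p) (Compr One \<up>\<^bold>\<top>)"
  proof (rule transitiveD[OF trans])
    show "w |= tv_subset One W (Compr One \<up>q) (Compr One \<up>\<^bold>\<top>)"
      by (rule tv_subset_One) (use ty force_mono[OF q] in simp_all)
    show "w |= tv_subset One W (Compr One \<up>p) (Compr One \<up>q)"
      by (rule tv_subset_One) (use ty sub p in simp_all)
  qed (simp_all add: ty)
  then have "w |= (Star \<^bold>\<in> Compr One \<up>p) \<^bold>\<in> W"
    by (rule tv_subsetD2) (simp_all add: force_Compr inst_def ty)
  then show ?thesis
  proof (rule force_cong)
    show "v |= Star \<^bold>\<in> Compr One \<up>p \<longleftrightarrow> v |= p" if "w \<le> v" for v
      using ty_mono[OF ty(1) that] by (simp add: force_Compr inst_def)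
  qed (simp_all add: ty)
qed

lemma transitive_imp_dominance:
  assumes w: "setting T w" and trans: "w |= transitive (open_tv T) One"
  shows "w |= dominance T"
proof (rule dominanceI)
  fix v u p
  assume v: "w \<le> v" and u: "v |= u \<^bold>\<in> open_tv T" and p: "ty v p = Some \<Omega>"
    and imp: "v |= u \<^bold>\<rightarrow> (p \<^bold>\<in> T)"
  note w = setting_mono[OF w v] and ty = open_ty[OF w u] p
  have "v |= (u \<^bold>\<and> p) \<^bold>\<in> open_tv T"
    using force_mono[OF trans v] _ ty(1) _ u
  proof (rule transitive_One)
    fix x assume x: "v \<le> x" and ux: "x |= u"
    note w = setting_mono[OF w x]
    have "x |= p \<^bold>\<in> open_tv T" using force_impE[OF imp x ux] test_iff[OF w] by simp
    then show "x |= (u \<^bold>\<and> p) \<^bold>\<in> open_tv T"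
      by (rule open_cong[OF w]) (use ty[THEN ty_mono, OF x] force_mono[OF ux] in simp_all)
  qed (use w ty in simp_all)
  then show "v |= (u \<^bold>\<and> p) \<^bold>\<in> T" by (simp add: test_iff[OF w])
qed (simp add: w)

text \<open>
  Under \<open>f\<close> the truth value \<open>p\<close> is open and may be proved by contradiction.
\<close>

lemma imp_as_neg:
  assumes w: "setting T w" and ty: "ty w f = Some \<Omega>" "ty w p = Some \<Omega>" and imp: "w |= f \<^bold>\<rightarrow> (p \<^bold>\<in> T)"
  shows "w |= \<^bold>\<not> (f \<^bold>\<and> \<^bold>\<not> p) \<longleftrightarrow> w |= f \<^bold>\<rightarrow> p"
proof
  assume fp: "w |= f \<^bold>\<rightarrow> p"
  show "w |= \<^bold>\<not> (f \<^bold>\<and> \<^bold>\<not> p)"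
  proof (rule force_impI)
    fix v assume v: "w \<le> v" "v |= f \<^bold>\<and> \<^bold>\<not> p"
    then have "v |= p" "v |= \<^bold>\<not> p" using force_impE[OF fp v(1)] by simp_all
    then show "v |= \<^bold>\<bottom>" using force_impE[OF _ order_refl] by blast
  qed (simp add: ty)
next
  assume no: "w |= \<^bold>\<not> (f \<^bold>\<and> \<^bold>\<not> p)"
  show "w |= f \<^bold>\<rightarrow> p"
  proof (rule force_impI[OF ty(1)])
    fix v assume v: "w \<le> v" "v |= f"
    note w = setting_mono[OF w v(1)]
    show "v |= p"
    proof (rule open_stable[OF w])
      show "v |= p \<^bold>\<in> open_tv T" using force_impE[OF imp v] by (simp add: test_iff[OF w])
      fix u assume u: "v \<le> u" "u |= \<^bold>\<not> p"
      show "u |= \<^bold>\<bottom>"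
        using force_impE[OF no order_trans[OF v(1) u(1)]] force_mono[OF v(2) u(1)] u(2) by simp
    qed
  qed
qed

text \<open>
  The negation of \<open>t \<in> R\<close> is equivalent to \<open>t \<in> S \<Rightarrow> \<not>(t \<in> R)\<close> because \<open>R \<subseteq> S\<close>; codominance
  applies to the latter, as \<open>\<not>(t \<in> R)\<close> is open once \<open>t \<in> S\<close> holds.
\<close>

lemma codominance_imp_transitive:
  assumes w: "setting T w" and codom: "w |= codominance T"
  shows "w |= transitive (closed_tv T) A"
proof (rule transitiveI)
  fix v X S R
  assume v: "w \<le> v"
    and ty: "ty v X = Some (\<P> A)" "ty v S = Some (\<P> A)" "ty v R = Some (\<P> A)"
    and S: "v |= tv_subset A (closed_tv T) S X" and R: "v |= tv_subset A (closed_tv T) R S"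
  note w = setting_mono[OF w v] and codom = force_mono[OF codom v]
  note [simp] = setting_ty[OF w] ty
  show "v |= tv_subset A (closed_tv T) R X"
  proof (rule tv_subsetI)
    fix x t assume x: "v \<le> x"
    note w = setting_mono[OF w x]
    show "x |= t \<^bold>\<in> X" if "x |= t \<^bold>\<in> R"
      using tv_subsetD1[OF S x] tv_subsetD1[OF R x] that by simp
    show "x |= (t \<^bold>\<in> R) \<^bold>\<in> closed_tv T" if t: "x |= t \<^bold>\<in> X"
    proof -
      have tyt [simp]: "ty x t = Some A" using mem_ty_elem[OF t] ty_mono[OF ty(1) x] by simp
      note [simp] = ty[THEN ty_mono, OF x]
      have f: "x |= (t \<^bold>\<in> S) \<^bold>\<in> closed_tv T" using tv_subsetD2[OF S x t] by simp
      have "x |= (t \<^bold>\<in> S) \<^bold>\<rightarrow> ((\<^bold>\<not> (t \<^bold>\<in> R)) \<^bold>\<in> T)"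
      proof (rule force_impI)
        fix y assume y: "x \<le> y" "y |= t \<^bold>\<in> S"
        note w = setting_mono[OF w y(1)]
        have "y |= (t \<^bold>\<in> R) \<^bold>\<in> closed_tv T" using tv_subsetD2[OF R order_trans[OF x y(1)] y(2)] by simp
        then show "y |= (\<^bold>\<not> (t \<^bold>\<in> R)) \<^bold>\<in> T"
          unfolding test_iff[OF w] by (rule neg_closed_open[OF w])
      qed simp
      from codominanceD[OF force_mono[OF codom x] f this]
      have "x |= (t \<^bold>\<in> S \<^bold>\<rightarrow> \<^bold>\<not> (t \<^bold>\<in> R)) \<^bold>\<in> open_tv T" using test_iff[OF w] by simp
      then have "x |= (\<^bold>\<not> (t \<^bold>\<in> R)) \<^bold>\<in> open_tv T"
      proof (rule open_cong[OF w])
        fix y assume y: "x \<le> y"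
        have ty: "ty y (t \<^bold>\<in> R) = Some \<Omega>" "ty y (t \<^bold>\<in> S) = Some \<Omega>"
          by (rule ty_mono[OF _ y], simp)+
        show "y |= t \<^bold>\<in> S \<^bold>\<rightarrow> \<^bold>\<not> (t \<^bold>\<in> R) \<longleftrightarrow> y |= \<^bold>\<not> (t \<^bold>\<in> R)"
        proof
          assume *: "y |= t \<^bold>\<in> S \<^bold>\<rightarrow> \<^bold>\<not> (t \<^bold>\<in> R)"
          show "y |= \<^bold>\<not> (t \<^bold>\<in> R)"
          proof (rule force_impI[OF ty(1)])
            fix z assume z: "y \<le> z" "z |= t \<^bold>\<in> R"
            have "z |= t \<^bold>\<in> S"
              using tv_subsetD1[OF R order_trans[OF x order_trans[OF y z(1)]] z(2)] by simp
            from force_impE[OF * z(1) this] show "z |= \<^bold>\<bottom>"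
              using z(2) force_impE[OF _ order_refl] by blast
          qed
        next
          assume *: "y |= \<^bold>\<not> (t \<^bold>\<in> R)"
          show "y |= t \<^bold>\<in> S \<^bold>\<rightarrow> \<^bold>\<not> (t \<^bold>\<in> R)"
            by (rule force_impI[OF ty(2)]) (rule force_mono[OF *])
        qed
      qed simp
      then show ?thesis by (simp add: closed_iff[OF w])
    qed
  qed simp_all
qed (simp add: w)

text \<open>
  Transitivity makes \<open>f \<and> \<not>p\<close> closed, and \<open>f \<Rightarrow> p\<close> is its negation.
\<close>

lemma transitive_imp_codominance:
  assumes w: "setting T w" and trans: "w |= transitive (closed_tv T) One"
  shows "w |= codominance T"
proof (rule codominanceI)
  fix v f p
  assume v: "w \<le> v" and f: "v |= f \<^bold>\<in> closed_tv T" and p: "ty v p = Some \<Omega>"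
    and imp: "v |= f \<^bold>\<rightarrow> (p \<^bold>\<in> T)"
  note w = setting_mono[OF w v] and ty = closed_ty[OF w f] p
  have "v |= (f \<^bold>\<and> \<^bold>\<not> p) \<^bold>\<in> closed_tv T"
    using force_mono[OF trans v] _ ty(1) _ f
  proof (rule transitive_One)
    fix x assume x: "v \<le> x" and fx: "x |= f"
    note w = setting_mono[OF w x]
    have "x |= p \<^bold>\<in> open_tv T" using force_impE[OF imp x fx] test_iff[OF w] by simp
    then have "x |= (\<^bold>\<not> p) \<^bold>\<in> closed_tv T" by (rule neg_open_closed[OF w])
    then show "x |= (f \<^bold>\<and> \<^bold>\<not> p) \<^bold>\<in> closed_tv T"
      by (rule closed_cong[OF w]) (use ty[THEN ty_mono, OF x] force_mono[OF fx] in simp_all)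
  qed (use w ty in simp_all)
  then have "v |= (\<^bold>\<not> (f \<^bold>\<and> \<^bold>\<not> p)) \<^bold>\<in> open_tv T" by (rule neg_closed_open[OF w])
  then have "v |= (f \<^bold>\<rightarrow> p) \<^bold>\<in> open_tv T"
  proof (rule open_cong[OF w])
    show "x |= \<^bold>\<not> (f \<^bold>\<and> \<^bold>\<not> p) \<longleftrightarrow> x |= f \<^bold>\<rightarrow> p" if x: "v \<le> x" for x
      by (rule imp_as_neg[OF setting_mono[OF w x] _ _ force_mono[OF imp x]]) (simp_all add: ty[THEN ty_mono, OF x])
  qed (simp add: ty)
  then show "v |= (f \<^bold>\<rightarrow> p) \<^bold>\<in> T" by (simp add: test_iff[OF w])
qed (simp add: w)

abbreviation complement :: "'b ty \<Rightarrow> 'b tm \<Rightarrow> 'b tm \<Rightarrow> 'b tm" where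
  "complement B Y S \<equiv> Compr B (V 0 \<^bold>\<in> \<up>Y \<^bold>\<and> \<^bold>\<not> (V 0 \<^bold>\<in> \<up>S))"

lemma force_complement:
  assumes "ty w Y = Some (\<P> B)" "ty w S = Some (\<P> B)"
  shows "w |= y \<^bold>\<in> complement B Y S \<longleftrightarrow> w |= y \<^bold>\<in> Y \<and> w |= \<^bold>\<not> (y \<^bold>\<in> S)"
  using assms mem_ty_elem[of w y Y B] by (auto simp: force_Compr inst_def)

lemma tv_subset_complement:
  assumes W: "ty w W = Some (\<P> \<Omega>)" and ty: "ty w Y = Some (\<P> B)" "ty w S = Some (\<P> B)"
    and neg: "\<And>v y. w \<le> v \<Longrightarrow> v |= y \<^bold>\<in> Y \<Longrightarrow> v |= (\<^bold>\<not> (y \<^bold>\<in> S)) \<^bold>\<in> W"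
  shows "w |= tv_subset B W (complement B Y S) Y"
proof (rule tv_subsetI)
  fix v y assume v: "w \<le> v"
  note tyv = ty[THEN ty_mono, OF v]
  show "v |= y \<^bold>\<in> Y" if "v |= y \<^bold>\<in> complement B Y S" using that by (simp add: force_complement tyv)
  show "v |= (y \<^bold>\<in> complement B Y S) \<^bold>\<in> W" if y: "v |= y \<^bold>\<in> Y"
  proof (rule force_cong[OF neg[OF v y]])
    show "x |= \<^bold>\<not> (y \<^bold>\<in> S) \<longleftrightarrow> x |= y \<^bold>\<in> complement B Y S" if "v \<le> x" for x
      using tyv[THEN ty_mono, OF that] force_mono[OF y that] by (simp add: force_complement)
  qed (use mem_ty_elem[OF y tyv(1)] tyv ty_mono[OF W v] in simp_all)
qed (simp_all add: W ty)

lemma complement_closed: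
  assumes w: "setting T w" and S: "w |= tv_subset B (open_tv T) S Y"
    and ty: "ty w Y = Some (\<P> B)" "ty w S = Some (\<P> B)"
  shows "w |= tv_subset B (stable_closed_tv T) (complement B Y S) Y"
proof (rule tv_subset_complement)
  fix v y assume v: "w \<le> v" and y: "v |= y \<^bold>\<in> Y"
  note w' = setting_mono[OF w v]
  have u: "v |= (y \<^bold>\<in> S) \<^bold>\<in> open_tv T" using tv_subsetD2[OF S v y] w ty by simp
  show "v |= (\<^bold>\<not> (y \<^bold>\<in> S)) \<^bold>\<in> stable_closed_tv T"
    using neg_open_closed[OF w' u] neg_stable[OF open_ty[OF w' u]] w' by (simp add: force_stable_closed)
qed (simp_all add: w ty)

lemma complement_open:
  assumes w: "setting T w" and S: "w |= tv_subset B (closed_tv T) S Y"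
    and ty: "ty w Y = Some (\<P> B)" "ty w S = Some (\<P> B)"
  shows "w |= tv_subset B (open_tv T) (complement B Y S) Y"
proof (rule tv_subset_complement)
  fix v y assume v: "w \<le> v" and y: "v |= y \<^bold>\<in> Y"
  show "v |= (\<^bold>\<not> (y \<^bold>\<in> S)) \<^bold>\<in> open_tv T"
    using tv_subsetD2[OF S v y] neg_closed_open[OF setting_mono[OF w v]] w ty by simp
qed (simp_all add: w ty)

text \<open>
  The test subset \<open>B\<close> of \<open>S\<close> is the trace of \<open>C = {t \<in> X | t \<in> S \<Rightarrow> t \<in> B}\<close>. By transitivity
  \<open>S - B\<close> is closed in \<open>X\<close>, and \<open>C\<close> is its complement by \<open>imp_as_neg\<close>.
\<close>

lemma stable_closed_subspace:
  assumes w: "setting T w" and trans: "w |= transitive (stable_closed_tv T) A"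
    and ty: "ty w X = Some (\<P> A)" "ty w S = Some (\<P> A)"
    and S: "w |= tv_subset A (stable_closed_tv T) S X"
  shows "w |= subspace T A S X"
proof -
  note [simp] = setting_ty[OF w] ty
  have "w |= subset A S X" using S by (simp add: force_subset force_tv_subset)
  moreover have "w |= \<^bold>\<forall>[\<P> A] (tv_subset A \<up>T (V 0) \<up>S \<^bold>\<rightarrow>
         (\<^bold>\<exists>[\<P> A] (tv_subset A \<up>\<up>T (V 0) \<up>\<up>X \<^bold>\<and> V 1 \<^bold>= inter A \<up>\<up>S (V 0))))"
  proof (subst force_all_imp, goal_cases)
    case 3
    have "v |= \<^bold>\<exists>[\<P> A] (tv_subset A \<up>T (V 0) \<up>X \<^bold>\<and> \<up>B \<^bold>= inter A \<up>S (V 0))"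
      if v: "w \<le> v" and B: "ty v B = Some (\<P> A)" and BS: "v |= tv_subset A T B S" for v B
    proof -
      note w = setting_mono[OF w v] and S = force_mono[OF S v]
      note ty = setting_ty[OF w] ty[THEN ty_mono, OF v] B
      note [simp] = ty
      \<comment> \<open>the test subset of \<open>X\<close> that restricts to \<open>B\<close>\<close>
      let ?C = "Compr A (V 0 \<^bold>\<in> \<up>X \<^bold>\<and> (V 0 \<^bold>\<in> \<up>S \<^bold>\<rightarrow> V 0 \<^bold>\<in> \<up>B))"
      let ?R = "complement A S B"
      have C: "x |= t \<^bold>\<in> ?C \<longleftrightarrow> x |= t \<^bold>\<in> X \<and> x |= t \<^bold>\<in> S \<^bold>\<rightarrow> t \<^bold>\<in> B"
        and R: "x |= t \<^bold>\<in> ?R \<longleftrightarrow> x |= t \<^bold>\<in> S \<and> x |= \<^bold>\<not> (t \<^bold>\<in> B)" if "v \<le> x" for x t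
        using ty[THEN ty_mono, OF that] mem_ty_elem[of x t _ A] by (auto simp: force_Compr inst_def)
      have BS1: "x |= t \<^bold>\<in> S" if "v \<le> x" "x |= t \<^bold>\<in> B" for x t
        using tv_subsetD1[OF BS that] by simp
      have BS2: "x |= (t \<^bold>\<in> B) \<^bold>\<in> T" if "v \<le> x" "x |= t \<^bold>\<in> S" for x t
        using tv_subsetD2[OF BS that] by simp
      have RX: "v |= tv_subset A (stable_closed_tv T) ?R X"
        by (rule transitiveD[OF force_mono[OF trans v] S complement_closed[OF w]])
           (use tv_subset_mono[OF BS, of "open_tv T"] test_iff[OF setting_mono[OF w]] in simp_all)
      have CX: "v |= tv_subset A T ?C X"
      proof (rule tv_subsetI)
        fix x t assume x: "v \<le> x"
        note w = setting_mono[OF w x] and ty = ty[THEN ty_mono, OF x]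
        show "x |= t \<^bold>\<in> X" if "x |= t \<^bold>\<in> ?C" using that C[OF x] by simp
        show "x |= (t \<^bold>\<in> ?C) \<^bold>\<in> T" if t: "x |= t \<^bold>\<in> X"
        proof -
          have tyt: "ty x t = Some A" using mem_ty_elem[OF t] ty by simp
          have "x |= (t \<^bold>\<in> ?R) \<^bold>\<in> closed_tv T"
            using tv_subsetD2[OF RX x t] w by (simp add: force_stable_closed)
          then have "x |= (\<^bold>\<not> (t \<^bold>\<in> ?R)) \<^bold>\<in> open_tv T" by (rule neg_closed_open[OF w])
          then have "x |= (t \<^bold>\<in> ?C) \<^bold>\<in> open_tv T"
          proof (rule open_cong[OF w])
            fix y assume y: "x \<le> y"
            note vy = order_trans[OF x y]
            note tyy = ty[THEN ty_mono, OF y] tyt[THEN ty_mono, OF y]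
            have imp: "y |= t \<^bold>\<in> S \<^bold>\<rightarrow> ((t \<^bold>\<in> B) \<^bold>\<in> T)"
              by (rule force_impI) (use tyy BS2[OF order_trans[OF vy]] in simp_all)
            have "y |= \<^bold>\<not> (t \<^bold>\<in> ?R) \<longleftrightarrow> y |= \<^bold>\<not> (t \<^bold>\<in> S \<^bold>\<and> \<^bold>\<not> (t \<^bold>\<in> B))"
              using R[OF order_trans[OF vy]] tyy by (simp add: force_neg)
            also have "\<dots> \<longleftrightarrow> y |= t \<^bold>\<in> S \<^bold>\<rightarrow> t \<^bold>\<in> B"
              by (rule imp_as_neg[OF setting_mono[OF w y] _ _ imp]) (simp_all add: tyy)
            also have "\<dots> \<longleftrightarrow> y |= t \<^bold>\<in> ?C"
              using C[OF vy] force_mono[OF t y] by simp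
            finally show "y |= \<^bold>\<not> (t \<^bold>\<in> ?R) \<longleftrightarrow> y |= t \<^bold>\<in> ?C" .
          qed (simp add: ty tyt)
          then show ?thesis by (simp add: test_iff[OF w])
        qed
      qed simp_all
      have "v |= B \<^bold>= inter A S ?C"
      proof (rule force_set_extI)
        fix x t assume x: "v \<le> x"
        note ty = ty[THEN ty_mono, OF x]
        show "x |= t \<^bold>\<in> inter A S ?C" if t: "x |= t \<^bold>\<in> B"
        proof -
          have "x |= t \<^bold>\<in> S" "x |= t \<^bold>\<in> X" using BS1[OF x t] tv_subsetD1[OF S x] by simp_all
          moreover have "x |= t \<^bold>\<in> S \<^bold>\<rightarrow> t \<^bold>\<in> B"
            by (rule force_impI) (use force_mono[OF t] force_ty[OF \<open>x |= t \<^bold>\<in> S\<close>] in simp_all)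
          ultimately show ?thesis using ty C[OF x] by (simp add: force_inter)
        qed
        show "x |= t \<^bold>\<in> B" if "x |= t \<^bold>\<in> inter A S ?C"
          using that ty C[OF x] force_impE[OF _ order_refl, of x "t \<^bold>\<in> S"] by (simp add: force_inter)
      qed simp_all
      with CX show ?thesis
        by (intro force_exI[of _ _ ?C]) (simp_all add: inst_def)
    qed
    then show ?case by (simp add: inst_def)
  qed simp_all
  ultimately show ?thesis by (simp add: subspace_def)
qed

section \<open>Compact and condensed maps\<close>

lemma app_inI:
  assumes "w |= \<langle>x, y\<rangle> \<^bold>\<in> f" "w |= y \<^bold>\<in> S" and S: "ty w S = Some (\<P> B)"
  shows "w |= app_in B f x S"
proof -
  have y: "ty w y = Some B" using assms(2) S by (rule mem_ty_elem)
  obtain C where C: "ty w \<langle>x, y\<rangle> = Some C" "ty w f = Some (\<P> C)"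
    using assms(1) by (rule mem_ty)
  then obtain A where "ty w x = Some A" "C = A \<^bold>\<times> B"
    using y by (auto split: option.splits)
  then show ?thesis
    unfolding app_in_def using assms S y C by (intro force_exI[of _ _ y]) (simp_all add: inst_def)
qed

lemma app_inE:
  assumes "w |= app_in B f x S" "ty w \<chi> = Some \<Omega>"
    and *: "\<And>v y. w \<le> v \<Longrightarrow> ty v y = Some B \<Longrightarrow> v |= \<langle>x, y\<rangle> \<^bold>\<in> f \<Longrightarrow> v |= y \<^bold>\<in> S \<Longrightarrow> v |= \<chi>"
  shows "w |= \<chi>"
  using assms(1)[unfolded app_in_def] assms(2)
  by (rule force_exE) (auto simp: inst_def intro: *)

lemma is_map_dom:
  assumes f: "w |= is_map A B f X Y" and "w \<le> v" "v |= \<langle>x, y\<rangle> \<^bold>\<in> f" "ty w f = Some (\<P> (A \<^bold>\<times> B))"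
  shows "v |= x \<^bold>\<in> X" "v |= y \<^bold>\<in> Y"
proof -
  have "ty v \<langle>x, y\<rangle> = Some (A \<^bold>\<times> B)" using assms by (blast intro: mem_ty_elem ty_mono)
  then have ty: "ty v x = Some A" "ty v y = Some B" by (auto split: option.splits)
  have 1: "w |= \<^bold>\<forall>[A] \<^bold>\<forall>[B] (\<langle>V 1, V 0\<rangle> \<^bold>\<in> \<up>\<up>f \<^bold>\<rightarrow> V 1 \<^bold>\<in> \<up>\<up>X \<^bold>\<and> V 0 \<^bold>\<in> \<up>\<up>Y)"
    using f by (simp add: is_map_def)
  note 2 = force_allE[OF 1 \<open>w \<le> v\<close> ty(1), unfolded inst_def, simplified]
  note 3 = force_allE[OF 2 order_refl ty(2), unfolded inst_def, simplified]
  show "v |= x \<^bold>\<in> X" "v |= y \<^bold>\<in> Y" using force_impE[OF 3 order_refl assms(3)] by simp_all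
qed

text \<open>
  The value of a functional relation, as an elimination rule: there is no function symbol for
  it, and it exists only at later worlds.
\<close>

lemma is_map_value:
  assumes f: "w |= is_map A B f X Y" and x: "w |= x \<^bold>\<in> X" and \<chi>: "ty w \<chi> = Some \<Omega>"
    and ty: "ty w f = Some (\<P> (A \<^bold>\<times> B))" "ty w X = Some (\<P> A)"
    and *: "\<And>v y. w \<le> v \<Longrightarrow> v |= \<langle>x, y\<rangle> \<^bold>\<in> f \<Longrightarrow> ty v y = Some B \<Longrightarrow>
      (\<And>u z. v \<le> u \<Longrightarrow> u |= \<langle>x, z\<rangle> \<^bold>\<in> f \<Longrightarrow> u |= z \<^bold>= y) \<Longrightarrow> v |= \<chi>"
  shows "w |= \<chi>"
proof -
  have tyx: "ty w x = Some A" using x ty(2) by (rule mem_ty_elem)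
  have 1: "w |= \<^bold>\<forall>[A, X] \<^bold>\<exists>[B] (\<langle>V 1, V 0\<rangle> \<^bold>\<in> \<up>\<up>f \<^bold>\<and> (\<^bold>\<forall>[B] (\<langle>V 2, V 0\<rangle> \<^bold>\<in> \<up>\<up>\<up>f \<^bold>\<rightarrow> V 0 \<^bold>= V 1)))"
    using f by (simp add: is_map_def)
  note 2 = force_allE[OF 1 order_refl tyx, unfolded inst_def numeral_2_eq_2, simplified]
  have 3: "w |= \<^bold>\<exists>[B] (\<langle>\<up>x, V 0\<rangle> \<^bold>\<in> \<up>f \<^bold>\<and> (\<^bold>\<forall>[B] (\<langle>\<up>\<up>x, V 0\<rangle> \<^bold>\<in> \<up>\<up>f \<^bold>\<rightarrow> V 0 \<^bold>= V 1)))"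
    using force_impE[OF 2 order_refl x] by simp
  from 3 \<chi> show ?thesis
  proof (rule force_exE)
    fix v y
    assume v: "w \<le> v" "ty v y = Some B"
      and y: "v |= (\<langle>\<up>x, V 0\<rangle> \<^bold>\<in> \<up>f \<^bold>\<and> (\<^bold>\<forall>[B] (\<langle>\<up>\<up>x, V 0\<rangle> \<^bold>\<in> \<up>\<up>f \<^bold>\<rightarrow> V 0 \<^bold>= V 1)))\<^bold>[y\<^bold>]"
    have y: "v |= \<langle>x, y\<rangle> \<^bold>\<in> f" "v |= \<^bold>\<forall>[B] (\<langle>\<up>x, V 0\<rangle> \<^bold>\<in> \<up>f \<^bold>\<rightarrow> V 0 \<^bold>= \<up>y)"
      using y by (simp_all add: inst_def)
    show "v |= \<chi>"
    proof (rule *[OF v(1) y(1) v(2)])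
      fix u z assume u: "v \<le> u" "u |= \<langle>x, z\<rangle> \<^bold>\<in> f"
      have "ty u \<langle>x, z\<rangle> = Some (A \<^bold>\<times> B)"
        using mem_ty_elem[OF u(2) ty_mono[OF ty(1) order_trans[OF v(1) u(1)]]] .
      then have "ty u z = Some B" by (auto split: option.splits)
      from force_allE[OF y(2) u(1) this, unfolded inst_def, simplified]
      show "u |= z \<^bold>= y" using force_impE[OF _ order_refl u(2)] by simp
    qed
  qed
qed

lemma app_in_value:
  assumes f: "v |= \<langle>x, y\<rangle> \<^bold>\<in> f" and uniq: "\<And>u z. v \<le> u \<Longrightarrow> u |= \<langle>x, z\<rangle> \<^bold>\<in> f \<Longrightarrow> u |= z \<^bold>= y"
    and ty: "ty v y = Some B" "ty v S = Some (\<P> B)"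
  shows "v |= app_in B f x S \<longleftrightarrow> v |= y \<^bold>\<in> S"
proof
  assume "v |= app_in B f x S"
  then show "v |= y \<^bold>\<in> S"
    by (rule app_inE) (use ty uniq force_mem_eq in \<open>simp_all, blast\<close>)
next
  assume "v |= y \<^bold>\<in> S"
  with f show "v |= app_in B f x S" using ty(2) by (rule app_inI)
qed

abbreviation ex_in :: "'b ty \<Rightarrow> 'b ty \<Rightarrow> 'b tm \<Rightarrow> 'b tm \<Rightarrow> 'b tm \<Rightarrow> 'b tm" where
  "ex_in A B f X S \<equiv> \<^bold>\<exists>[A, X] app_in B \<up>f (V 0) \<up>S"

abbreviation all_in :: "'b ty \<Rightarrow> 'b ty \<Rightarrow> 'b tm \<Rightarrow> 'b tm \<Rightarrow> 'b tm \<Rightarrow> 'b tm" where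
  "all_in A B f X S \<equiv> \<^bold>\<forall>[A, X] app_in B \<up>f (V 0) \<up>S"

lemma force_ex_preserves:
  assumes "ty w W = Some (\<P> \<Omega>)" "ty w W' = Some (\<P> \<Omega>)" "ty w f = Some (\<P> (A \<^bold>\<times> B))"
    "ty w X = Some (\<P> A)" "ty w Y = Some (\<P> B)"
  shows "w |= ex_preserves A B W W' f X Y \<longleftrightarrow>
    (\<forall>v\<ge>w. \<forall>S. ty v S = Some (\<P> B) \<longrightarrow> v |= tv_subset B W S Y \<longrightarrow> v |= ex_in A B f X S \<^bold>\<in> W')"
  unfolding ex_preserves_def by (subst force_all_imp) (simp_all add: assms inst_def)

lemma force_all_preserves:
  assumes "ty w W = Some (\<P> \<Omega>)" "ty w W' = Some (\<P> \<Omega>)" "ty w f = Some (\<P> (A \<^bold>\<times> B))"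
    "ty w X = Some (\<P> A)" "ty w Y = Some (\<P> B)"
  shows "w |= all_preserves A B W W' f X Y \<longleftrightarrow>
    (\<forall>v\<ge>w. \<forall>S. ty v S = Some (\<P> B) \<longrightarrow> v |= tv_subset B W S Y \<longrightarrow> v |= all_in A B f X S \<^bold>\<in> W')"
  unfolding all_preserves_def by (subst force_all_imp) (simp_all add: assms inst_def)

lemma ex_inI:
  assumes "w |= x \<^bold>\<in> X" "w |= app_in B f x S"
    "ty w f = Some (\<P> (A \<^bold>\<times> B))" "ty w X = Some (\<P> A)" "ty w S = Some (\<P> B)"
  shows "w |= ex_in A B f X S"
  using assms mem_ty_elem[OF assms(1,4)] by (intro force_exI[of _ _ x]) (simp_all add: inst_def)

lemma ex_inE:
  assumes "w |= ex_in A B f X S" "ty w \<chi> = Some \<Omega>"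
    and *: "\<And>v x. w \<le> v \<Longrightarrow> v |= x \<^bold>\<in> X \<Longrightarrow> v |= app_in B f x S \<Longrightarrow> v |= \<chi>"
  shows "w |= \<chi>"
  using assms(1,2) by (rule force_exE) (auto simp: inst_def intro: *)

lemma force_all_in:
  assumes "ty w f = Some (\<P> (A \<^bold>\<times> B))" "ty w X = Some (\<P> A)" "ty w S = Some (\<P> B)"
  shows "w |= all_in A B f X S \<longleftrightarrow> (\<forall>v\<ge>w. \<forall>x. v |= x \<^bold>\<in> X \<longrightarrow> v |= app_in B f x S)"
  using mem_ty_elem[OF _ ty_mono[OF assms(2)]]
  by (subst force_all_imp) (auto simp: assms inst_def)

text \<open>
  Pointwise \<open>f(x) \<in> U\<close> is the negation of \<open>f(x) \<in> F\<close>, and \<open>\<forall>x. \<not>\<phi>\<close> is intuitionistically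
  equivalent to \<open>\<not>\<exists>x. \<phi>\<close>.
\<close>

lemma all_in_complement:
  assumes f: "w |= is_map A B f X Y"
    and ty: "ty w f = Some (\<P> (A \<^bold>\<times> B))" "ty w X = Some (\<P> A)" "ty w U = Some (\<P> B)" "ty w F = Some (\<P> B)"
    and compl: "\<And>v y. w \<le> v \<Longrightarrow> v |= y \<^bold>\<in> Y \<Longrightarrow> v |= y \<^bold>\<in> U \<longleftrightarrow> v |= \<^bold>\<not> (y \<^bold>\<in> F)"
  shows "w |= all_in A B f X U \<longleftrightarrow> w |= \<^bold>\<not> ex_in A B f X F"
proof
  assume all: "w |= all_in A B f X U"
  show "w |= \<^bold>\<not> ex_in A B f X F"
  proof (rule force_impI)
    fix v assume v: "w \<le> v" "v |= ex_in A B f X F"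
    show "v |= \<^bold>\<bottom>"
      using v(2)
    proof (rule ex_inE)
      fix u x assume u: "v \<le> u" and x: "u |= x \<^bold>\<in> X" and xF: "u |= app_in B f x F"
      note wu = order_trans[OF v(1) u]
      note tyu = ty[THEN ty_mono, OF wu]
      have xU: "u |= app_in B f x U" using all wu x by (simp add: force_all_in ty)
      show "u |= \<^bold>\<bottom>"
        using force_mono[OF f wu] x _ tyu(1,2)
      proof (rule is_map_value)
        fix t y
        assume t: "u \<le> t" and y: "t |= \<langle>x, y\<rangle> \<^bold>\<in> f" "ty t y = Some B"
          and uniq: "\<And>u z. t \<le> u \<Longrightarrow> u |= \<langle>x, z\<rangle> \<^bold>\<in> f \<Longrightarrow> u |= z \<^bold>= y"
        note tyt = tyu[THEN ty_mono, OF t] and wt = order_trans[OF wu t]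
        have yY: "t |= y \<^bold>\<in> Y" using is_map_dom(2)[OF f wt y(1) ty(1)] .
        have "t |= y \<^bold>\<in> U" "t |= y \<^bold>\<in> F"
          using app_in_value[OF y(1) uniq y(2)] tyt force_mono[OF xU t] force_mono[OF xF t] by blast+
        then show "t |= \<^bold>\<bottom>" using compl[OF wt yY] force_impE[OF _ order_refl] by blast
      qed simp
    qed simp
  qed (simp add: ty)
next
  assume no: "w |= \<^bold>\<not> ex_in A B f X F"
  have "v |= app_in B f x U" if v: "w \<le> v" and x: "v |= x \<^bold>\<in> X" for v x
  proof -
    note tyv = ty[THEN ty_mono, OF v]
    show ?thesis
      using force_mono[OF f v] x _ tyv(1,2)
    proof (rule is_map_value)
      show "ty v (app_in B f x U) = Some \<Omega>" using mem_ty_elem[OF x tyv(2)] tyv by simp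
      fix t y
      assume t: "v \<le> t" and y: "t |= \<langle>x, y\<rangle> \<^bold>\<in> f" "ty t y = Some B"
        and uniq: "\<And>u z. t \<le> u \<Longrightarrow> u |= \<langle>x, z\<rangle> \<^bold>\<in> f \<Longrightarrow> u |= z \<^bold>= y"
      note tyt = tyv[THEN ty_mono, OF t] and wt = order_trans[OF v t]
      have "t |= y \<^bold>\<in> Y" using is_map_dom(2)[OF f wt y(1) ty(1)] .
      moreover have "t |= \<^bold>\<not> (y \<^bold>\<in> F)"
      proof (rule force_impI)
        fix r assume r: "t \<le> r" "r |= y \<^bold>\<in> F"
        note tyr = tyt[THEN ty_mono, OF r(1)]
        have "r |= ex_in A B f X F"
          by (rule ex_inI[OF force_mono[OF x order_trans[OF t r(1)]] app_inI[OF force_mono[OF y(1) r(1)] r(2)]])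
             (simp_all add: tyr)
        then show "r |= \<^bold>\<bottom>" by (rule force_impE[OF no order_trans[OF wt r(1)]])
      qed (simp add: tyt y)
      ultimately have "t |= y \<^bold>\<in> U" using compl[OF wt] by simp
      then show "t |= app_in B f x U" using app_in_value[OF y(1) uniq y(2)] tyt by blast
    qed
  qed
  then show "w |= all_in A B f X U" by (simp add: force_all_in ty)
qed

lemma strongly_condensed_iff_compact:
  assumes w: "setting T w"
    and ty: "ty w f = Some (\<P> (A \<^bold>\<times> B))" "ty w X = Some (\<P> A)" "ty w Y = Some (\<P> B)"
  shows "w |= strongly_condensed T A B f X Y \<longleftrightarrow> w |= compact_map T A B f X Y"
proof -
  have "v |= tv_subset B T S Y \<longleftrightarrow> v |= tv_subset B (open_tv T) S Y"
    if v: "w \<le> v" "ty v S = Some (\<P> B)" for v S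
    using setting_mono[OF w v(1)] setting_mono[OF setting_mono[OF w v(1)]] ty(3)[THEN ty_mono, OF v(1)] v(2)
    by (simp add: force_tv_subset test_iff)
  then show ?thesis
    unfolding strongly_condensed_def compact_map_def
    using w setting_mono[OF w] ty by (simp add: force_all_preserves test_iff)
qed

lemma condensed_imp_stable:
  assumes w: "setting T w"
    and ty: "ty w f = Some (\<P> (A \<^bold>\<times> B))" "ty w X = Some (\<P> A)" "ty w Y = Some (\<P> B)"
    and cond: "w |= condensed T A B f X Y"
  shows "w |= condensed_on_stable T A B f X Y"
proof -
  have "v |= ex_in A B f X S \<^bold>\<in> closed_tv T"
    if v: "w \<le> v" "ty v S = Some (\<P> B)" "v |= tv_subset B (stable_closed_tv T) S Y" for v S
  proof -
    note w' = setting_mono[OF w v(1)]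
    have "v |= tv_subset B (closed_tv T) S Y"
      by (rule tv_subset_mono[OF v(3)])
         (use w' v(2) ty(3)[THEN ty_mono, OF v(1)] setting_mono[OF w'] in \<open>simp_all add: force_stable_closed\<close>)
    then show ?thesis
      using cond v w ty unfolding condensed_def by (simp add: force_ex_preserves)
  qed
  then show ?thesis
    using w ty unfolding condensed_on_stable_def by (simp add: force_ex_preserves)
qed

text \<open>
  The complement of an open \<open>U\<close> is stable and closed, and \<open>U\<close> is in turn the complement of it
  because \<open>U\<close> is stable.
\<close>

lemma condensed_on_stable_imp_compact:
  assumes w: "setting T w" and f: "w |= is_map A B f X Y"
    and ty: "ty w f = Some (\<P> (A \<^bold>\<times> B))" "ty w X = Some (\<P> A)" "ty w Y = Some (\<P> B)"
    and cond: "w |= condensed_on_stable T A B f X Y"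
  shows "w |= compact_map T A B f X Y"
proof -
  have "v |= all_in A B f X U \<^bold>\<in> open_tv T"
    if v: "w \<le> v" and U: "ty v U = Some (\<P> B)" "v |= tv_subset B (open_tv T) U Y" for v U
  proof -
    note w' = setting_mono[OF w v] and tyv = ty[THEN ty_mono, OF v]
    let ?F = "complement B Y U"
    have F: "ty v ?F = Some (\<P> B)" using tyv U by simp
    have "v |= ex_in A B f X ?F \<^bold>\<in> closed_tv T"
      using cond v F complement_closed[OF w' U(2) tyv(3) U(1)] w ty
      unfolding condensed_on_stable_def by (simp add: force_ex_preserves)
    then have "v |= \<^bold>\<not> ex_in A B f X ?F \<^bold>\<in> open_tv T" by (rule neg_closed_open[OF w'])
    then show ?thesis
    proof (rule open_cong[OF w'])
      fix x assume x: "v \<le> x"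
      have vx: "w \<le> x" using v x by (rule order_trans)
      note tyx = tyv[THEN ty_mono, OF x] U(1)[THEN ty_mono, OF x]
      have "x |= all_in A B f X U \<longleftrightarrow> x |= \<^bold>\<not> ex_in A B f X ?F"
      proof (rule all_in_complement[OF force_mono[OF f vx]])
        fix z y assume z: "x \<le> z" and y: "z |= y \<^bold>\<in> Y"
        note tyz = tyx[THEN ty_mono, OF z]
        note wz = setting_mono[OF w order_trans[OF vx z]]
        have tyy: "ty z y = Some B" using y tyz(3) by (rule mem_ty_elem)
        have op: "z |= (y \<^bold>\<in> U) \<^bold>\<in> open_tv T"
          by (rule tv_subsetD2[OF U(2) order_trans[OF x z] y]) (simp_all add: w' U tyv)
        have "z |= \<^bold>\<not> (y \<^bold>\<in> ?F) \<longleftrightarrow> z |= \<^bold>\<not> \<^bold>\<not> (y \<^bold>\<in> U)"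
        proof -
          have "r |= y \<^bold>\<in> ?F \<longleftrightarrow> r |= \<^bold>\<not> (y \<^bold>\<in> U)" if "z \<le> r" for r
            using tyz[THEN ty_mono, OF that] force_mono[OF y that] by (simp add: force_complement)
          then show ?thesis using tyy tyz by (simp add: force_imp[of z])
        qed
        then show "z |= y \<^bold>\<in> U \<longleftrightarrow> z |= \<^bold>\<not> (y \<^bold>\<in> ?F)" using open_double_neg[OF wz op] by simp
      qed (simp_all add: tyx)
      then show "x |= \<^bold>\<not> ex_in A B f X ?F \<longleftrightarrow> x |= all_in A B f X U" by simp
    qed (simp add: tyv U)
  qed
  then show ?thesis
    using w ty unfolding compact_map_def by (simp add: force_all_preserves)
qed

text \<open>
  The existential quantification over \<open>F\<close> is closed because its negation is the universal one
  over the open complement of \<open>F\<close>; \<open>F\<close> itself is an arbitrary closed subset, stable or not.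
\<close>

lemma compact_imp_condensed:
  assumes w: "setting T w" and f: "w |= is_map A B f X Y"
    and ty: "ty w f = Some (\<P> (A \<^bold>\<times> B))" "ty w X = Some (\<P> A)" "ty w Y = Some (\<P> B)"
    and comp: "w |= compact_map T A B f X Y"
  shows "w |= condensed T A B f X Y"
proof -
  have "v |= ex_in A B f X F \<^bold>\<in> closed_tv T"
    if v: "w \<le> v" and F: "ty v F = Some (\<P> B)" "v |= tv_subset B (closed_tv T) F Y" for v F
  proof -
    note w' = setting_mono[OF w v] and tyv = ty[THEN ty_mono, OF v]
    let ?U = "complement B Y F"
    have U: "ty v ?U = Some (\<P> B)" using tyv F by simp
    have "v |= all_in A B f X ?U \<^bold>\<in> open_tv T"
      using comp v U complement_open[OF w' F(2) tyv(3) F(1)] w ty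
      unfolding compact_map_def by (simp add: force_all_preserves)
    then have "v |= \<^bold>\<not> ex_in A B f X F \<^bold>\<in> open_tv T"
    proof (rule open_cong[OF w'])
      fix x assume x: "v \<le> x"
      note tyx = tyv[THEN ty_mono, OF x] F(1)[THEN ty_mono, OF x]
      show "x |= all_in A B f X ?U \<longleftrightarrow> x |= \<^bold>\<not> ex_in A B f X F"
        by (rule all_in_complement[OF force_mono[OF f order_trans[OF v x]]])
           (simp_all add: tyx force_complement tyx[THEN ty_mono])
    qed (simp add: tyv F)
    then show ?thesis using closed_iff[OF w', of "ex_in A B f X F"] tyv F by simp
  qed
  then show ?thesis
    using w ty unfolding condensed_def by (simp add: force_ex_preserves)
qed

lemma map_notions_agree_at:
  assumes w: "setting T w" and f: "w |= is_map A B f X Y"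
    and ty: "ty w f = Some (\<P> (A \<^bold>\<times> B))" "ty w X = Some (\<P> A)" "ty w Y = Some (\<P> B)"
  shows "w |= strongly_condensed T A B f X Y \<longleftrightarrow> w |= condensed T A B f X Y"
    and "w |= condensed T A B f X Y \<longleftrightarrow> w |= compact_map T A B f X Y"
    and "w |= condensed T A B f X Y \<longleftrightarrow> w |= condensed_on_stable T A B f X Y"
  using strongly_condensed_iff_compact[OF w ty] condensed_imp_stable[OF w ty]
    condensed_on_stable_imp_compact[OF w f ty] compact_imp_condensed[OF w f ty] by blast+

lemma map_notions_agree:
  assumes w: "setting T w"
  shows "w |= \<^bold>\<forall>[\<P> A] \<^bold>\<forall>[\<P> B] \<^bold>\<forall>[\<P> (A \<^bold>\<times> B)] (is_map A B (V 0) (V 2) (V 1) \<^bold>\<rightarrow>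
        (strongly_condensed \<up>\<up>\<up>T A B (V 0) (V 2) (V 1) \<^bold>\<leftrightarrow> condensed \<up>\<up>\<up>T A B (V 0) (V 2) (V 1)) \<^bold>\<and>
        (condensed \<up>\<up>\<up>T A B (V 0) (V 2) (V 1) \<^bold>\<leftrightarrow> compact_map \<up>\<up>\<up>T A B (V 0) (V 2) (V 1)) \<^bold>\<and>
        (condensed \<up>\<up>\<up>T A B (V 0) (V 2) (V 1) \<^bold>\<leftrightarrow> condensed_on_stable \<up>\<up>\<up>T A B (V 0) (V 2) (V 1)))"
proof (rule force_allI, goal_cases)
  case (2 x X)
  note w = setting_mono[OF w 2(1)] and X = 2(2)
  have "x |= \<^bold>\<forall>[\<P> B] \<^bold>\<forall>[\<P> (A \<^bold>\<times> B)] (is_map A B (V 0) \<up>\<up>X (V 1) \<^bold>\<rightarrow>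
        (strongly_condensed \<up>\<up>T A B (V 0) \<up>\<up>X (V 1) \<^bold>\<leftrightarrow> condensed \<up>\<up>T A B (V 0) \<up>\<up>X (V 1)) \<^bold>\<and>
        (condensed \<up>\<up>T A B (V 0) \<up>\<up>X (V 1) \<^bold>\<leftrightarrow> compact_map \<up>\<up>T A B (V 0) \<up>\<up>X (V 1)) \<^bold>\<and>
        (condensed \<up>\<up>T A B (V 0) \<up>\<up>X (V 1) \<^bold>\<leftrightarrow> condensed_on_stable \<up>\<up>T A B (V 0) \<up>\<up>X (V 1)))"
  proof (rule force_allI, goal_cases)
    case (2 y Y)
    note w = setting_mono[OF w 2(1)] and X = ty_mono[OF X 2(1)] and Y = 2(2)
    have "y |= \<^bold>\<forall>[\<P> (A \<^bold>\<times> B)] (is_map A B (V 0) \<up>X \<up>Y \<^bold>\<rightarrow>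
        (strongly_condensed \<up>T A B (V 0) \<up>X \<up>Y \<^bold>\<leftrightarrow> condensed \<up>T A B (V 0) \<up>X \<up>Y) \<^bold>\<and>
        (condensed \<up>T A B (V 0) \<up>X \<up>Y \<^bold>\<leftrightarrow> compact_map \<up>T A B (V 0) \<up>X \<up>Y) \<^bold>\<and>
        (condensed \<up>T A B (V 0) \<up>X \<up>Y \<^bold>\<leftrightarrow> condensed_on_stable \<up>T A B (V 0) \<up>X \<up>Y))"
    proof (subst force_all_imp, goal_cases)
      case 3
      have "z |= (strongly_condensed T A B f X Y \<^bold>\<leftrightarrow> condensed T A B f X Y) \<^bold>\<and>
          (condensed T A B f X Y \<^bold>\<leftrightarrow> compact_map T A B f X Y) \<^bold>\<and>
          (condensed T A B f X Y \<^bold>\<leftrightarrow> condensed_on_stable T A B f X Y)"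
        if z: "y \<le> z" and tyf: "ty z f = Some (\<P> (A \<^bold>\<times> B))" and f: "z |= is_map A B f X Y" for z f
      proof -
        note w = setting_mono[OF w z] and ty = tyf X[THEN ty_mono, OF z] Y[THEN ty_mono, OF z]
        have iff: "r |= strongly_condensed T A B f X Y \<longleftrightarrow> r |= condensed T A B f X Y"
          "r |= condensed T A B f X Y \<longleftrightarrow> r |= compact_map T A B f X Y"
          "r |= condensed T A B f X Y \<longleftrightarrow> r |= condensed_on_stable T A B f X Y" if "z \<le> r" for r
          using map_notions_agree_at[OF setting_mono[OF w that] force_mono[OF f that] ty[THEN ty_mono, OF that]] .
        show ?thesis
          unfolding force_and[of z "(_ \<^bold>\<leftrightarrow> _)"]
          using w ty iff by (intro conjI force_iff) (simp_all add: setting_ty)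
      qed
      then show ?case by (simp add: inst_def)
    qed (use w X Y in simp_all)
    then show ?case by (simp add: inst_def)
  qed (use w X in simp)
  then show ?case by (simp add: inst_def numeral_2_eq_2)
qed (use w in simp)

section \<open>Finite sets\<close>

lemma nat_leI:
  assumes ty: "ty w k = Some \<N>" "ty w n = Some \<N>"
    and *: "\<And>v S. w \<le> v \<Longrightarrow> ty v S = Some (\<P> \<N>) \<Longrightarrow> v |= k \<^bold>\<in> S \<Longrightarrow>
      (\<And>u m. v \<le> u \<Longrightarrow> u |= m \<^bold>\<in> S \<Longrightarrow> u |= Succ m \<^bold>\<in> S) \<Longrightarrow> v |= n \<^bold>\<in> S"
  shows "w |= nat_le k n"
  unfolding nat_le_def
proof (subst force_all_imp, goal_cases)
  case 3
  have "v |= n \<^bold>\<in> S"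
    if v: "w \<le> v" and S: "ty v S = Some (\<P> \<N>)" and k: "v |= k \<^bold>\<in> S"
      and step: "v |= \<^bold>\<forall>[\<N>] (V 0 \<^bold>\<in> \<up>S \<^bold>\<rightarrow> Succ (V 0) \<^bold>\<in> \<up>S)" for v S
  proof (rule *[OF v S k])
    fix u m assume u: "v \<le> u" and m: "u |= m \<^bold>\<in> S"
    have "ty u m = Some \<N>" using m ty_mono[OF S u] by (rule mem_ty_elem)
    from force_allE[OF step u this, unfolded inst_def, simplified]
    show "u |= Succ m \<^bold>\<in> S" by (rule force_impE[OF _ order_refl m])
  qed
  then show ?case by (simp add: inst_def)
qed (simp_all add: ty)

lemma nat_leD:
  assumes le: "w |= nat_le k n" and S: "ty w S = Some (\<P> \<N>)" and k: "w |= k \<^bold>\<in> S"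
    and step: "\<And>v m. w \<le> v \<Longrightarrow> v |= m \<^bold>\<in> S \<Longrightarrow> v |= Succ m \<^bold>\<in> S"
  shows "w |= n \<^bold>\<in> S"
proof -
  note 1 = force_allE[OF le[unfolded nat_le_def] order_refl S, unfolded inst_def, simplified]
  have "w |= \<^bold>\<forall>[\<N>] (V 0 \<^bold>\<in> \<up>S \<^bold>\<rightarrow> Succ (V 0) \<^bold>\<in> \<up>S)"
    using step by (subst force_all_imp) (simp_all add: S inst_def)
  then show ?thesis using force_impE[OF 1 order_refl] k by simp
qed

lemma nat_le_refl: "ty w k = Some \<N> \<Longrightarrow> w |= nat_le k k"
  by (rule nat_leI)

lemma nat_le_ty:
  assumes "w |= nat_le k n" shows "ty w k = Some \<N>" "ty w n = Some \<N>"
proof -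
  have *: "ty w t = Some \<N>" if "tyof (\<P> \<N> # ctx w) (\<up>t \<^bold>\<in> V 0) = Some \<Omega>" for t
    using that by (auto split: option.splits if_splits)
  show "ty w k = Some \<N>" "ty w n = Some \<N>"
    using force_ty[OF assms] unfolding nat_le_def
    by (auto intro!: * split: if_splits simp del: tyof.simps(7))
qed

lemma nat_le_Succ:
  assumes "w |= nat_le k n" shows "w |= nat_le k (Succ n)"
proof (rule nat_leI)
  fix v S
  assume v: "w \<le> v" and S: "ty v S = Some (\<P> \<N>)" "v |= k \<^bold>\<in> S"
    and step: "\<And>u m. v \<le> u \<Longrightarrow> u |= m \<^bold>\<in> S \<Longrightarrow> u |= Succ m \<^bold>\<in> S"
  show "v |= Succ n \<^bold>\<in> S"
    using nat_leD[OF force_mono[OF assms v] S step] step by blast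
qed (use nat_le_ty[OF assms] in simp_all)

lemma mem_nats_below:
  assumes "ty w n = Some \<N>"
  shows "w |= k \<^bold>\<in> nats_below n \<longleftrightarrow> ty w k = Some \<N> \<and> w |= nat_le (Succ k) n"
  unfolding nats_below_def using assms by (simp add: force_Compr inst_def)

lemma below_ty: "w |= k \<^bold>\<in> nats_below n \<Longrightarrow> ty w n = Some \<N> \<Longrightarrow> ty w k = Some \<N>"
  by (simp add: mem_nats_below)

lemma below_SuccI1: "w |= k \<^bold>\<in> nats_below n \<Longrightarrow> ty w n = Some \<N> \<Longrightarrow> w |= k \<^bold>\<in> nats_below (Succ n)"
  by (simp add: mem_nats_below nat_le_Succ)

lemma below_SuccI2: "ty w n = Some \<N> \<Longrightarrow> w |= n \<^bold>\<in> nats_below (Succ n)"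
  by (simp add: mem_nats_below nat_le_refl)

lemma Succ_neq_Zero: "w |= Succ n \<^bold>= Zero \<Longrightarrow> w |= \<^bold>\<bottom>"
  unfolding forces_def by (rule prv.succ_neq_zero)

lemma not_below_Zero:
  assumes "w |= k \<^bold>\<in> nats_below Zero"
  shows "w |= \<^bold>\<bottom>"
proof -
  \<comment> \<open>the set of nonzero numbers contains every successor, hence every upper bound of one\<close>
  let ?S = "Compr \<N> (\<^bold>\<not> (V 0 \<^bold>= Zero))"
  have S: "v |= m \<^bold>\<in> ?S \<longleftrightarrow> ty v m = Some \<N> \<and> v |= \<^bold>\<not> (m \<^bold>= Zero)" for v m
    by (simp add: force_Compr inst_def)
  have Succ: "v |= Succ m \<^bold>\<in> ?S" if "ty v m = Some \<N>" for v m
    unfolding S using that by (auto intro!: force_impI dest: Succ_neq_Zero)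
  have k: "ty w k = Some \<N>" "w |= nat_le (Succ k) Zero"
    using assms by (simp_all add: mem_nats_below)
  have "w |= Zero \<^bold>\<in> ?S"
    using k(2) by (rule nat_leD) (simp, auto intro: Succ[OF k(1)] Succ simp: S[THEN iffD1])
  then show ?thesis
    unfolding S using force_impE[OF _ order_refl force_refl] by fastforce
qed

text \<open>
  Counting below \<open>n + 1\<close> splits off the last number. The order is defined by quantification over
  inductive sets, so the case distinction is encoded in one of them.
\<close>

lemma below_SuccE:
  assumes k: "w |= k \<^bold>\<in> nats_below (Succ n)" and n: "ty w n = Some \<N>" and \<chi>: "ty w \<chi> = Some \<Omega>"
    and less: "\<And>v. w \<le> v \<Longrightarrow> v |= k \<^bold>\<in> nats_below n \<Longrightarrow> v |= \<chi>"
    and eq: "\<And>v. w \<le> v \<Longrightarrow> v |= k \<^bold>= n \<Longrightarrow> v |= \<chi>"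
  shows "w |= \<chi>"
proof -
  have k: "ty w k = Some \<N>" "w |= nat_le (Succ k) (Succ n)"
    using k n by (simp_all add: mem_nats_below)
  \<comment> \<open>the successors of the numbers \<open>j \<ge> k\<close>, with \<open>j \<ge> k\<close> split into \<open>j = k\<close> and \<open>j > k\<close>\<close>
  let ?\<phi> = "\<lambda>m. \<^bold>\<exists>[\<N>] (\<up>m \<^bold>= Succ (V 0) \<^bold>\<and> (\<up>k \<^bold>= V 0 \<^bold>\<or> nat_le (Succ \<up>k) (V 0)))"
  let ?S = "Compr \<N> (\<^bold>\<exists>[\<N>] (V 1 \<^bold>= Succ (V 0) \<^bold>\<and> (\<up>\<up>k \<^bold>= V 0 \<^bold>\<or> nat_le (Succ \<up>\<up>k) (V 0))))"
  have S: "v |= m \<^bold>\<in> ?S \<longleftrightarrow> ty v m = Some \<N> \<and> v |= ?\<phi> m" if "w \<le> v" for v m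
    using ty_mono[OF k(1) that] by (simp add: force_Compr inst_def)
  have SI: "v |= Succ j \<^bold>\<in> ?S" if v: "w \<le> v" and j: "ty v j = Some \<N>" "v |= k \<^bold>= j \<^bold>\<or> nat_le (Succ k) j" for v j
    unfolding S[OF v] using j ty_mono[OF k(1) v] force_refl[of v "Succ j"]
    by (auto intro!: force_exI[of _ _ j] simp: inst_def)
  have "w |= Succ n \<^bold>\<in> ?S"
    using k(2)
  proof (rule nat_leD)
    show "w |= Succ k \<^bold>\<in> ?S"
      by (rule SI) (use k(1) in \<open>auto intro!: force_orI1 force_refl\<close>)
    fix v m assume v: "w \<le> v" and m: "v |= m \<^bold>\<in> ?S"
    have tym: "ty v m = Some \<N>" and tyk: "ty v k = Some \<N>" using m S[OF v] ty_mono[OF k(1) v] by simp_all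
    have "v |= ?\<phi> m" using m S[OF v] by simp
    then show "v |= Succ m \<^bold>\<in> ?S"
    proof (rule force_exE)
      fix u j
      assume u: "v \<le> u" "ty u j = Some \<N>"
        and "u |= (\<up>m \<^bold>= Succ (V 0) \<^bold>\<and> (\<up>k \<^bold>= V 0 \<^bold>\<or> nat_le (Succ \<up>k) (V 0)))\<^bold>[j\<^bold>]"
      then have m: "u |= m \<^bold>= Succ j" and j: "u |= k \<^bold>= j \<^bold>\<or> nat_le (Succ k) j"
        by (simp_all add: inst_def)
      have tyk: "ty u k = Some \<N>" and tym: "ty u m = Some \<N>"
        using ty_mono[OF tyk u(1)] ty_mono[OF tym u(1)] by simp_all
      from j have "u |= nat_le (Succ k) (Succ j)"
      proof (rule force_orE)
        fix x assume x: "u \<le> x" "x |= k \<^bold>= j"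
        note tyk = ty_mono[OF tyk x(1)]
        show "x |= nat_le (Succ k) (Succ j)"
          using force_replace[OF x(2), of "nat_le (Succ \<up>k) (Succ (V 0))" \<N>] tyk nat_le_refl[of x "Succ k"]
          by (simp add: inst_def)
      qed (rule nat_le_Succ)
      then have "u |= nat_le (Succ k) m"
        using force_replace[OF force_sym[OF m], of "nat_le (Succ \<up>k) (V 0)" \<N>] tyk u(2)
        by (simp add: inst_def)
      then show "u |= Succ m \<^bold>\<in> ?S"
        using tym tyk by (intro SI order_trans[OF v u(1)]) (auto intro: force_orI2)
    qed (use tyk tym in simp)
  qed (use k(1) in simp)
  then have "w |= ?\<phi> (Succ n)" using S[OF order_refl] by simp
  then show ?thesis using \<chi>
  proof (rule force_exE)
    fix v j
    assume v: "w \<le> v" "ty v j = Some \<N>"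
      and "v |= (\<up>(Succ n) \<^bold>= Succ (V 0) \<^bold>\<and> (\<up>k \<^bold>= V 0 \<^bold>\<or> nat_le (Succ \<up>k) (V 0)))\<^bold>[j\<^bold>]"
    then have "v |= Succ n \<^bold>= Succ j" and j: "v |= k \<^bold>= j \<^bold>\<or> nat_le (Succ k) j"
      by (simp_all add: inst_def)
    then have "v |= n \<^bold>= j" by (simp add: forces_def prv.succ_inj)
    then have jn: "v |= j \<^bold>= n" by (rule force_sym)
    note tyk = ty_mono[OF k(1) v(1)] and tyn = ty_mono[OF n v(1)]
    from j show "v |= \<chi>"
    proof (rule force_orE)
      fix u assume u: "v \<le> u" "u |= k \<^bold>= j"
      have "u |= k \<^bold>= n"
        using force_replace[OF force_mono[OF jn u(1)], of "\<up>k \<^bold>= V 0" \<N>] u(2) tyk[THEN ty_mono, OF u(1)]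
          v(2)[THEN ty_mono, OF u(1)] by (simp add: inst_def)
      then show "u |= \<chi>" by (rule eq[OF order_trans[OF v(1) u(1)]])
    next
      fix u assume u: "v \<le> u" "u |= nat_le (Succ k) j"
      have "u |= nat_le (Succ k) n"
        using force_replace[OF force_mono[OF jn u(1)], of "nat_le (Succ \<up>k) (V 0)" \<N>] u(2)
          tyk[THEN ty_mono, OF u(1)] v(2)[THEN ty_mono, OF u(1)] by (simp add: inst_def)
      then show "u |= \<chi>"
        using tyk[THEN ty_mono, OF u(1)] tyn[THEN ty_mono, OF u(1)]
        by (intro less[OF order_trans[OF v(1) u(1)]]) (simp add: mem_nats_below)
    qed
  qed
qed

lemma force_nat_induct:
  assumes Zero: "w |= Zero \<^bold>\<in> S" and S: "ty w S = Some (\<P> \<N>)" and n: "ty w n = Some \<N>"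
    and step: "\<And>v m. w \<le> v \<Longrightarrow> v |= m \<^bold>\<in> S \<Longrightarrow> v |= Succ m \<^bold>\<in> S"
  shows "w |= n \<^bold>\<in> S"
proof -
  have "w |= \<^bold>\<forall>[\<N>] (V 0 \<^bold>\<in> \<up>S \<^bold>\<rightarrow> Succ (V 0) \<^bold>\<in> \<up>S)"
    using step by (subst force_all_imp) (simp_all add: S inst_def)
  then show ?thesis
    using Zero n unfolding forces_def by (auto simp: typed_iff intro: prv.nat_induct)
qed

abbreviation ex_below :: "'b tm \<Rightarrow> 'b tm \<Rightarrow> 'b tm" where
  "ex_below n K \<equiv> \<^bold>\<exists>[\<N>] (V 0 \<^bold>\<in> \<up>(nats_below n) \<^bold>\<and> V 0 \<^bold>\<in> \<up>K)"

lemma ex_belowI: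
  assumes "w |= k \<^bold>\<in> nats_below n" "w |= k \<^bold>\<in> K" "ty w n = Some \<N>" "ty w K = Some (\<P> \<N>)"
  shows "w |= ex_below n K"
  using assms below_ty[OF assms(1,3)] by (intro force_exI[of _ _ k]) (simp_all add: inst_def)

lemma ex_belowE:
  assumes "w |= ex_below n K" "ty w \<chi> = Some \<Omega>"
    and *: "\<And>v k. w \<le> v \<Longrightarrow> v |= k \<^bold>\<in> nats_below n \<Longrightarrow> v |= k \<^bold>\<in> K \<Longrightarrow> v |= \<chi>"
  shows "w |= \<chi>"
  using assms(1,2) by (rule force_exE) (auto simp: inst_def intro: *)

text \<open>
  The hypothesis on \<open>K\<close> is part of the induction predicate: it has to be restricted from the
  numbers below \<open>m + 1\<close> to those below \<open>m\<close>.
\<close>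

lemma finite_join:
  assumes W: "ty w W = Some (\<P> \<Omega>)" and K: "ty w K = Some (\<P> \<N>)" and n: "ty w n = Some \<N>"
    and join: "w |= finite_join_closed W"
    and mem: "\<And>v k. w \<le> v \<Longrightarrow> v |= k \<^bold>\<in> nats_below n \<Longrightarrow> v |= (k \<^bold>\<in> K) \<^bold>\<in> W"
  shows "w |= ex_below n K \<^bold>\<in> W"
proof -
  have bot: "v |= \<^bold>\<bottom> \<^bold>\<in> W" if "w \<le> v" for v
    using force_mono[OF join that] ty_mono[OF W that] by (simp add: force_finite_join_closed)
  have or: "v |= (p \<^bold>\<or> q) \<^bold>\<in> W" if "w \<le> v" "v |= p \<^bold>\<in> W" "v |= q \<^bold>\<in> W" for v p q
    using join that W by (simp add: force_finite_join_closed)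
  let ?\<phi> = "\<^bold>\<forall>[\<N>] (V 0 \<^bold>\<in> nats_below (V (Suc 0)) \<^bold>\<rightarrow> (V 0 \<^bold>\<in> \<up>\<up>K) \<^bold>\<in> \<up>\<up>W)"
  let ?S = "Compr \<N> (?\<phi> \<^bold>\<rightarrow> (\<^bold>\<exists>[\<N>] (V 0 \<^bold>\<in> nats_below (V (Suc 0)) \<^bold>\<and> V 0 \<^bold>\<in> \<up>\<up>K)) \<^bold>\<in> \<up>W)"
  have S: "v |= m \<^bold>\<in> ?S \<longleftrightarrow> ty v m = Some \<N> \<and>
      (\<forall>u\<ge>v. (\<forall>x\<ge>u. \<forall>k. x |= k \<^bold>\<in> nats_below m \<longrightarrow> x |= (k \<^bold>\<in> K) \<^bold>\<in> W) \<longrightarrow> u |= ex_below m K \<^bold>\<in> W)"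
    if v: "w \<le> v" for v m
  proof (cases "ty v m = Some \<N>")
    case True
    note tyv = W[THEN ty_mono, OF v] K[THEN ty_mono, OF v] True
    have all: "u |= \<^bold>\<forall>[\<N>] (V 0 \<^bold>\<in> nats_below \<up>m \<^bold>\<rightarrow> (V 0 \<^bold>\<in> \<up>K) \<^bold>\<in> \<up>W) \<longleftrightarrow>
        (\<forall>x\<ge>u. \<forall>k. x |= k \<^bold>\<in> nats_below m \<longrightarrow> x |= (k \<^bold>\<in> K) \<^bold>\<in> W)" if u: "v \<le> u" for u
      using below_ty[OF _ ty_mono[OF ty_mono[OF True u]]]
      by (subst force_all_imp) (auto simp: tyv[THEN ty_mono, OF u] inst_def)
    have "\<up>(nats_below m) = nats_below \<up>m" by (simp add: shift_def nats_below_def nat_le_def ren_ren comp_def)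
    then show ?thesis
      using tyv all by (simp add: force_Compr inst_def force_imp)
  next
    case False
    then show ?thesis
      using mem_ty_elem[of v m ?S \<N>] W[THEN ty_mono, OF v] K[THEN ty_mono, OF v] by auto
  qed
  have "w |= n \<^bold>\<in> ?S"
  proof (rule force_nat_induct)
    have "v |= ex_below Zero K \<^bold>\<in> W" if v: "w \<le> v" for v
    proof (rule force_cong[OF bot[OF v]])
      note tyv = W[THEN ty_mono, OF v] K[THEN ty_mono, OF v]
      show "ty v (ex_below Zero K) = Some \<Omega>" "ty v W = Some (\<P> \<Omega>)" using tyv by simp_all
      show "u |= \<^bold>\<bottom> \<longleftrightarrow> u |= ex_below Zero K" if u: "v \<le> u" for u
      proof
        show "u |= \<^bold>\<bottom> \<Longrightarrow> u |= ex_below Zero K"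
          using tyv[THEN ty_mono, OF u] by (auto intro: force_bot)
        show "u |= \<^bold>\<bottom>" if "u |= ex_below Zero K"
          using that by (rule ex_belowE) (simp_all add: not_below_Zero)
      qed
    qed
    then show "w |= Zero \<^bold>\<in> ?S" by (simp add: S)
  next
    fix v m assume v: "w \<le> v" and m: "v |= m \<^bold>\<in> ?S"
    have tym: "ty v m = Some \<N>"
      and IH: "\<And>u. v \<le> u \<Longrightarrow> (\<And>x k. u \<le> x \<Longrightarrow> x |= k \<^bold>\<in> nats_below m \<Longrightarrow> x |= (k \<^bold>\<in> K) \<^bold>\<in> W) \<Longrightarrow>
        u |= ex_below m K \<^bold>\<in> W"
      using m by (simp_all add: S[OF v])
    have "u |= ex_below (Succ m) K \<^bold>\<in> W"
      if u: "v \<le> u" and H: "\<And>x k. u \<le> x \<Longrightarrow> x |= k \<^bold>\<in> nats_below (Succ m) \<Longrightarrow> x |= (k \<^bold>\<in> K) \<^bold>\<in> W" for u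
    proof -
      have wu: "w \<le> u" using v u by (rule order_trans)
      note tyu = W[THEN ty_mono, OF wu] K[THEN ty_mono, OF wu] tym[THEN ty_mono, OF u]
      have "u |= ex_below m K \<^bold>\<in> W"
        by (rule IH[OF u]) (use H below_SuccI1 tyu(3)[THEN ty_mono] in blast)
      moreover have "u |= (m \<^bold>\<in> K) \<^bold>\<in> W"
        by (rule H[OF order_refl below_SuccI2[OF tyu(3)]])
      ultimately have "u |= (ex_below m K \<^bold>\<or> m \<^bold>\<in> K) \<^bold>\<in> W" by (rule or[OF wu])
      then show ?thesis
      proof (rule force_cong)
        fix x assume x: "u \<le> x"
        note tyx = tyu[THEN ty_mono, OF x]
        show "x |= ex_below m K \<^bold>\<or> m \<^bold>\<in> K \<longleftrightarrow> x |= ex_below (Succ m) K"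
        proof
          assume "x |= ex_below m K \<^bold>\<or> m \<^bold>\<in> K"
          then show "x |= ex_below (Succ m) K"
          proof (rule force_orE)
            fix y assume y: "x \<le> y" "y |= ex_below m K"
            note tyy = tyx[THEN ty_mono, OF y(1)]
            show "y |= ex_below (Succ m) K"
              using y(2)
            proof (rule ex_belowE)
              fix z k assume z: "y \<le> z" "z |= k \<^bold>\<in> nats_below m" "z |= k \<^bold>\<in> K"
              note tyz = tyy[THEN ty_mono, OF z(1)]
              show "z |= ex_below (Succ m) K"
                by (rule ex_belowI[OF below_SuccI1[OF z(2)] z(3)]) (simp_all add: tyz)
            qed (simp add: tyy)
          next
            fix y assume y: "x \<le> y" "y |= m \<^bold>\<in> K"
            note tyy = tyx[THEN ty_mono, OF y(1)]
            show "y |= ex_below (Succ m) K"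
              by (rule ex_belowI[OF below_SuccI2 y(2)]) (simp_all add: tyy)
          qed
        next
          assume "x |= ex_below (Succ m) K"
          then show "x |= ex_below m K \<^bold>\<or> m \<^bold>\<in> K"
          proof (rule ex_belowE)
            fix y k assume y: "x \<le> y" "y |= k \<^bold>\<in> nats_below (Succ m)" and k: "y |= k \<^bold>\<in> K"
            note tyy = tyx[THEN ty_mono, OF y(1)]
            show "y |= ex_below m K \<^bold>\<or> m \<^bold>\<in> K"
              using y(2) tyy(3)
            proof (rule below_SuccE)
              fix z assume z: "y \<le> z"
              note tyz = tyy[THEN ty_mono, OF z] and kz = force_mono[OF k z]
              show "z |= ex_below m K \<^bold>\<or> m \<^bold>\<in> K" if "z |= k \<^bold>\<in> nats_below m"
                by (rule force_orI1[OF ex_belowI[OF that kz]]) (simp_all add: tyz)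
              show "z |= ex_below m K \<^bold>\<or> m \<^bold>\<in> K" if "z |= k \<^bold>= m"
                by (rule force_orI2[OF force_mem_eq[OF that kz]]) (simp add: tyz)
            qed (simp add: tyy)
          qed (simp add: tyx)
        qed
      qed (simp_all add: tyu)
    qed
    then show "v |= Succ m \<^bold>\<in> ?S" by (simp add: S[OF v] tym)
  qed (simp_all add: W K n)
  then show ?thesis using mem by (simp add: S)
qed

lemma id_mapI:
  assumes "w |= x \<^bold>\<in> X" "ty w X = Some (\<P> A)"
  shows "w |= \<langle>x, x\<rangle> \<^bold>\<in> id_map A X"
  using assms mem_ty_elem[OF assms] force_refl[of w "\<langle>x, x\<rangle>"] unfolding id_map_def
  by (auto simp: force_Compr inst_def intro!: force_exI[of _ _ x])

lemma id_mapD: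
  assumes "w |= \<langle>x, y\<rangle> \<^bold>\<in> id_map A X" "ty w X = Some (\<P> A)"
  shows "w |= x \<^bold>\<in> X" "w |= x \<^bold>= y"
proof -
  have "ty w \<langle>x, y\<rangle> = Some (A \<^bold>\<times> A)" using assms(1) by (rule mem_ty_elem) (simp add: assms)
  then have ty: "ty w x = Some A" "ty w y = Some A" by (auto split: option.splits)
  have "w |= \<^bold>\<exists>[A, X] (\<langle>\<up>x, \<up>y\<rangle> \<^bold>= \<langle>V 0, V 0\<rangle>)"
    using assms ty unfolding id_map_def by (simp add: force_Compr inst_def)
  then have "w |= x \<^bold>\<in> X \<^bold>\<and> x \<^bold>= y"
  proof (rule force_exE)
    fix v a
    assume v: "w \<le> v" "ty v a = Some A" "v |= (V 0 \<^bold>\<in> \<up>X \<^bold>\<and> \<langle>\<up>x, \<up>y\<rangle> \<^bold>= \<langle>V 0, V 0\<rangle>)\<^bold>[a\<^bold>]"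
    then have a: "v |= a \<^bold>\<in> X" and "v |= \<langle>x, y\<rangle> \<^bold>= \<langle>a, a\<rangle>" by (simp_all add: inst_def)
    then have "v |= x \<^bold>= a" "v |= y \<^bold>= a"
      unfolding forces_def by (blast intro: prv.pair_inj1 prv.pair_inj2)+
    then show "v |= x \<^bold>\<in> X \<^bold>\<and> x \<^bold>= y"
      using force_mem_eq[OF force_sym a] force_replace[OF force_sym[of v y a], of "\<up>x \<^bold>= V 0" A] v(2)
        ty[THEN ty_mono, OF v(1)] by (simp add: inst_def)
  qed (use ty assms in simp)
  then show "w |= x \<^bold>\<in> X" "w |= x \<^bold>= y" by simp_all
qed

lemma app_in_id:
  assumes "w |= app_in A (id_map A X) x S"
    "ty w X = Some (\<P> A)" "ty w S = Some (\<P> A)" "ty w x = Some A"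
  shows "w |= x \<^bold>\<in> S"
  using assms(1)
proof (rule app_inE)
  fix v y assume v: "w \<le> v" "v |= \<langle>x, y\<rangle> \<^bold>\<in> id_map A X" "v |= y \<^bold>\<in> S"
  then show "v |= x \<^bold>\<in> S"
    using force_mem_eq[OF force_sym[OF id_mapD(2)[OF v(2) ty_mono[OF assms(2) v(1)]]]] by blast
qed (use assms in simp)

lemma ex_in_idI:
  assumes "w |= x \<^bold>\<in> X" "w |= x \<^bold>\<in> S" "ty w X = Some (\<P> A)" "ty w S = Some (\<P> A)"
  shows "w |= ex_in A A (id_map A X) X S"
  using assms(1) app_inI[OF id_mapI[OF assms(1,3)] assms(2,4)]
  by (rule ex_inI) (simp_all add: assms)

lemma ex_in_idE:
  assumes "w |= ex_in A A (id_map A X) X S" "ty w \<chi> = Some \<Omega>" "ty w X = Some (\<P> A)" "ty w S = Some (\<P> A)"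
    and *: "\<And>v x. w \<le> v \<Longrightarrow> v |= x \<^bold>\<in> X \<Longrightarrow> v |= x \<^bold>\<in> S \<Longrightarrow> v |= \<chi>"
  shows "w |= \<chi>"
  using assms(1,2)
proof (rule ex_inE)
  fix v x assume v: "w \<le> v" "v |= x \<^bold>\<in> X" "v |= app_in A (id_map A X) x S"
  note ty = assms(3,4)[THEN ty_mono, OF v(1)]
  show "v |= \<chi>"
    using *[OF v(1,2)] app_in_id[OF v(3) ty mem_ty_elem[OF v(2) ty(1)]] by blast
qed

lemma finite_setE:
  assumes "w |= finite_set A X" "ty w \<chi> = Some \<Omega>" "ty w X = Some (\<P> A)"
    and *: "\<And>v n g. w \<le> v \<Longrightarrow> ty v n = Some \<N> \<Longrightarrow> ty v g = Some (\<P> (\<N> \<^bold>\<times> A)) \<Longrightarrow>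
      v |= is_map \<N> A g (nats_below n) X \<Longrightarrow> v |= \<^bold>\<forall>[A, X] \<^bold>\<exists>[\<N>] (\<langle>V 0, V 1\<rangle> \<^bold>\<in> \<up>\<up>g) \<Longrightarrow> v |= \<chi>"
  shows "w |= \<chi>"
  using assms(1)[unfolded finite_set_def] assms(2)
proof (rule force_exE, goal_cases)
  case (1 v n)
  then have "v |= \<^bold>\<exists>[\<P> (\<N> \<^bold>\<times> A)]
        (is_map \<N> A (V 0) (nats_below \<up>n) \<up>X \<^bold>\<and> (\<^bold>\<forall>[A, \<up>X] \<^bold>\<exists>[\<N>] (\<langle>V 0, V 1\<rangle> \<^bold>\<in> V 2)))"
    by (simp add: inst_def numeral_2_eq_2)
  then show ?case
    using ty_mono[OF assms(2) 1(1)]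
  proof (rule force_exE, goal_cases)
    case u: (1 u g)
    then have "u |= is_map \<N> A g (nats_below n) X" "u |= \<^bold>\<forall>[A, X] \<^bold>\<exists>[\<N>] (\<langle>V 0, V 1\<rangle> \<^bold>\<in> \<up>\<up>g)"
      by (simp_all add: inst_def numeral_2_eq_2)
    then show ?case
      using *[OF order_trans[OF 1(1) u(1)] ty_mono[OF 1(2) u(1)] u(2)] by blast
  qed
qed

text \<open>
  An enumeration \<open>g\<close> of \<open>X\<close> turns the quantifier over \<open>X\<close> into one over an initial segment of
  the natural numbers, to which \<open>finite_join\<close> applies.
\<close>

lemma finite_set_join:
  assumes fin: "w |= finite_set A X" and join: "w |= finite_join_closed W"
    and U: "w |= tv_subset A W U X"
    and ty: "ty w X = Some (\<P> A)" "ty w U = Some (\<P> A)" "ty w W = Some (\<P> \<Omega>)"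
  shows "w |= ex_in A A (id_map A X) X U \<^bold>\<in> W"
  using fin _ ty(1)
proof (rule finite_setE)
  show "ty w (ex_in A A (id_map A X) X U \<^bold>\<in> W) = Some \<Omega>" by (simp add: ty)
  fix v n g
  assume v: "w \<le> v" and n: "ty v n = Some \<N>" and g: "ty v g = Some (\<P> (\<N> \<^bold>\<times> A))"
    and map: "v |= is_map \<N> A g (nats_below n) X"
    and onto: "v |= \<^bold>\<forall>[A, X] \<^bold>\<exists>[\<N>] (\<langle>V 0, V 1\<rangle> \<^bold>\<in> \<up>\<up>g)"
  note tyv = ty[THEN ty_mono, OF v] n g
  let ?K = "Compr \<N> (app_in A \<up>g (V 0) \<up>U)"
  have K: "u |= k \<^bold>\<in> ?K \<longleftrightarrow> ty u k = Some \<N> \<and> u |= app_in A g k U" if "v \<le> u" for u k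
    using tyv[THEN ty_mono, OF that] by (simp add: force_Compr inst_def)
  have "v |= ex_below n ?K \<^bold>\<in> W"
  proof (rule finite_join)
    show "v |= finite_join_closed W" by (rule force_mono[OF join v])
    fix u k assume u: "v \<le> u" and k: "u |= k \<^bold>\<in> nats_below n"
    note tyu = tyv[THEN ty_mono, OF u]
    have tyk: "ty u k = Some \<N>" using k tyu(4) by (rule below_ty)
    show "u |= (k \<^bold>\<in> ?K) \<^bold>\<in> W"
      using force_mono[OF map u] k
    proof (rule is_map_value)
      fix x y
      assume x: "u \<le> x" and y: "x |= \<langle>k, y\<rangle> \<^bold>\<in> g" "ty x y = Some A"
        and uniq: "\<And>t z. x \<le> t \<Longrightarrow> t |= \<langle>k, z\<rangle> \<^bold>\<in> g \<Longrightarrow> t |= z \<^bold>= y"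
      have vx: "v \<le> x" using u x by (rule order_trans)
      note tyx = tyu[THEN ty_mono, OF x] tyk[THEN ty_mono, OF x]
      have "x |= y \<^bold>\<in> X" by (rule is_map_dom(2)[OF map vx y(1) g])
      then have "x |= (y \<^bold>\<in> U) \<^bold>\<in> W"
        by (rule tv_subsetD2[OF U order_trans[OF v vx]]) (simp_all add: ty)
      then show "x |= (k \<^bold>\<in> ?K) \<^bold>\<in> W"
      proof (rule force_cong)
        fix t assume t: "x \<le> t"
        note tyt = tyx[THEN ty_mono, OF t] y(2)[THEN ty_mono, OF t]
        have "t |= app_in A g k U \<longleftrightarrow> t |= y \<^bold>\<in> U"
          by (rule app_in_value[OF force_mono[OF y(1) t] uniq[OF order_trans[OF t]]]) (simp_all add: tyt)
        then show "t |= y \<^bold>\<in> U \<longleftrightarrow> t |= k \<^bold>\<in> ?K" by (simp add: K[OF order_trans[OF vx t]] tyt)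
      qed (simp_all add: tyx)
    qed (simp_all add: tyu tyk)
  qed (simp_all add: tyv)
  then show "v |= ex_in A A (id_map A X) X U \<^bold>\<in> W"
  proof (rule force_cong)
    fix u assume u: "v \<le> u"
    note tyu = tyv[THEN ty_mono, OF u]
    show "u |= ex_below n ?K \<longleftrightarrow> u |= ex_in A A (id_map A X) X U"
    proof
      assume "u |= ex_below n ?K"
      then show "u |= ex_in A A (id_map A X) X U"
      proof (rule ex_belowE)
        fix x k assume x: "u \<le> x" "x |= k \<^bold>\<in> nats_below n" "x |= k \<^bold>\<in> ?K"
        have "x |= app_in A g k U" using x(3) K[OF order_trans[OF u x(1)]] by simp
        then show "x |= ex_in A A (id_map A X) X U"
        proof (rule app_inE)
          fix y a assume y: "x \<le> y" "y |= \<langle>k, a\<rangle> \<^bold>\<in> g" "y |= a \<^bold>\<in> U"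
          have uy: "u \<le> y" using x(1) y(1) by (rule order_trans)
          show "y |= ex_in A A (id_map A X) X U"
            using is_map_dom(2)[OF map order_trans[OF u uy] y(2) g] y(3)
            by (rule ex_in_idI) (simp_all add: tyu[THEN ty_mono, OF uy])
        qed (simp add: tyu[THEN ty_mono, OF x(1)])
      qed (simp add: tyu)
    next
      assume "u |= ex_in A A (id_map A X) X U"
      then show "u |= ex_below n ?K"
      proof (rule ex_in_idE)
        fix x a assume x: "u \<le> x" "x |= a \<^bold>\<in> X" "x |= a \<^bold>\<in> U"
        note vx = order_trans[OF u x(1)]
        note tyx = tyu[THEN ty_mono, OF x(1)]
        have tya: "ty x a = Some A" using x(2) tyx(1) by (rule mem_ty_elem)
        note 1 = force_allE[OF onto vx tya, unfolded inst_def, simplified]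
        have "x |= \<^bold>\<exists>[\<N>] (\<langle>V 0, \<up>a\<rangle> \<^bold>\<in> \<up>g)" using force_impE[OF 1 order_refl x(2)] .
        then show "x |= ex_below n ?K"
        proof (rule force_exE)
          fix y k assume y: "x \<le> y" "ty y k = Some \<N>" "y |= (\<langle>V 0, \<up>a\<rangle> \<^bold>\<in> \<up>g)\<^bold>[k\<^bold>]"
          have ka: "y |= \<langle>k, a\<rangle> \<^bold>\<in> g" using y(3) by (simp add: inst_def)
          note vy = order_trans[OF vx y(1)]
          note tyy = tyx[THEN ty_mono, OF y(1)]
          have "y |= app_in A g k U" by (rule app_inI[OF ka force_mono[OF x(3) y(1)] tyy(2)])
          then have "y |= k \<^bold>\<in> ?K" using K[OF vy] y(2) by simp
          with is_map_dom(1)[OF map vy ka g] show "y |= ex_below n ?K"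
            by (rule ex_belowI) (simp_all add: tyy)
        qed (simp add: tyx)
      qed (simp_all add: tyu)
    qed
  qed (simp_all add: tyv)
qed

lemma finite_sets_preserve:
  assumes join: "w |= finite_join_closed W" and W: "ty w W = Some (\<P> \<Omega>)"
  shows "w |= \<^bold>\<forall>[\<P> A] (finite_set A (V 0) \<^bold>\<rightarrow>
    ex_preserves A A \<up>W \<up>W (id_map A (V 0)) (V 0) (V 0))"
proof (subst force_all_imp, goal_cases)
  case 3
  have "v |= ex_preserves A A W W (id_map A X) X X"
    if v: "w \<le> v" and X: "ty v X = Some (\<P> A)" "v |= finite_set A X" for v X
  proof -
    note W' = ty_mono[OF W v]
    have "u |= ex_in A A (id_map A X) X U \<^bold>\<in> W"
      if u: "v \<le> u" and U: "ty u U = Some (\<P> A)" "u |= tv_subset A W U X" for u U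
      by (rule finite_set_join[OF force_mono[OF X(2) u] force_mono[OF join order_trans[OF v u]] U(2)])
         (simp_all add: X(1)[THEN ty_mono, OF u] U(1) ty_mono[OF W' u])
    then show ?thesis by (simp add: force_ex_preserves W' X)
  qed
  then show ?case by (simp add: inst_def)
qed (simp_all add: W)

lemma is_map_id:
  assumes X: "ty w X = Some (\<P> A)"
  shows "w |= is_map A A (id_map A X) X X"
  unfolding is_map_def force_and
proof
  show "w |= \<^bold>\<forall>[A] \<^bold>\<forall>[A] (\<langle>V 1, V 0\<rangle> \<^bold>\<in> \<up>\<up>(id_map A X) \<^bold>\<rightarrow> V 1 \<^bold>\<in> \<up>\<up>X \<^bold>\<and> V 0 \<^bold>\<in> \<up>\<up>X)"
  proof (rule force_allI, goal_cases)
    case (2 v x)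
    note X = ty_mono[OF X 2(1)] and x = 2(2)
    have "v |= \<^bold>\<forall>[A] (\<langle>\<up>x, V 0\<rangle> \<^bold>\<in> \<up>(id_map A X) \<^bold>\<rightarrow> \<up>x \<^bold>\<in> \<up>X \<^bold>\<and> V 0 \<^bold>\<in> \<up>X)"
    proof (subst force_all_imp, goal_cases)
      case 3
      have "u |= x \<^bold>\<in> X \<and> u |= y \<^bold>\<in> X" if "v \<le> u" "u |= \<langle>x, y\<rangle> \<^bold>\<in> id_map A X" for u y
        using id_mapD[OF that(2) ty_mono[OF X that(1)]] force_mem_eq by blast
      then show ?case by (simp add: inst_def)
    qed (use X x in simp_all)
    then show ?case by (simp add: inst_def)
  qed (simp add: X)
  show "w |= \<^bold>\<forall>[A, X] \<^bold>\<exists>[A] (\<langle>V 1, V 0\<rangle> \<^bold>\<in> \<up>\<up>(id_map A X) \<^bold>\<and>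
      (\<^bold>\<forall>[A] (\<langle>V 2, V 0\<rangle> \<^bold>\<in> \<up>\<up>\<up>(id_map A X) \<^bold>\<rightarrow> V 0 \<^bold>= V 1)))"
  proof (subst force_all_imp, goal_cases)
    case 3
    have "v |= \<^bold>\<exists>[A] (\<langle>\<up>x, V 0\<rangle> \<^bold>\<in> \<up>(id_map A X) \<^bold>\<and>
        (\<^bold>\<forall>[A] (\<langle>\<up>\<up>x, V 0\<rangle> \<^bold>\<in> \<up>\<up>(id_map A X) \<^bold>\<rightarrow> V 0 \<^bold>= V 1)))"
      if v: "w \<le> v" and x: "ty v x = Some A" "v |= x \<^bold>\<in> X" for v x
    proof (rule force_exI[of _ _ x])
      note X = ty_mono[OF X v]
      have "v |= \<^bold>\<forall>[A] (\<langle>\<up>x, V 0\<rangle> \<^bold>\<in> \<up>(id_map A X) \<^bold>\<rightarrow> V 0 \<^bold>= \<up>x)"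
      proof (subst force_all_imp, goal_cases)
        case 3
        have "u |= y \<^bold>= x" if "v \<le> u" "u |= \<langle>x, y\<rangle> \<^bold>\<in> id_map A X" for u y
          using force_sym[OF id_mapD(2)[OF that(2) ty_mono[OF X that(1)]]] .
        then show ?case by (simp add: inst_def)
      qed (use X x in simp_all)
      then show "v |= (\<langle>\<up>x, V 0\<rangle> \<^bold>\<in> \<up>(id_map A X) \<^bold>\<and>
        (\<^bold>\<forall>[A] (\<langle>\<up>\<up>x, V 0\<rangle> \<^bold>\<in> \<up>\<up>(id_map A X) \<^bold>\<rightarrow> V 0 \<^bold>= V 1)))\<^bold>[x\<^bold>]"
        using id_mapI[OF x(2) X] by (simp add: inst_def)
    qed (use x ty_mono[OF X v] in simp_all)
    then show ?case by (simp add: inst_def numeral_2_eq_2)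
  qed (simp_all add: X)
qed

lemma finite_nats_below:
  assumes n: "ty w n = Some \<N>"
  shows "w |= finite_set \<N> (nats_below n)"
proof -
  let ?X = "nats_below n"
  have X: "ty w ?X = Some (\<P> \<N>)" using n by simp
  have "w |= \<^bold>\<forall>[\<N>, ?X] \<^bold>\<exists>[\<N>] (\<langle>V 0, V 1\<rangle> \<^bold>\<in> \<up>\<up>(id_map \<N> ?X))"
  proof (subst force_all_imp, goal_cases)
    case 3
    have "v |= \<^bold>\<exists>[\<N>] (\<langle>V 0, \<up>x\<rangle> \<^bold>\<in> \<up>(id_map \<N> ?X))"
      if v: "w \<le> v" "ty v x = Some \<N>" "v |= x \<^bold>\<in> ?X" for v x
      using v id_mapI[OF v(3) ty_mono[OF X v(1)]] ty_mono[OF n v(1)]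
      by (intro force_exI[of _ _ x]) (simp_all add: inst_def)
    then show ?case by (simp add: inst_def)
  qed (simp_all add: n)
  then have "w |= \<^bold>\<exists>[\<P> (\<N> \<^bold>\<times> \<N>)] (is_map \<N> \<N> (V 0) (nats_below \<up>n) \<up>?X \<^bold>\<and>
      (\<^bold>\<forall>[\<N>, \<up>?X] \<^bold>\<exists>[\<N>] (\<langle>V 0, V 1\<rangle> \<^bold>\<in> V 2)))"
    using is_map_id[OF X] n
    by (intro force_exI[of _ _ "id_map \<N> ?X"]) (simp_all add: inst_def numeral_2_eq_2)
  then show ?thesis
    unfolding finite_set_def using n
    by (intro force_exI[of _ _ n]) (simp_all add: inst_def numeral_2_eq_2)
qed

text \<open>
  The finite sets in question are the initial segments \<open>{}\<close> and \<open>{0, 1}\<close> of the natural numbers,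
  each enumerated by its identity. The join of \<open>p\<close> and \<open>q\<close> is the quantifier over the subset of
  \<open>{0, 1}\<close> that contains \<open>0\<close> if \<open>p\<close> and \<open>1\<close> if \<open>q\<close>.
\<close>

lemma finite_overt_imp_join:
  assumes overt: "w |= finite_sets_overt T \<N>" and T: "ty w T = Some (\<P> \<Omega>)"
  shows "w |= finite_join_closed (open_tv T)"
proof -
  have ex: "v |= ex_in \<N> \<N> (id_map \<N> (nats_below n)) (nats_below n) U \<^bold>\<in> open_tv T"
    if v: "w \<le> v" and n: "ty v n = Some \<N>" and U: "ty v U = Some (\<P> \<N>)"
      "v |= tv_subset \<N> (open_tv T) U (nats_below n)" for v n U
  proof -
    note T' = ty_mono[OF T v]
    have "ty v (nats_below n) = Some (\<P> \<N>)" using n by simp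
    note 1 = force_allE[OF overt[unfolded finite_sets_overt_def overt_def] v this, unfolded inst_def, simplified]
    have "v |= ex_preserves \<N> \<N> (open_tv T) (open_tv T) (id_map \<N> (nats_below n)) (nats_below n) (nats_below n)"
      using force_impE[OF 1 order_refl finite_nats_below[OF n]] .
    then show ?thesis using U n T' by (simp add: force_ex_preserves)
  qed
  have bot: "w |= \<^bold>\<bottom> \<^bold>\<in> open_tv T"
  proof (rule force_cong[OF ex[OF order_refl]])
    let ?U = "Compr \<N> \<^bold>\<bottom>"
    show "w |= tv_subset \<N> (open_tv T) ?U (nats_below Zero)"
    proof (rule tv_subsetI)
      fix v t assume v: "w \<le> v"
      show "v |= t \<^bold>\<in> nats_below Zero" if "v |= t \<^bold>\<in> ?U"
        using that by (auto simp: force_Compr inst_def intro: force_bot)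
      show "v |= (t \<^bold>\<in> ?U) \<^bold>\<in> open_tv T" if "v |= t \<^bold>\<in> nats_below Zero"
        using not_below_Zero[OF that] below_ty[OF that] ty_mono[OF T v] by (auto intro: force_bot)
    qed (simp_all add: T)
    show "v |= ex_in \<N> \<N> (id_map \<N> (nats_below Zero)) (nats_below Zero) ?U \<longleftrightarrow> v |= \<^bold>\<bottom>" for v
    proof
      show "v |= \<^bold>\<bottom>" if "v |= ex_in \<N> \<N> (id_map \<N> (nats_below Zero)) (nats_below Zero) ?U"
        using that by (rule ex_in_idE) (simp_all add: not_below_Zero)
    qed (auto intro: force_bot)
  qed (simp_all add: T)
  have or: "v |= (p \<^bold>\<or> q) \<^bold>\<in> open_tv T"
    if v: "w \<le> v" and p: "v |= p \<^bold>\<in> open_tv T" and q: "v |= q \<^bold>\<in> open_tv T" for v p q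
  proof -
    let ?one = "Succ Zero"
    let ?U = "Compr \<N> ((V 0 \<^bold>= Zero \<^bold>\<and> \<up>p) \<^bold>\<or> (V 0 \<^bold>= ?one \<^bold>\<and> \<up>q))"
    let ?X = "nats_below (Succ ?one)"
    note T' = ty_mono[OF T v]
    have ty: "ty v p = Some \<Omega>" "ty v q = Some \<Omega>"
      using mem_ty_elem[OF p] mem_ty_elem[OF q] T' by simp_all
    have U: "u |= k \<^bold>\<in> ?U \<longleftrightarrow> ty u k = Some \<N> \<and> u |= (k \<^bold>= Zero \<^bold>\<and> p) \<^bold>\<or> (k \<^bold>= ?one \<^bold>\<and> q)" if "v \<le> u" for u k
      using ty[THEN ty_mono, OF that] by (simp add: force_Compr inst_def)
    have X0: "u |= Zero \<^bold>\<in> ?X" and X1: "u |= ?one \<^bold>\<in> ?X" for u :: "'a world"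
      by (simp_all add: below_SuccI1 below_SuccI2)
    have caseX: "u |= \<chi>"
      if k: "u |= k \<^bold>\<in> ?X" and \<chi>: "ty u \<chi> = Some \<Omega>"
        and *: "\<And>x. u \<le> x \<Longrightarrow> x |= k \<^bold>= Zero \<Longrightarrow> x |= \<chi>" "\<And>x. u \<le> x \<Longrightarrow> x |= k \<^bold>= ?one \<Longrightarrow> x |= \<chi>"
      for u :: "'a world" and k \<chi>
      using k _ \<chi>
    proof (rule below_SuccE)
      fix x assume x: "u \<le> x" "x |= k \<^bold>\<in> nats_below ?one"
      note \<chi>' = ty_mono[OF \<chi> x(1)]
      from x(2) _ \<chi>' show "x |= \<chi>"
      proof (rule below_SuccE)
        show "y |= \<chi>" if "x \<le> y" "y |= k \<^bold>\<in> nats_below Zero" for y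
          using not_below_Zero[OF that(2)] ty_mono[OF \<chi>' that(1)] by (rule force_bot)
        show "y |= \<chi>" if "x \<le> y" "y |= k \<^bold>= Zero" for y
          using order_trans[OF x(1) that(1)] that(2) by (rule *(1))
      qed simp
    qed (simp_all add: *(2))
    \<comment> \<open>the two alternatives in \<open>?U\<close> exclude each other\<close>
    have one_zero: "u |= \<^bold>\<bottom>" if "u |= k \<^bold>= Zero" "u |= k \<^bold>= ?one" for u :: "'a world" and k
    proof (rule Succ_neq_Zero)
      have "ty u k = Some \<N>" using eq_ty[OF force_sym[OF that(1)]] by simp
      then show "u |= ?one \<^bold>= Zero"
        using force_replace[OF that(2), of "V 0 \<^bold>= Zero" \<N>] that(1) by (simp add: inst_def)
    qed
    have opn: "v |= tv_subset \<N> (open_tv T) ?U ?X"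
    proof (rule tv_subsetI)
      fix u k assume u: "v \<le> u"
      note tyu = ty[THEN ty_mono, OF u] ty_mono[OF T' u]
      show "u |= k \<^bold>\<in> ?X" if "u |= k \<^bold>\<in> ?U"
      proof -
        have tyk: "ty u k = Some \<N>" and or: "u |= (k \<^bold>= Zero \<^bold>\<and> p) \<^bold>\<or> (k \<^bold>= ?one \<^bold>\<and> q)"
          using that U[OF u] by simp_all
        from or show ?thesis
        proof (rule force_orE)
          show "x |= k \<^bold>\<in> ?X" if "u \<le> x" "x |= k \<^bold>= Zero \<^bold>\<and> p" for x
            using that by (intro force_mem_eq[OF force_sym X0]) simp
          show "x |= k \<^bold>\<in> ?X" if "u \<le> x" "x |= k \<^bold>= ?one \<^bold>\<and> q" for x
            using that by (intro force_mem_eq[OF force_sym X1]) simp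
        qed
      qed
      show "u |= (k \<^bold>\<in> ?U) \<^bold>\<in> open_tv T" if k: "u |= k \<^bold>\<in> ?X"
      proof -
        have tyk: "ty u k = Some \<N>" using k by (rule below_ty) simp
        show ?thesis using k
        proof (rule caseX)
          show "ty u ((k \<^bold>\<in> ?U) \<^bold>\<in> open_tv T) = Some \<Omega>" using tyk tyu by simp
        next
          fix x assume x: "u \<le> x" "x |= k \<^bold>= Zero"
          have vx: "v \<le> x" using u x(1) by (rule order_trans)
          note tyx = tyu[THEN ty_mono, OF x(1)] tyk[THEN ty_mono, OF x(1)]
          show "x |= (k \<^bold>\<in> ?U) \<^bold>\<in> open_tv T"
          proof (rule force_cong[OF force_mono[OF p vx]])
            fix y assume y: "x \<le> y"
            note tyy = tyx[THEN ty_mono, OF y]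
            have "y |= p" if "y |= (k \<^bold>= Zero \<^bold>\<and> p) \<^bold>\<or> (k \<^bold>= ?one \<^bold>\<and> q)"
              using that
            proof (rule force_orE)
              show "z |= p" if "y \<le> z" "z |= k \<^bold>= ?one \<^bold>\<and> q" for z
                by (rule force_bot[OF one_zero[OF force_mono[OF x(2) order_trans[OF y that(1)]]]])
                   (use that(2) tyy(1)[THEN ty_mono, OF that(1)] in simp_all)
            qed simp
            moreover have "y |= (k \<^bold>= Zero \<^bold>\<and> p) \<^bold>\<or> (k \<^bold>= ?one \<^bold>\<and> q)" if "y |= p"
              using that force_mono[OF x(2) y] tyy by (intro force_orI1) simp_all
            ultimately show "y |= p \<longleftrightarrow> y |= k \<^bold>\<in> ?U" using U[OF order_trans[OF vx y]] tyy by blast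
          qed (simp_all add: tyx)
        next
          fix x assume x: "u \<le> x" "x |= k \<^bold>= ?one"
          have vx: "v \<le> x" using u x(1) by (rule order_trans)
          note tyx = tyu[THEN ty_mono, OF x(1)] tyk[THEN ty_mono, OF x(1)]
          show "x |= (k \<^bold>\<in> ?U) \<^bold>\<in> open_tv T"
          proof (rule force_cong[OF force_mono[OF q vx]])
            fix y assume y: "x \<le> y"
            note tyy = tyx[THEN ty_mono, OF y]
            have "y |= q" if "y |= (k \<^bold>= Zero \<^bold>\<and> p) \<^bold>\<or> (k \<^bold>= ?one \<^bold>\<and> q)"
              using that
            proof (rule force_orE)
              show "z |= q" if "y \<le> z" "z |= k \<^bold>= Zero \<^bold>\<and> p" for z
                by (rule force_bot[OF one_zero[OF _ force_mono[OF x(2) order_trans[OF y that(1)]]]])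
                   (use that(2) tyy(2)[THEN ty_mono, OF that(1)] in simp_all)
            qed simp
            moreover have "y |= (k \<^bold>= Zero \<^bold>\<and> p) \<^bold>\<or> (k \<^bold>= ?one \<^bold>\<and> q)" if "y |= q"
              using that force_mono[OF x(2) y] tyy by (intro force_orI2) simp_all
            ultimately show "y |= q \<longleftrightarrow> y |= k \<^bold>\<in> ?U" using U[OF order_trans[OF vx y]] tyy by blast
          qed (simp_all add: tyx)
        qed
      qed
    qed (simp_all add: T' ty)
    have "v |= ex_in \<N> \<N> (id_map \<N> ?X) ?X ?U \<^bold>\<in> open_tv T"
      by (rule ex[OF v _ _ opn]) (simp_all add: ty)
    then show ?thesis
    proof (rule force_cong)
      fix u assume u: "v \<le> u"
      note tyu = ty[THEN ty_mono, OF u]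
      show "u |= ex_in \<N> \<N> (id_map \<N> ?X) ?X ?U \<longleftrightarrow> u |= p \<^bold>\<or> q"
      proof
        assume "u |= ex_in \<N> \<N> (id_map \<N> ?X) ?X ?U"
        then show "u |= p \<^bold>\<or> q"
        proof (rule ex_in_idE)
          fix x k assume x: "u \<le> x" "x |= k \<^bold>\<in> ?U"
          note tyx = tyu[THEN ty_mono, OF x(1)]
          have "x |= (k \<^bold>= Zero \<^bold>\<and> p) \<^bold>\<or> (k \<^bold>= ?one \<^bold>\<and> q)" using U[OF order_trans[OF u x(1)]] x(2) by simp
          then show "x |= p \<^bold>\<or> q"
            by (rule force_orE) (use tyx[THEN ty_mono] in \<open>auto intro: force_orI1 force_orI2\<close>)
        qed (simp_all add: tyu)
      next
        assume "u |= p \<^bold>\<or> q"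
        then show "u |= ex_in \<N> \<N> (id_map \<N> ?X) ?X ?U"
        proof (rule force_orE)
          fix x assume x: "u \<le> x" "x |= p"
          note tyx = tyu[THEN ty_mono, OF x(1)]
          have "x |= (Zero \<^bold>= Zero \<^bold>\<and> p) \<^bold>\<or> (Zero \<^bold>= ?one \<^bold>\<and> q)"
            using x(2) tyx by (intro force_orI1) (simp_all add: force_refl)
          then have "x |= Zero \<^bold>\<in> ?U" using U[OF order_trans[OF u x(1)]] by simp
          with X0 show "x |= ex_in \<N> \<N> (id_map \<N> ?X) ?X ?U" by (rule ex_in_idI) (simp_all add: tyx)
        next
          fix x assume x: "u \<le> x" "x |= q"
          note tyx = tyu[THEN ty_mono, OF x(1)]
          have "x |= (?one \<^bold>= Zero \<^bold>\<and> p) \<^bold>\<or> (?one \<^bold>= ?one \<^bold>\<and> q)"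
            using x(2) tyx by (intro force_orI2) (simp_all add: force_refl)
          then have "x |= ?one \<^bold>\<in> ?U" using U[OF order_trans[OF u x(1)]] by simp
          with X1 show "x |= ex_in \<N> \<N> (id_map \<N> ?X) ?X ?U" by (rule ex_in_idI) (simp_all add: tyx)
        qed
      qed
    qed (simp_all add: ty T')
  qed
  show ?thesis using bot or T by (simp add: force_finite_join_closed)
qed

section \<open>From forcing to derivability\<close>

text \<open>
  The hypotheses are forced at the world that they form themselves, so a sequent may be proved
  at an arbitrary world which forces them.
\<close>

lemma prv_by_forcing:
  assumes "\<And>\<gamma>. \<gamma> \<in> \<Gamma> \<Longrightarrow> \<Delta> \<turnstile> \<gamma> \<^bold>: \<Omega>"
    and "\<And>w. ctx w = \<Delta> \<Longrightarrow> (\<And>\<gamma>. \<gamma> \<in> \<Gamma> \<Longrightarrow> w |= \<gamma>) \<Longrightarrow> w |= \<phi>"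
  shows "\<Delta> \<parallel> \<Gamma> \<turnstile> \<phi>"
proof -
  have w: "ctx (world \<Delta> \<Gamma>) = \<Delta>" "hyps (world \<Delta> \<Gamma>) = \<Gamma>"
    using world[of \<Gamma> \<Delta>, OF assms(1)] by blast+
  have "world \<Delta> \<Gamma> |= \<gamma>" if "\<gamma> \<in> \<Gamma>" for \<gamma>
    using prv.hyp[OF that assms(1)[OF that]] by (simp add: forces_def w)
  then have "world \<Delta> \<Gamma> |= \<phi>" using assms(2)[OF w(1)] by blast
  then show ?thesis by (simp add: forces_def w)
qed

lemma standing_typed:
  assumes "\<Delta> \<turnstile> T \<^bold>: \<P> \<Omega>" "\<gamma> \<in> standing T"
  shows "\<Delta> \<turnstile> \<gamma> \<^bold>: \<Omega>"
  using assms by (auto simp: standing_def tests_are_stable_opens_def typed_iff)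

lemma standing_setting:
  assumes "ty w T = Some (\<P> \<Omega>)" and "\<And>\<gamma>. \<gamma> \<in> standing T \<Longrightarrow> w |= \<gamma>"
  shows "setting T w"
  using assms finite_overt_imp_join[OF assms(2)]
  by (auto simp: setting_def standing_def tests_are_stable_opens_def simp del: setting_ty)

lemma prv_standing:
  assumes "\<Delta> \<turnstile> T \<^bold>: \<P> \<Omega>" and "\<And>\<gamma>. \<gamma> \<in> \<Gamma> \<Longrightarrow> \<Delta> \<turnstile> \<gamma> \<^bold>: \<Omega>"
    and "\<And>w. setting T w \<Longrightarrow> (\<And>\<gamma>. \<gamma> \<in> \<Gamma> \<Longrightarrow> w |= \<gamma>) \<Longrightarrow> w |= \<phi>"
  shows "\<Delta> \<parallel> standing T \<union> \<Gamma> \<turnstile> \<phi>"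
proof (rule prv_by_forcing)
  show "\<And>\<gamma>. \<gamma> \<in> standing T \<union> \<Gamma> \<Longrightarrow> \<Delta> \<turnstile> \<gamma> \<^bold>: \<Omega>"
    using standing_typed[OF assms(1)] assms(2) by blast
  fix w assume w: "ctx w = \<Delta>" "\<And>\<gamma>. \<gamma> \<in> standing T \<union> \<Gamma> \<Longrightarrow> w |= \<gamma>"
  have "setting T w" by (rule standing_setting) (use w assms(1) in \<open>simp_all add: typed_iff\<close>)
  then show "w |= \<phi>" using assms(3) w(2) by blast
qed

lemma shift_tvs: "\<up>(open_tv T) = open_tv \<up>T" "\<up>(closed_tv T) = closed_tv \<up>T"
  by (simp_all add: shift_def open_tv_def closed_tv_def ren_ren comp_def)

lemma finite_sets_overtI:
  assumes "ty w T = Some (\<P> \<Omega>)" "w |= finite_join_closed (open_tv T)"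
  shows "w |= finite_sets_overt T A"
  using finite_sets_preserve[OF assms(2), of A] assms(1)
  by (simp add: finite_sets_overt_def overt_def shift_tvs)

lemma finite_sets_condensedI:
  assumes "setting T w"
  shows "w |= finite_sets_condensed T A"
  using finite_sets_preserve[OF closed_finite_join_closed[OF assms], of A] setting_ty[OF assms]
  by (simp add: finite_sets_condensed_def condensed_def shift_tvs)

lemma stable_closed_subspaces:
  assumes w: "setting T w" and trans: "w |= transitive (stable_closed_tv T) A"
  shows "w |= \<^bold>\<forall>[\<P> A] \<^bold>\<forall>[\<P> A] (tv_subset A \<up>\<up>(stable_closed_tv T) (V 0) (V 1) \<^bold>\<rightarrow>
    subspace \<up>\<up>T A (V 0) (V 1))"
proof (rule force_allI, goal_cases)
  case (2 v X)
  note w = setting_mono[OF w 2(1)] and trans = force_mono[OF trans 2(1)] and X = 2(2)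
  have "v |= \<^bold>\<forall>[\<P> A] (tv_subset A \<up>(stable_closed_tv T) (V 0) \<up>X \<^bold>\<rightarrow> subspace \<up>T A (V 0) \<up>X)"
  proof (subst force_all_imp, goal_cases)
    case 3
    have "u |= subspace T A S X"
      if u: "v \<le> u" and S: "ty u S = Some (\<P> A)" "u |= tv_subset A (stable_closed_tv T) S X" for u S
      by (rule stable_closed_subspace[OF setting_mono[OF w u] force_mono[OF trans u] ty_mono[OF X u] S])
    then show ?case by (simp add: inst_def)
  qed (use w X in simp_all)
  then show ?case by (simp add: inst_def)
qed (use w in simp)

theorem theorem2p53:
  fixes \<Delta> :: "'b ty list" and T :: "'b tm"
  assumes "\<Delta> \<turnstile> T \<^bold>: \<P> \<Omega>"
  shows
    \<comment> \<open>the equivalent form of the hypothesis that finite sets are overt\<close>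
    "((\<Delta> \<parallel> standing T \<turnstile> finite_join_closed (open_tv T)) \<and>
      (\<forall>A. \<Delta> \<parallel> tests_are_stable_opens T \<union> {finite_join_closed (open_tv T)} \<turnstile> finite_sets_overt T A)) \<and>
     \<comment> \<open>(1)\<close>
     (\<Delta> \<parallel> standing T \<turnstile> closed_tv T \<^bold>= Compr \<Omega> ((\<^bold>\<not> V 0) \<^bold>\<in> \<up>(open_tv T))) \<and>
     \<comment> \<open>(2)\<close>
     (\<Delta> \<parallel> standing T \<turnstile> open_tv T \<^bold>= neg_set (closed_tv T)) \<and>
     \<comment> \<open>(3)\<close>
     (\<Delta> \<parallel> standing T \<turnstile> neg_set (neg_set (closed_tv T)) \<^bold>= neg_set (open_tv T) \<^bold>\<and>
        neg_set (open_tv T) \<^bold>= stable_closed_tv T) \<and>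
     \<comment> \<open>(4)\<close>
     (\<forall>A B. \<Delta> \<parallel> standing T \<turnstile> \<^bold>\<forall>[\<P> A] \<^bold>\<forall>[\<P> B] \<^bold>\<forall>[\<P> (A \<^bold>\<times> B)] (is_map A B (V 0) (V 2) (V 1) \<^bold>\<rightarrow>
        (strongly_condensed \<up>\<up>\<up>T A B (V 0) (V 2) (V 1) \<^bold>\<leftrightarrow> condensed \<up>\<up>\<up>T A B (V 0) (V 2) (V 1)) \<^bold>\<and>
        (condensed \<up>\<up>\<up>T A B (V 0) (V 2) (V 1) \<^bold>\<leftrightarrow> compact_map \<up>\<up>\<up>T A B (V 0) (V 2) (V 1)) \<^bold>\<and>
        (condensed \<up>\<up>\<up>T A B (V 0) (V 2) (V 1) \<^bold>\<leftrightarrow> condensed_on_stable \<up>\<up>\<up>T A B (V 0) (V 2) (V 1)))) \<and>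
     \<comment> \<open>(5)\<close>
     ((\<Delta> \<parallel> standing T \<turnstile> bounded_sublattice (closed_tv T)) \<and>
      (\<forall>A. \<Delta> \<parallel> standing T \<turnstile> finite_sets_condensed T A)) \<and>
     \<comment> \<open>(6)\<close>
     (\<Delta> \<parallel> standing T \<turnstile> inter \<Omega> (open_tv T) (closed_tv T) \<^bold>= decidable_tv \<^bold>\<and>
        decidable_tv \<^bold>= inter \<Omega> (open_tv T) (stable_closed_tv T)) \<and>
     \<comment> \<open>(7)\<close>
     ((\<forall>A. \<Delta> \<parallel> standing T \<union> {dominance T} \<turnstile> transitive (open_tv T) A) \<and>
      (\<Delta> \<parallel> standing T \<union> range (transitive (open_tv T)) \<turnstile> dominance T)) \<and>
     \<comment> \<open>(8)\<close>
     ((\<forall>A. \<Delta> \<parallel> standing T \<union> {codominance T} \<turnstile> transitive (closed_tv T) A) \<and>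
      (\<Delta> \<parallel> standing T \<union> range (transitive (closed_tv T)) \<turnstile> codominance T) \<and>
      (\<forall>A. \<Delta> \<parallel> standing T \<union> range (transitive (stable_closed_tv T)) \<turnstile>
         \<^bold>\<forall>[\<P> A] \<^bold>\<forall>[\<P> A] (tv_subset A \<up>\<up>(stable_closed_tv T) (V 0) (V 1) \<^bold>\<rightarrow>
           subspace \<up>\<up>T A (V 0) (V 1))))"
proof -
  have T: "tyof \<Delta> T = Some (\<P> \<Omega>)" using assms by (simp add: typed_iff)
  have by_setting: "\<Delta> \<parallel> standing T \<turnstile> \<phi>" if "\<And>w. setting T w \<Longrightarrow> w |= \<phi>" for \<phi>
    using prv_standing[OF assms, of "{}" \<phi>] that by simp
  show ?thesis
  proof (intro conjI HOL.allI)
    show "\<Delta> \<parallel> standing T \<turnstile> finite_join_closed (open_tv T)"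
      by (rule by_setting) (simp add: setting_def del: setting_ty)
    show "\<Delta> \<parallel> tests_are_stable_opens T \<union> {finite_join_closed (open_tv T)} \<turnstile> finite_sets_overt T A" for A
      by (rule prv_by_forcing)
         (use T in \<open>auto simp: tests_are_stable_opens_def typed_iff intro!: finite_sets_overtI\<close>)
    show "\<Delta> \<parallel> standing T \<turnstile> closed_tv T \<^bold>= Compr \<Omega> ((\<^bold>\<not> V 0) \<^bold>\<in> \<up>(open_tv T))"
      by (rule by_setting) (rule closed_tv_eq_neg_open)
    show "\<Delta> \<parallel> standing T \<turnstile> open_tv T \<^bold>= neg_set (closed_tv T)"
      by (rule by_setting) (rule open_tv_eq_neg_closed)
    show "\<Delta> \<parallel> standing T \<turnstile> neg_set (neg_set (closed_tv T)) \<^bold>= neg_set (open_tv T) \<^bold>\<and>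
        neg_set (open_tv T) \<^bold>= stable_closed_tv T"
      by (rule by_setting) (rule neg_open_eq_stable_closed)
    show "\<Delta> \<parallel> standing T \<turnstile> \<^bold>\<forall>[\<P> A] \<^bold>\<forall>[\<P> B] \<^bold>\<forall>[\<P> (A \<^bold>\<times> B)] (is_map A B (V 0) (V 2) (V 1) \<^bold>\<rightarrow>
        (strongly_condensed \<up>\<up>\<up>T A B (V 0) (V 2) (V 1) \<^bold>\<leftrightarrow> condensed \<up>\<up>\<up>T A B (V 0) (V 2) (V 1)) \<^bold>\<and>
        (condensed \<up>\<up>\<up>T A B (V 0) (V 2) (V 1) \<^bold>\<leftrightarrow> compact_map \<up>\<up>\<up>T A B (V 0) (V 2) (V 1)) \<^bold>\<and>
        (condensed \<up>\<up>\<up>T A B (V 0) (V 2) (V 1) \<^bold>\<leftrightarrow> condensed_on_stable \<up>\<up>\<up>T A B (V 0) (V 2) (V 1)))" for A B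
      by (rule by_setting) (rule map_notions_agree)
    show "\<Delta> \<parallel> standing T \<turnstile> bounded_sublattice (closed_tv T)"
      by (rule by_setting) (rule closed_bounded_sublattice)
    show "\<Delta> \<parallel> standing T \<turnstile> finite_sets_condensed T A" for A
      by (rule by_setting) (rule finite_sets_condensedI)
    show "\<Delta> \<parallel> standing T \<turnstile> inter \<Omega> (open_tv T) (closed_tv T) \<^bold>= decidable_tv \<^bold>\<and>
        decidable_tv \<^bold>= inter \<Omega> (open_tv T) (stable_closed_tv T)"
      by (rule by_setting) (rule open_inter_closed_decidable)
    show "\<Delta> \<parallel> standing T \<union> {dominance T} \<turnstile> transitive (open_tv T) A" for A
      by (rule prv_standing[OF assms]) (use T in \<open>auto simp: typed_iff intro: dominance_imp_transitive\<close>)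
    show "\<Delta> \<parallel> standing T \<union> range (transitive (open_tv T)) \<turnstile> dominance T"
      by (rule prv_standing[OF assms]) (use T in \<open>auto simp: typed_iff intro: transitive_imp_dominance\<close>)
    show "\<Delta> \<parallel> standing T \<union> {codominance T} \<turnstile> transitive (closed_tv T) A" for A
      by (rule prv_standing[OF assms]) (use T in \<open>auto simp: typed_iff intro: codominance_imp_transitive\<close>)
    show "\<Delta> \<parallel> standing T \<union> range (transitive (closed_tv T)) \<turnstile> codominance T"
      by (rule prv_standing[OF assms]) (use T in \<open>auto simp: typed_iff intro: transitive_imp_codominance\<close>)
    show "\<Delta> \<parallel> standing T \<union> range (transitive (stable_closed_tv T)) \<turnstile>
         \<^bold>\<forall>[\<P> A] \<^bold>\<forall>[\<P> A] (tv_subset A \<up>\<up>(stable_closed_tv T) (V 0) (V 1) \<^bold>\<rightarrow>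
           subspace \<up>\<up>T A (V 0) (V 1))" for A
      by (rule prv_standing[OF assms], (use T in \<open>auto simp: typed_iff\<close>)[1], rule stable_closed_subspaces) simp_all
  qed
qed

end
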